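(* Let $\mathfrak g$ be a finite-dimensional Lie algebra over a field $\mathbb K$ of characteristic zero. Let $(V,[\alpha])$ and $(W,[\beta])$ be two dg Loday–Pirashvili classes which are dg lifts of Loday–Pirashvili modules $(G,X)$ and $(H,Y)$, respectively, and suppose that $V$ is also a resolution of $G$. Then for every morphism of Loday–Pirashvili modules $\varphi\colon(G,X)\to(H,Y)$ there exists a unique morphism of dg Loday–Pirashvili classes $[f]\colon(V,[\alpha])\rightsquigarrow(W,[\beta])$ which is a dg lift of $\varphi$.
   Context: A dg $\mathfrak g$-module is a bounded cochain complex $(V^\bullet,d^V)$ of $\mathfrak g$-modules with $\mathfrak g$-equivariant differentials; $\Omega_{\mathfrak g}(V)=\wedge^\bullet\mathfrak g^\vee\otimes V$ (degree $p+q$ on $\wedge^p\mathfrak g^\vee\otimes V^q$) with total differential $d^V_{\mathrm{tot}}=d^V_{\mathrm{CE}}+d^V$, where $d^V_{\mathrm{CE}}$ is the Chevalley–Eilenberg differential and $d^V(\omega\otimes v)=(-1)^p\omega\otimes d^Vv$. A weak morphism $f\colon V\rightsquigarrow W$ is a degree $0$ $\Omega_{\mathfrak g}$-linear map $\Omega_{\mathfrak g}(V)\to\Omega_{\mathfrak g}(W)$ intertwining total differentials, with component $f_0^0\colon V^0\to W^0$; weak morphisms $f,f'$ are homotopic if $f'-f=d^W_{\mathrm{tot}}h+hd^V_{\mathrm{tot}}$ for some degree $-1$ $\Omega_{\mathfrak g}$-linear $h$, and $[f]$ denotes the homotopy class. $V$ is a resolution of $G$ if $V^i=0$ for $i<0$,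 $G\cong\ker d^V_0$ and $\mathbf H^i(V)=0$ for $i\geq 1$. A Loday–Pirashvili module $(G,X)$ is a $\mathfrak g$-module $G$ with a $\mathfrak g$-equivariant linear map $X\colon G\to\mathfrak g$ (adjoint action on $\mathfrak g$); a morphism $(G,X)\to(H,Y)$ is a $\mathfrak g$-module map $\varphi$ with $Y\circ\varphi=X$. A dg Loday–Pirashvili module $(V,\alpha)$ is a non-negative bounded dg $\mathfrak g$-module $V$ with a weak morphism $\alpha\colon V\rightsquigarrow\mathfrak g$ ($\mathfrak g$ concentrated in degree $0$); a dg Loday–Pirashvili class is $(V,[\alpha])$. A morphism of classes $[f]\colon(V,[\alpha])\rightsquigarrow(W,[\beta])$ is the homotopy class of a weak morphism $f\colon V\rightsquigarrow W$ with $\beta\circ f$ homotopic to $\alpha$. $\mathbf H^0$ sends $(V,[\alpha])$ to $(\ker d^V_0,\alpha_0|_{\ker d^V_0})$ and $[f]$ to $\mathbf H^0(f)=f_0^0|_{\ker d^V_0}$. $(V,[\alpha])$ is a dg lift of $(G,X)$ if $\mathbf H^0(V,[\alpha])\cong(G,X)$ as Loday–Pirashvili modules. A dg lift of $\varphi$ is a morphism $[f]$ such that $\mathbf H^0(f)$ corresponds to $\varphi$ under these isomorphisms. *)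

theory Defs
  imports Main "HOL.Vector_Spaces" "HOL-Combinatorics.Permutations"
begin

record ('k, 'g) lie =
  lsc :: "'k \<Rightarrow> 'g \<Rightarrow> 'g"
  lbr :: "'g \<Rightarrow> 'g \<Rightarrow> 'g"

definition lie_algebra :: "('k::field, 'g::ab_group_add) lie \<Rightarrow> bool" where
  "lie_algebra L \<longleftrightarrow> vector_space (lsc L) \<and>
     (\<forall>x y z. lbr L (x + y) z = lbr L x z + lbr L y z) \<and>
     (\<forall>x y z. lbr L x (y + z) = lbr L x y + lbr L x z) \<and>
     (\<forall>c x y. lbr L (lsc L c x) y = lsc L c (lbr L x y)) \<and>
     (\<forall>c x y. lbr L x (lsc L c y) = lsc L c (lbr L x y)) \<and>
     (\<forall>x. lbr L x x = 0) \<and>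
     (\<forall>x y z. lbr L x (lbr L y z) + lbr L y (lbr L z x) + lbr L z (lbr L x y) = 0)"

definition finite_dim :: "('k::field, 'g::ab_group_add) lie \<Rightarrow> bool" where
  "finite_dim L \<longleftrightarrow> (\<exists>B. finite B \<and> module.span (lsc L) B = UNIV)"

section \<open>dg g-modules: graded pieces are subspaces V i of an ambient space\<close>

record ('k, 'g, 'v) dgmod =
  vsc :: "'k \<Rightarrow> 'v \<Rightarrow> 'v"
  carr :: "int \<Rightarrow> 'v set"
  act :: "'g \<Rightarrow> 'v \<Rightarrow> 'v"
  dif :: "int \<Rightarrow> 'v \<Rightarrow> 'v"

definition dg_module :: "('k::field, 'g::ab_group_add) lie \<Rightarrow> ('k, 'g, 'v::ab_group_add) dgmod \<Rightarrow> bool" where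
  "dg_module L V \<longleftrightarrow> vector_space (vsc V) \<and>
     (\<forall>i. module.subspace (vsc V) (carr V i)) \<and>
     (\<forall>i x v. v \<in> carr V i \<longrightarrow> act V x v \<in> carr V i) \<and>
     (\<forall>i x y v. v \<in> carr V i \<longrightarrow> act V (x + y) v = act V x v + act V y v) \<and>
     (\<forall>i c x v. v \<in> carr V i \<longrightarrow> act V (lsc L c x) v = vsc V c (act V x v)) \<and>
     (\<forall>i x v w. v \<in> carr V i \<longrightarrow> w \<in> carr V i \<longrightarrow> act V x (v + w) = act V x v + act V x w) \<and>
     (\<forall>i c x v. v \<in> carr V i \<longrightarrow> act V x (vsc V c v) = vsc V c (act V x v)) \<and>
     (\<forall>i x y v. v \<in> carr V i \<longrightarrow>
        act V (lbr L x y) v = act V x (act V y v) - act V y (act V x v)) \<and>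
     (\<forall>i v. v \<in> carr V i \<longrightarrow> dif V i v \<in> carr V (i + 1)) \<and>
     (\<forall>i v w. v \<in> carr V i \<longrightarrow> w \<in> carr V i \<longrightarrow> dif V i (v + w) = dif V i v + dif V i w) \<and>
     (\<forall>i c v. v \<in> carr V i \<longrightarrow> dif V i (vsc V c v) = vsc V c (dif V i v)) \<and>
     (\<forall>i x v. v \<in> carr V i \<longrightarrow> dif V i (act V x v) = act V x (dif V i v)) \<and>
     (\<forall>i v. v \<in> carr V i \<longrightarrow> dif V (i + 1) (dif V i v) = 0) \<and>
     (\<exists>N. \<forall>i. \<bar>i\<bar> > N \<longrightarrow> carr V i = {0})"

definition nonneg :: "('k, 'g, 'v::zero) dgmod \<Rightarrow> bool" where
  "nonneg V \<longleftrightarrow> (\<forall>i < 0. carr V i = {0})"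

definition adj :: "('k, 'g::zero) lie \<Rightarrow> ('k, 'g, 'g) dgmod" where
  "adj L = \<lparr>vsc = lsc L, carr = (\<lambda>i. if i = 0 then UNIV else {0}),
            act = lbr L, dif = (\<lambda>i v. 0)\<rparr>"

section \<open>Omega_g(V) = Lambda g^dual (x) V, realised as alternating multilinear maps\<close>

definition rm :: "nat \<Rightarrow> 'a list \<Rightarrow> 'a list" where
  "rm i xs = take i xs @ drop (Suc i) xs"

definition alt_form :: "('k, 'g::ab_group_add) lie \<Rightarrow> ('k \<Rightarrow> 'v \<Rightarrow> 'v) \<Rightarrow> 'v set \<Rightarrow> nat
    \<Rightarrow> ('g list \<Rightarrow> 'v::ab_group_add) \<Rightarrow> bool" where
  "alt_form L sv S p \<omega> \<longleftrightarrow>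
     (\<forall>xs. length xs = p \<longrightarrow> \<omega> xs \<in> S) \<and>
     (\<forall>xs. length xs \<noteq> p \<longrightarrow> \<omega> xs = 0) \<and>
     (\<forall>xs i y z. length xs = p \<longrightarrow> i < p \<longrightarrow>
        \<omega> (xs[i := y + z]) = \<omega> (xs[i := y]) + \<omega> (xs[i := z])) \<and>
     (\<forall>xs i c y. length xs = p \<longrightarrow> i < p \<longrightarrow>
        \<omega> (xs[i := lsc L c y]) = sv c (\<omega> (xs[i := y]))) \<and>
     (\<forall>xs i j. length xs = p \<longrightarrow> i < j \<longrightarrow> j < p \<longrightarrow> xs ! i = xs ! j \<longrightarrow> \<omega> xs = 0)"

definition sform :: "('k::field, 'g::ab_group_add) lie \<Rightarrow> nat \<Rightarrow> ('g list \<Rightarrow> 'k) \<Rightarrow> bool" where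
  "sform L k \<eta> \<longleftrightarrow> alt_form L (*) UNIV k \<eta>"

text \<open>Homogeneous elements of Omega_g(V) of total degree n: component p lies in
  Lambda^p g^dual (x) V^(n-p).\<close>
definition Om :: "('k, 'g::ab_group_add) lie \<Rightarrow> ('k, 'g, 'v::ab_group_add) dgmod \<Rightarrow> int
    \<Rightarrow> (nat \<Rightarrow> 'g list \<Rightarrow> 'v) set" where
  "Om L V n = {\<omega>. \<forall>p. alt_form L (vsc V) (carr V (n - int p)) p (\<omega> p)}"

definition wedge1 :: "('k \<Rightarrow> 'v \<Rightarrow> 'v) \<Rightarrow> nat \<Rightarrow> nat \<Rightarrow> ('g list \<Rightarrow> 'k::field)
    \<Rightarrow> ('g list \<Rightarrow> 'v::ab_group_add) \<Rightarrow> 'g list \<Rightarrow> 'v" where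
  "wedge1 sv k p \<eta> \<omega> xs =
     (if length xs = k + p then
        (\<Sum>\<sigma> \<in> {\<sigma>. \<sigma> permutes {0..<k + p}}.
           (let ys = map (\<lambda>i. xs ! \<sigma> i) [0..<k + p] in
            sv (of_int (sign \<sigma>) * \<eta> (take k ys) / of_nat (fact k * fact p)) (\<omega> (drop k ys))))
      else 0)"

definition wedge :: "('k, 'g, 'v) dgmod \<Rightarrow> nat \<Rightarrow> ('g list \<Rightarrow> 'k::field)
    \<Rightarrow> (nat \<Rightarrow> 'g list \<Rightarrow> 'v::ab_group_add) \<Rightarrow> nat \<Rightarrow> 'g list \<Rightarrow> 'v" where
  "wedge V k \<eta> \<omega> m = (if k \<le> m then wedge1 (vsc V) k (m - k) \<eta> (\<omega> (m - k)) else (\<lambda>xs. 0))"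

definition ce :: "('k::field, 'g::ab_group_add) lie \<Rightarrow> ('k, 'g, 'v::ab_group_add) dgmod \<Rightarrow> nat
    \<Rightarrow> ('g list \<Rightarrow> 'v) \<Rightarrow> 'g list \<Rightarrow> 'v" where
  "ce L V p \<omega> xs =
     (if length xs = p + 1 then
        (\<Sum>i < p + 1. vsc V ((-1) ^ i) (act V (xs ! i) (\<omega> (rm i xs)))) +
        (\<Sum>(i, j) \<in> {(i, j). i < j \<and> j < p + 1}.
           vsc V ((-1) ^ (i + j)) (\<omega> (lbr L (xs ! i) (xs ! j) # rm i (rm j xs))))
      else 0)"

text \<open>Total differential d_CE + d^V on Omega^n(V), landing in Omega^(n+1)(V);
  d^V(omega (x) v) = (-1)^p omega (x) d^V v.\<close>
definition dtot :: "('k::field, 'g::ab_group_add) lie \<Rightarrow> ('k, 'g, 'v::ab_group_add) dgmod \<Rightarrow> int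
    \<Rightarrow> (nat \<Rightarrow> 'g list \<Rightarrow> 'v) \<Rightarrow> nat \<Rightarrow> 'g list \<Rightarrow> 'v" where
  "dtot L V n \<omega> p xs =
     (if p = 0 then 0 else ce L V (p - 1) (\<omega> (p - 1)) xs) +
     (if length xs = p then vsc V ((-1) ^ p) (dif V (n - int p) (\<omega> p xs)) else 0)"

definition weak_mor :: "('k::field, 'g::ab_group_add) lie \<Rightarrow> ('k, 'g, 'v::ab_group_add) dgmod
    \<Rightarrow> ('k, 'g, 'w::ab_group_add) dgmod
    \<Rightarrow> (int \<Rightarrow> (nat \<Rightarrow> 'g list \<Rightarrow> 'v) \<Rightarrow> (nat \<Rightarrow> 'g list \<Rightarrow> 'w)) \<Rightarrow> bool" where
  "weak_mor L V W F \<longleftrightarrow>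
     (\<forall>n \<omega>. \<omega> \<in> Om L V n \<longrightarrow> F n \<omega> \<in> Om L W n) \<and>
     (\<forall>n \<omega> \<omega>'. \<omega> \<in> Om L V n \<longrightarrow> \<omega>' \<in> Om L V n \<longrightarrow>
        F n (\<lambda>p xs. \<omega> p xs + \<omega>' p xs) = (\<lambda>p xs. F n \<omega> p xs + F n \<omega>' p xs)) \<and>
     (\<forall>n c \<omega>. \<omega> \<in> Om L V n \<longrightarrow>
        F n (\<lambda>p xs. vsc V c (\<omega> p xs)) = (\<lambda>p xs. vsc W c (F n \<omega> p xs))) \<and>
     (\<forall>k \<eta> n \<omega>. sform L k \<eta> \<longrightarrow> \<omega> \<in> Om L V n \<longrightarrow>
        F (n + int k) (wedge V k \<eta> \<omega>) = wedge W k \<eta> (F n \<omega>)) \<and>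
     (\<forall>n \<omega>. \<omega> \<in> Om L V n \<longrightarrow> F (n + 1) (dtot L V n \<omega>) = dtot L W n (F n \<omega>))"

text \<open>Homotopy: a degree -1 Omega_g-linear map h (Koszul sign (-1)^k for k-forms)
  with F' - F = d h + h d.\<close>
definition homotopic :: "('k::field, 'g::ab_group_add) lie \<Rightarrow> ('k, 'g, 'v::ab_group_add) dgmod
    \<Rightarrow> ('k, 'g, 'w::ab_group_add) dgmod
    \<Rightarrow> (int \<Rightarrow> (nat \<Rightarrow> 'g list \<Rightarrow> 'v) \<Rightarrow> (nat \<Rightarrow> 'g list \<Rightarrow> 'w))
    \<Rightarrow> (int \<Rightarrow> (nat \<Rightarrow> 'g list \<Rightarrow> 'v) \<Rightarrow> (nat \<Rightarrow> 'g list \<Rightarrow> 'w)) \<Rightarrow> bool" where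
  "homotopic L V W F F' \<longleftrightarrow> (\<exists>h.
     (\<forall>n \<omega>. \<omega> \<in> Om L V n \<longrightarrow> h n \<omega> \<in> Om L W (n - 1)) \<and>
     (\<forall>n \<omega> \<omega>'. \<omega> \<in> Om L V n \<longrightarrow> \<omega>' \<in> Om L V n \<longrightarrow>
        h n (\<lambda>p xs. \<omega> p xs + \<omega>' p xs) = (\<lambda>p xs. h n \<omega> p xs + h n \<omega>' p xs)) \<and>
     (\<forall>n c \<omega>. \<omega> \<in> Om L V n \<longrightarrow>
        h n (\<lambda>p xs. vsc V c (\<omega> p xs)) = (\<lambda>p xs. vsc W c (h n \<omega> p xs))) \<and>
     (\<forall>k \<eta> n \<omega>. sform L k \<eta> \<longrightarrow> \<omega> \<in> Om L V n \<longrightarrow>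
        h (n + int k) (wedge V k \<eta> \<omega>) = (\<lambda>p xs. vsc W ((-1) ^ k) (wedge W k \<eta> (h n \<omega>) p xs))) \<and>
     (\<forall>n \<omega>. \<omega> \<in> Om L V n \<longrightarrow>
        (\<lambda>p xs. F' n \<omega> p xs - F n \<omega> p xs) =
        (\<lambda>p xs. dtot L W (n - 1) (h n \<omega>) p xs + h (n + 1) (dtot L V n \<omega>) p xs)))"

text \<open>Embedding of v in V^q as 1 (x) v in Omega^q(V), and the component f_0^0.\<close>
definition emb :: "'v::zero \<Rightarrow> nat \<Rightarrow> 'g list \<Rightarrow> 'v" where
  "emb v = (\<lambda>p xs. if p = 0 \<and> xs = [] then v else 0)"

definition f00 :: "(int \<Rightarrow> (nat \<Rightarrow> 'g list \<Rightarrow> 'v::zero) \<Rightarrow> (nat \<Rightarrow> 'g list \<Rightarrow> 'w)) \<Rightarrow> 'v \<Rightarrow> 'w" where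
  "f00 F v = F 0 (emb v) 0 []"

definition comp_wm ::
  "(int \<Rightarrow> (nat \<Rightarrow> 'g list \<Rightarrow> 'w) \<Rightarrow> (nat \<Rightarrow> 'g list \<Rightarrow> 'u))
   \<Rightarrow> (int \<Rightarrow> (nat \<Rightarrow> 'g list \<Rightarrow> 'v) \<Rightarrow> (nat \<Rightarrow> 'g list \<Rightarrow> 'w))
   \<Rightarrow> (int \<Rightarrow> (nat \<Rightarrow> 'g list \<Rightarrow> 'v) \<Rightarrow> (nat \<Rightarrow> 'g list \<Rightarrow> 'u))" where
  "comp_wm G F = (\<lambda>n \<omega>. G n (F n \<omega>))"

definition LP_module :: "('k::field, 'g::ab_group_add) lie \<Rightarrow> ('k \<Rightarrow> 'a \<Rightarrow> 'a)
    \<Rightarrow> ('g \<Rightarrow> 'a::ab_group_add \<Rightarrow> 'a) \<Rightarrow> ('a \<Rightarrow> 'g) \<Rightarrow> bool" where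
  "LP_module L sa aa X \<longleftrightarrow> vector_space sa \<and>
     (\<forall>x y v. aa (x + y) v = aa x v + aa y v) \<and>
     (\<forall>c x v. aa (lsc L c x) v = sa c (aa x v)) \<and>
     (\<forall>x v w. aa x (v + w) = aa x v + aa x w) \<and>
     (\<forall>c x v. aa x (sa c v) = sa c (aa x v)) \<and>
     (\<forall>x y v. aa (lbr L x y) v = aa x (aa y v) - aa y (aa x v)) \<and>
     (\<forall>v w. X (v + w) = X v + X w) \<and> (\<forall>c v. X (sa c v) = lsc L c (X v)) \<and>
     (\<forall>x v. X (aa x v) = lbr L x (X v))"

definition LP_mor :: "('k::field, 'g::ab_group_add) lie
    \<Rightarrow> ('k \<Rightarrow> 'a \<Rightarrow> 'a) \<Rightarrow> ('g \<Rightarrow> 'a::ab_group_add \<Rightarrow> 'a) \<Rightarrow> ('a \<Rightarrow> 'g)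
    \<Rightarrow> ('k \<Rightarrow> 'b \<Rightarrow> 'b) \<Rightarrow> ('g \<Rightarrow> 'b::ab_group_add \<Rightarrow> 'b) \<Rightarrow> ('b \<Rightarrow> 'g)
    \<Rightarrow> ('a \<Rightarrow> 'b) \<Rightarrow> bool" where
  "LP_mor L sa aa X sb ab Y \<phi> \<longleftrightarrow>
     (\<forall>v w. \<phi> (v + w) = \<phi> v + \<phi> w) \<and> (\<forall>c v. \<phi> (sa c v) = sb c (\<phi> v)) \<and>
     (\<forall>x v. \<phi> (aa x v) = ab x (\<phi> v)) \<and> (\<forall>v. Y (\<phi> v) = X v)"

definition ker0 :: "('k, 'g, 'v::zero) dgmod \<Rightarrow> 'v set" where
  "ker0 V = {v \<in> carr V 0. dif V 0 v = 0}"

definition dg_LP :: "('k::field, 'g::ab_group_add) lie \<Rightarrow> ('k, 'g, 'v::ab_group_add) dgmod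
    \<Rightarrow> (int \<Rightarrow> (nat \<Rightarrow> 'g list \<Rightarrow> 'v) \<Rightarrow> (nat \<Rightarrow> 'g list \<Rightarrow> 'g)) \<Rightarrow> bool" where
  "dg_LP L V \<alpha> \<longleftrightarrow> dg_module L V \<and> nonneg V \<and> weak_mor L V (adj L) \<alpha>"

text \<open>iota is an isomorphism of Loday--Pirashvili modules
  H^0(V,[alpha]) = (ker d_0, alpha_0 restricted) --> (G, X).\<close>
definition H0_iso :: "('k::field, 'g::ab_group_add) lie \<Rightarrow> ('k, 'g, 'v::ab_group_add) dgmod
    \<Rightarrow> (int \<Rightarrow> (nat \<Rightarrow> 'g list \<Rightarrow> 'v) \<Rightarrow> (nat \<Rightarrow> 'g list \<Rightarrow> 'g))
    \<Rightarrow> ('k \<Rightarrow> 'a \<Rightarrow> 'a) \<Rightarrow> ('g \<Rightarrow> 'a::ab_group_add \<Rightarrow> 'a) \<Rightarrow> ('a \<Rightarrow> 'g)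
    \<Rightarrow> ('v \<Rightarrow> 'a) \<Rightarrow> bool" where
  "H0_iso L V \<alpha> sa aa X \<iota> \<longleftrightarrow> bij_betw \<iota> (ker0 V) UNIV \<and>
     (\<forall>v \<in> ker0 V. \<forall>w \<in> ker0 V. \<iota> (v + w) = \<iota> v + \<iota> w) \<and>
     (\<forall>c. \<forall>v \<in> ker0 V. \<iota> (vsc V c v) = sa c (\<iota> v)) \<and>
     (\<forall>x. \<forall>v \<in> ker0 V. \<iota> (act V x v) = aa x (\<iota> v)) \<and>
     (\<forall>v \<in> ker0 V. X (\<iota> v) = f00 \<alpha> v)"

definition acyclic_pos :: "('k, 'g, 'v::ab_group_add) dgmod \<Rightarrow> bool" where
  "acyclic_pos V \<longleftrightarrow> (\<forall>i \<ge> 1. \<forall>v \<in> carr V i. dif V i v = 0 \<longrightarrow>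
       (\<exists>u \<in> carr V (i - 1). dif V (i - 1) u = v))"

end

theory Submission
  imports Defs "Jordan_Normal_Form.Determinant"
begin

text \<open>
  Let \<open>K = ker d\<^sub>0\<close> for the resolution \<open>V\<close>, and let \<open>D\<close> denote total differentials. Choose a linear
  (not equivariant) contraction \<open>s\<close> of \<open>V\<close> onto \<open>K\<close> and extend it to an \<open>\<Omega>\<close>-linear map \<open>h\<close>. Then
  \<open>P = 1 - (D h + h D)\<close> is a weak endomorphism of \<open>V\<close> homotopic to the identity. It is the projection
  onto \<open>K\<close> minus a term raising the form degree by one, so, \<open>V\<close> being bounded, a power \<open>Q\<close> of \<open>P\<close>
  takes values in \<open>\<Omega>(K)\<close>.

  A weak morphism from \<open>K\<close> to a non-negative module is determined by its component in form degree
  \<open>0\<close>, since \<open>\<Omega>(K)\<close> is generated by \<open>K\<close>. Hence \<open>f = \<psi> \<circ> Q\<close>, with \<open>\<psi>\<close> the map of kernels given by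
  \<open>\<phi>\<close>, satisfies \<open>\<beta> \<circ> f = \<alpha> \<circ> Q \<simeq> \<alpha>\<close>, and any other lift \<open>f'\<close> satisfies \<open>f' \<simeq> f' \<circ> Q = \<psi> \<circ> Q = f\<close>.

  The identities \<open>D\<^sup>2 = 0\<close> and the \<open>\<Omega>\<close>-linearity of \<open>P\<close> are proved by induction on the form
  degree, using Cartan's formula for the contraction of \<open>d\<^sub>C\<^sub>E \<omega>\<close> and the derivation rule for the
  contraction of a wedge product.
\<close>

text \<open>The obstacle is that the kernel need not have an invariant complement, so
  \<open>s\<close> cannot in general be equivariant and \<open>D h + h D\<close> picks up the
  commutator of d_CE with \<open>s\<close>. This commutator has to be linear over the scalar forms
  although d_CE is only a derivation: in a product with eta the two terms containing d eta cancel.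
  The proof reaches this without a Leibniz rule. Contracting the commutator with x gives the
  commutator of the Lie derivative L_x with \<open>s\<close>, which acts on values only, minus the
  commutator applied to the contracted form.

  Passing to \<open>Q\<close> replaces a degree by degree construction of \<open>f\<close> and of
  the homotopies: both are obtained from the single homotopy between the identity and
  \<open>Q\<close>, and on forms with values in K, which sits in degree 0, the comparisons become
  equalities. Characteristic zero is used for the factor 1 / (k! p!) of the wedge product and for
  dividing by the form degree when a form is rebuilt from its contractions.\<close>

section \<open>Alternating forms and contraction of the first argument\<close>

definition ctr :: "'g \<Rightarrow> ('g list \<Rightarrow> 'v) \<Rightarrow> 'g list \<Rightarrow> 'v" where
  "ctr x \<omega> = (\<lambda>xs. \<omega> (x # xs))"

lemma ctr_apply [simp]: "ctr x \<omega> xs = \<omega> (x # xs)"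
  by (simp add: ctr_def)

lemma alt_form_mem: "alt_form L sv S p \<omega> \<Longrightarrow> length xs = p \<Longrightarrow> \<omega> xs \<in> S"
  and alt_form_zero: "alt_form L sv S p \<omega> \<Longrightarrow> length xs \<noteq> p \<Longrightarrow> \<omega> xs = 0"
  and alt_form_add: "alt_form L sv S p \<omega> \<Longrightarrow> length xs = p \<Longrightarrow> i < p \<Longrightarrow>
        \<omega> (xs[i := y + z]) = \<omega> (xs[i := y]) + \<omega> (xs[i := z])"
  and alt_form_scale: "alt_form L sv S p \<omega> \<Longrightarrow> length xs = p \<Longrightarrow> i < p \<Longrightarrow>
        \<omega> (xs[i := lsc L c y]) = sv c (\<omega> (xs[i := y]))"
  and alt_form_alt: "alt_form L sv S p \<omega> \<Longrightarrow> length xs = p \<Longrightarrow> i < j \<Longrightarrow> j < p \<Longrightarrow>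
        xs ! i = xs ! j \<Longrightarrow> \<omega> xs = 0"
  by (simp_all add: alt_form_def)

lemma alt_form_mem':
  assumes "alt_form L sv S p \<omega>" "0 \<in> S"
  shows "\<omega> xs \<in> S"
  using assms by (cases "length xs = p") (auto simp: alt_form_mem alt_form_zero)

lemma alt_form_Cons_add:
  "alt_form L sv S (Suc p) \<omega> \<Longrightarrow> length zs = p \<Longrightarrow> \<omega> ((x + y) # zs) = \<omega> (x # zs) + \<omega> (y # zs)"
  using alt_form_add[of L sv S "Suc p" \<omega> "x # zs" 0 x y] by simp

lemma alt_form_Cons_scale:
  "alt_form L sv S (Suc p) \<omega> \<Longrightarrow> length zs = p \<Longrightarrow> \<omega> (lsc L c x # zs) = sv c (\<omega> (x # zs))"
  using alt_form_scale[of L sv S "Suc p" \<omega> "x # zs" 0 c x] by simp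

lemma alt_form_ctr:
  assumes "alt_form L sv S (Suc p) \<omega>"
  shows "alt_form L sv S p (ctr x \<omega>)"
proof -
  have "\<omega> (x # xs[i := y + z]) = \<omega> (x # xs[i := y]) + \<omega> (x # xs[i := z])"
    if "length xs = p" "i < p" for xs i y z
    using alt_form_add[OF assms, of "x # xs" "Suc i" y z] that by simp
  moreover have "\<omega> (x # xs[i := lsc L c y]) = sv c (\<omega> (x # xs[i := y]))"
    if "length xs = p" "i < p" for xs i c y
    using alt_form_scale[OF assms, of "x # xs" "Suc i" c y] that by simp
  moreover have "\<omega> (x # xs) = 0" if "length xs = p" "i < j" "j < p" "xs ! i = xs ! j" for xs i j
    using alt_form_alt[OF assms, of "x # xs" "Suc i" "Suc j"] that by simp
  ultimately show ?thesis
    using alt_form_mem[OF assms] alt_form_zero[OF assms] by (simp add: alt_form_def)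
qed

text \<open>Polarisation: expand the value on x + y, x + y. The hypotheses concern the first two
  slots alone, since \<open>alt_form_SucI\<close> applies this to a map not yet known to be
  alternating.\<close>

lemma alternating_swap:
  fixes \<omega> :: "'g::ab_group_add list \<Rightarrow> 'v::ab_group_add"
  assumes "\<And>x. \<omega> (x # x # zs) = 0"
    and "\<And>x y z. \<omega> ((x + y) # z # zs) = \<omega> (x # z # zs) + \<omega> (y # z # zs)"
    and "\<And>x y z. \<omega> (z # (x + y) # zs) = \<omega> (z # x # zs) + \<omega> (z # y # zs)"
  shows "\<omega> (x # y # zs) = - \<omega> (y # x # zs)"
proof -
  have "0 = \<omega> ((x + y) # (x + y) # zs)" by (simp only: assms(1))
  also have "\<dots> = \<omega> (x # y # zs) + \<omega> (y # x # zs)"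
    by (simp only: assms(2,3)) (simp add: assms(1) add.commute)
  finally show ?thesis by (metis eq_neg_iff_add_eq_0)
qed

lemma alt_form_eq01:
  assumes "alt_form L sv S p \<omega>"
  shows "\<omega> (x # x # zs) = 0"
proof (cases "length (x # x # zs) = p")
  case True
  then show ?thesis using alt_form_alt[OF assms, of "x # x # zs" 0 1] by simp
qed (use alt_form_zero[OF assms] in blast)

lemma alt_form_swap:
  assumes "alt_form L sv S p \<omega>"
  shows "\<omega> (x # y # zs) = - \<omega> (y # x # zs)"
proof (cases "p = Suc (Suc (length zs))")
  case True
  show ?thesis
  proof (rule alternating_swap)
    show "\<omega> (x # x # zs) = 0" for x by (rule alt_form_eq01[OF assms])
    show "\<omega> ((x + y) # z # zs) = \<omega> (x # z # zs) + \<omega> (y # z # zs)" for x y z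
      using alt_form_Cons_add[OF assms[unfolded True], of "z # zs" x y] by simp
    show "\<omega> (z # (x + y) # zs) = \<omega> (z # x # zs) + \<omega> (z # y # zs)" for x y z
      using alt_form_Cons_add[OF alt_form_ctr[OF assms[unfolded True], of z], of zs x y] by simp
  qed
qed (simp add: alt_form_zero[OF assms])

lemma alt_form_ctr_ctr_same: "alt_form L sv S p \<omega> \<Longrightarrow> ctr x (ctr x \<omega>) = (\<lambda>_. 0)"
  by (auto simp: fun_eq_iff dest: alt_form_eq01)

text \<open>The converse of \<open>alt_form_ctr\<close>, by which later forms are built inductively.
  Contractions control every slot except the first, so it remains to check linearity in the first
  slot and vanishing when the first two entries agree.\<close>

lemma alt_form_SucI:
  fixes \<omega> :: "'g::ab_group_add list \<Rightarrow> 'v::ab_group_add"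
  assumes ctr: "\<And>x. alt_form L sv S p (ctr x \<omega>)"
    and Nil: "\<omega> [] = 0"
    and add: "\<And>x y zs. length zs = p \<Longrightarrow> \<omega> ((x + y) # zs) = \<omega> (x # zs) + \<omega> (y # zs)"
    and scale: "\<And>c x zs. length zs = p \<Longrightarrow> \<omega> (lsc L c x # zs) = sv c (\<omega> (x # zs))"
    and eq01: "\<And>x zs. Suc (length zs) = p \<Longrightarrow> \<omega> (x # x # zs) = 0"
  shows "alt_form L sv S (Suc p) \<omega>"
  unfolding alt_form_def
proof (intro conjI allI impI)
  fix xs :: "'g list" assume "length xs = Suc p"
  then show "\<omega> xs \<in> S" using alt_form_mem[OF ctr] by (cases xs) auto
next
  fix xs :: "'g list" assume "length xs \<noteq> Suc p"
  then show "\<omega> xs = 0" using alt_form_zero[OF ctr] Nil by (cases xs) auto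
next
  fix xs :: "'g list" and i y z assume "length xs = Suc p" "i < Suc p"
  then show "\<omega> (xs[i := y + z]) = \<omega> (xs[i := y]) + \<omega> (xs[i := z])"
    using alt_form_add[OF ctr] add by (cases xs; cases i) auto
next
  fix xs :: "'g list" and i c y assume "length xs = Suc p" "i < Suc p"
  then show "\<omega> (xs[i := lsc L c y]) = sv c (\<omega> (xs[i := y]))"
    using alt_form_scale[OF ctr] scale by (cases xs; cases i) auto
next
  fix xs :: "'g list" and i j assume *: "length xs = Suc p" "i < j" "j < Suc p" "xs ! i = xs ! j"
  then obtain x0 ys where xs: "xs = x0 # ys" by (cases xs) auto
  show "\<omega> xs = 0"
  proof (cases i)
    case (Suc i')
    then show ?thesis using alt_form_alt[OF ctr[of x0], of ys i' "j - 1"] * xs by auto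
  next
    case 0
    from * 0 xs obtain x1 zs where ys: "ys = x1 # zs" by (cases ys) auto
    have len: "p = Suc (length zs)" using * xs ys by simp
    show ?thesis
    proof (cases "j = 1")
      case True
      then show ?thesis using eq01[of zs x0] * 0 xs ys len by simp
    next
      case False
      \<comment> \<open>The repetition involves the first entry and one beyond the second.
        Exchanging the first two entries moves it inside the contraction with \<open>x1\<close>, to
        positions 0 and j - 1.\<close>
      have "\<omega> xs = - \<omega> (x1 # x0 # zs)" unfolding xs ys
      proof (rule alternating_swap)
        show "\<omega> (x # x # zs) = 0" for x using eq01 len by simp
        show "\<omega> ((x + y) # z # zs) = \<omega> (x # z # zs) + \<omega> (y # z # zs)" for x y z
          using add[of "z # zs" x y] len by simp
        show "\<omega> (z # (x + y) # zs) = \<omega> (z # x # zs) + \<omega> (z # y # zs)" for x y z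
          using alt_form_Cons_add[OF ctr[of z, unfolded len], of zs x y] by simp
      qed
      moreover have "(x0 # zs) ! (j - 1) = xs ! j" using False * 0 xs ys by (cases j) (auto simp: nth_Cons')
      then have "\<omega> (x1 # x0 # zs) = 0"
        using alt_form_alt[OF ctr[of x1], of "x0 # zs" 0 "j - 1"] * 0 xs ys len False by simp
      ultimately show ?thesis by simp
    qed
  qed
qed

lemma alt_form_0_iff:
  "alt_form L sv S 0 \<omega> \<longleftrightarrow> \<omega> [] \<in> S \<and> (\<forall>xs. xs \<noteq> [] \<longrightarrow> \<omega> xs = 0)"
  by (auto simp: alt_form_def)

lemma form_eqI:
  assumes "\<omega> [] = \<omega>' []" "\<And>x. ctr x \<omega> = ctr x \<omega>'"
  shows "\<omega> = \<omega>'"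
proof
  fix xs show "\<omega> xs = \<omega>' xs"
    using assms by (cases xs) (auto simp: fun_eq_iff)
qed

lemma rm_0 [simp]: "rm 0 (x # xs) = xs"
  and rm_Suc [simp]: "rm (Suc i) (x # xs) = x # rm i xs"
  by (simp_all add: rm_def)

text \<open>Each of the j adjacent transpositions contributes a sign; if \<open>length xs\<close>
  differs from \<open>p\<close>, both sides vanish. This turns the bracket terms of
  \<open>ce\<close> into those of a Lie derivative.\<close>

lemma alt_form_move:
  assumes "vector_space sv" "alt_form L sv S p \<omega>" "j < length xs"
  shows "\<omega> (y # rm j xs) = sv ((-1) ^ j) (\<omega> (xs[j := y]))"
  using assms(2,3)
proof (induction j arbitrary: xs \<omega> p)
  interpret vector_space sv by fact
  case 0
  then show ?case by (cases xs) auto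
next
  interpret vector_space sv by fact
  case (Suc j)
  then obtain x zs where xs: "xs = x # zs" and j: "j < length zs" by (cases xs) auto
  show ?case
  proof (cases p)
    case 0
    then show ?thesis using xs alt_form_zero[OF Suc.prems(1)] by simp
  next
    case p: (Suc p')
    have "\<omega> (y # rm (Suc j) xs) = - ctr x \<omega> (y # rm j zs)"
      unfolding xs rm_Suc ctr_apply by (rule alt_form_swap[OF Suc.prems(1)])
    also have "ctr x \<omega> (y # rm j zs) = sv ((-1) ^ j) (ctr x \<omega> (zs[j := y]))"
      using Suc.IH[OF alt_form_ctr[OF Suc.prems(1)[unfolded p]] j] by simp
    finally show ?thesis by (simp add: xs)
  qed
qed

text \<open>Two scalars at once, so that sums, differences and multiples are instances;
  \<open>lieD_lin\<close>, \<open>ce_lin\<close> and \<open>dtot_lin\<close> follow the same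
  pattern.\<close>

lemma alt_form_lin:
  assumes "vector_space sv" "module.subspace sv S" "alt_form L sv S p \<omega>" "alt_form L sv S p \<omega>'"
  shows "alt_form L sv S p (\<lambda>xs. sv a (\<omega> xs) + sv b (\<omega>' xs))"
proof -
  interpret vector_space sv by fact
  show ?thesis
    using assms(2-4)
    by (simp add: alt_form_def subspace_add subspace_scale scale_right_distrib
        mult.commute)
qed

lemma alt_form_plus:
  assumes "vector_space sv" "module.subspace sv S" "alt_form L sv S p \<omega>" "alt_form L sv S p \<omega>'"
  shows "alt_form L sv S p (\<lambda>xs. \<omega> xs + \<omega>' xs)"
proof -
  interpret vector_space sv by fact
  show ?thesis using alt_form_lin[OF assms, of 1 1] by simp
qed

lemma alt_form_minus:
  assumes "vector_space sv" "module.subspace sv S" "alt_form L sv S p \<omega>" "alt_form L sv S p \<omega>'"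
  shows "alt_form L sv S p (\<lambda>xs. \<omega> xs - \<omega>' xs)"
proof -
  interpret vector_space sv by fact
  show ?thesis using alt_form_lin[OF assms, of 1 "-1"] by simp
qed

lemma alt_form_smult:
  assumes "vector_space sv" "module.subspace sv S" "alt_form L sv S p \<omega>"
  shows "alt_form L sv S p (\<lambda>xs. sv c (\<omega> xs))"
proof -
  interpret vector_space sv by fact
  show ?thesis using alt_form_lin[OF assms assms(3), of c 0] by simp
qed

lemma alt_form_zero_form:
  assumes "vector_space sv" "module.subspace sv S"
  shows "alt_form L sv S p (\<lambda>xs. 0)"
proof -
  interpret vector_space sv by fact
  show ?thesis using assms(2) by (simp add: alt_form_def subspace_0)
qed

lemma ctr_add:
  assumes "alt_form L sv S (Suc p) \<omega>"
  shows "ctr (x + y) \<omega> = (\<lambda>xs. ctr x \<omega> xs + ctr y \<omega> xs)"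
proof
  fix xs show "ctr (x + y) \<omega> xs = ctr x \<omega> xs + ctr y \<omega> xs"
    using alt_form_Cons_add[OF assms] alt_form_zero[OF assms] by (cases "length xs = p") auto
qed

lemma ctr_scale:
  assumes "vector_space sv" "alt_form L sv S (Suc p) \<omega>"
  shows "ctr (lsc L c x) \<omega> = (\<lambda>xs. sv c (ctr x \<omega> xs))"
proof
  interpret vector_space sv by fact
  fix xs show "ctr (lsc L c x) \<omega> xs = sv c (ctr x \<omega> xs)"
    using alt_form_Cons_scale[OF assms(2)] alt_form_zero[OF assms(2)] by (cases "length xs = p") auto
qed

text \<open>Separates the pairs containing the index 0. For \<open>ce\<close> on
  \<open>x # xs\<close> these are the brackets of x with the other arguments, and the remaining
  pairs are those of \<open>ce\<close> on the contracted form.\<close>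

lemma sum_pairs_Suc:
  "(\<Sum>(i, j)\<in>{(i, j). i < j \<and> j < Suc n}. f i j :: 'a::comm_monoid_add) =
   (\<Sum>j<n. f 0 (Suc j)) + (\<Sum>(i, j)\<in>{(i, j). i < j \<and> j < n}. f (Suc i) (Suc j))"
proof -
  have *: "(\<Sum>(i, j)\<in>{(i, j). i < j \<and> j < m}. g i j) = (\<Sum>j<m. \<Sum>i<j. g i j)"
    for g :: "nat \<Rightarrow> nat \<Rightarrow> 'a" and m
  proof -
    have "(\<Sum>j<m. \<Sum>i<j. g i j) = (\<Sum>(j, i)\<in>Sigma {..<m} (\<lambda>j. {..<j}). g i j)"
      by (rule sum.Sigma) auto
    also have "\<dots> = (\<Sum>(i, j)\<in>{(i, j). i < j \<and> j < m}. g i j)"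
      by (rule sum.reindex_bij_witness[where i = prod.swap and j = prod.swap]) auto
    finally show ?thesis ..
  qed
  show ?thesis
    unfolding * by (simp add: sum.lessThan_Suc_shift sum.distrib del: sum.lessThan_Suc)
qed

subsection \<open>The Cartan calculus\<close>

text \<open>The Lie derivative L_x of vector-valued forms. The sum runs over
  \<open>length xs\<close>, so no form degree has to be passed.\<close>

definition lieD :: "('k, 'g) lie \<Rightarrow> ('k, 'g, 'v::ab_group_add) dgmod \<Rightarrow> 'g \<Rightarrow> ('g list \<Rightarrow> 'v)
    \<Rightarrow> 'g list \<Rightarrow> 'v" where
  "lieD L V x \<omega> xs = act V x (\<omega> xs) - (\<Sum>j<length xs. \<omega> (xs[j := lbr L x (xs ! j)]))"

text \<open>The summand j = 0 puts [x, y] into the first slot; the others assemble to L_x of the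
  contracted form.\<close>

lemma ctr_lieD: "ctr y (lieD L V x \<omega>) = (\<lambda>xs. lieD L V x (ctr y \<omega>) xs - ctr (lbr L x y) \<omega> xs)"
  by (rule ext) (simp add: lieD_def sum.lessThan_Suc_shift del: sum.lessThan_Suc)

lemma lieD_Cons: "lieD L V x \<omega> (y # ys) = lieD L V x (ctr y \<omega>) ys - \<omega> (lbr L x y # ys)"
  using ctr_lieD[of y L V x \<omega>] by (metis ctr_apply)

lemma lie_algebra_simps:
  assumes "lie_algebra L"
  shows "lbr L (x + y) z = lbr L x z + lbr L y z" "lbr L x (y + z) = lbr L x y + lbr L x z"
    "lbr L (lsc L c x) y = lsc L c (lbr L x y)" "lbr L x (lsc L c y) = lsc L c (lbr L x y)"
    "lbr L x x = 0"
  using assms by (simp_all add: lie_algebra_def)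

lemma lie_algebra_anti:
  assumes "lie_algebra L"
  shows "lbr L x y = - lbr L y x"
proof -
  note l = lie_algebra_simps[OF assms]
  have "lbr L (x + y) (x + y) = 0" by (rule l)
  then show ?thesis unfolding l(1,2) by (simp add: l(5) eq_neg_iff_add_eq_0 add.commute)
qed

lemma lie_algebra_jacobi:
  assumes "lie_algebra L"
  shows "lbr L x (lbr L y z) = lbr L (lbr L x y) z + lbr L y (lbr L x z)"
proof -
  interpret vector_space "lsc L" using assms by (simp add: lie_algebra_def)
  have "lbr L x (lbr L y z) + lbr L y (lbr L z x) + lbr L z (lbr L x y) = 0"
    using assms by (simp add: lie_algebra_def)
  moreover have "lbr L y (lbr L z x) = - lbr L y (lbr L x z)"
    using lie_algebra_simps(4)[OF assms, of y "-1" "lbr L x z"] lie_algebra_anti[OF assms, of z x] by simp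
  moreover have "lbr L z (lbr L x y) = - lbr L (lbr L x y) z"
    by (rule lie_algebra_anti[OF assms])
  ultimately show ?thesis by (simp add: algebra_simps)
qed

locale lie_dgmod =
  fixes L :: "('k::field, 'g::ab_group_add) lie" and V :: "('k, 'g, 'v::ab_group_add) dgmod"
  assumes lie: "lie_algebra L" and dgm: "dg_module L V"
begin

sublocale vs: vector_space "vsc V"
  using dgm by (simp add: dg_module_def)

sublocale gs: vector_space "lsc L"
  using lie by (simp add: lie_algebra_def)

abbreviation form :: "int \<Rightarrow> nat \<Rightarrow> ('g list \<Rightarrow> 'v) \<Rightarrow> bool" where
  "form i \<equiv> alt_form L (vsc V) (carr V i)"

lemmas lbr_simps = lie_algebra_simps[OF lie]
lemmas lbr_jacobi = lie_algebra_jacobi[OF lie]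

lemma carr_subspace: "vs.subspace (carr V i)"
  using dgm by (simp add: dg_module_def)

lemmas carr_0 [simp] = vs.subspace_0[OF carr_subspace]
lemmas carr_add = vs.subspace_add[OF carr_subspace]
lemmas carr_scale = vs.subspace_scale[OF carr_subspace]
lemmas carr_diff = vs.subspace_diff[OF carr_subspace]
lemmas carr_sum = vs.subspace_sum[OF carr_subspace]

lemma act_mem: "v \<in> carr V i \<Longrightarrow> act V x v \<in> carr V i"
  and act_add_left: "v \<in> carr V i \<Longrightarrow> act V (x + y) v = act V x v + act V y v"
  and act_scale_left: "v \<in> carr V i \<Longrightarrow> act V (lsc L c x) v = vsc V c (act V x v)"
  and act_add: "v \<in> carr V i \<Longrightarrow> w \<in> carr V i \<Longrightarrow> act V x (v + w) = act V x v + act V x w"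
  and act_scale: "v \<in> carr V i \<Longrightarrow> act V x (vsc V c v) = vsc V c (act V x v)"
  and act_lbr: "v \<in> carr V i \<Longrightarrow> act V (lbr L x y) v = act V x (act V y v) - act V y (act V x v)"
  and dif_mem: "v \<in> carr V i \<Longrightarrow> dif V i v \<in> carr V (i + 1)"
  and dif_add: "v \<in> carr V i \<Longrightarrow> w \<in> carr V i \<Longrightarrow> dif V i (v + w) = dif V i v + dif V i w"
  and dif_scale: "v \<in> carr V i \<Longrightarrow> dif V i (vsc V c v) = vsc V c (dif V i v)"
  and dif_act: "v \<in> carr V i \<Longrightarrow> dif V i (act V x v) = act V x (dif V i v)"
  and dif_dif: "v \<in> carr V i \<Longrightarrow> dif V (i + 1) (dif V i v) = 0"
  using dgm unfolding dg_module_def by - (elim conjE, metis)+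

lemma act_0 [simp]: "act V x 0 = 0"
  using act_scale[of 0 0 x 0] by simp

lemma dif_0 [simp]: "dif V i 0 = 0"
  using dif_scale[of 0 i 0] by simp

lemma form_val: "form i p \<omega> \<Longrightarrow> \<omega> xs \<in> carr V i"
  by (rule alt_form_mem') auto

lemmas form_plus = alt_form_plus[OF vs.vector_space_axioms carr_subspace]
lemmas form_minus = alt_form_minus[OF vs.vector_space_axioms carr_subspace]
lemmas form_smult = alt_form_smult[OF vs.vector_space_axioms carr_subspace]
lemmas form_zero_form = alt_form_zero_form[OF vs.vector_space_axioms carr_subspace]
lemmas form_ctr_scale = ctr_scale[OF vs.vector_space_axioms]

lemma lieD_lin:
  assumes "form i p \<omega>" "form i q \<omega>'"
  shows "lieD L V x (\<lambda>xs. vsc V a (\<omega> xs) + vsc V b (\<omega>' xs)) xs =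
    vsc V a (lieD L V x \<omega> xs) + vsc V b (lieD L V x \<omega>' xs)"
proof -
  note [simp] = form_val[OF assms(1)] form_val[OF assms(2)]
  have "act V x (vsc V a (\<omega> xs) + vsc V b (\<omega>' xs)) = vsc V a (act V x (\<omega> xs)) + vsc V b (act V x (\<omega>' xs))"
    using act_add[of _ i] act_scale[of _ i] carr_scale[of _ i] by simp
  then show ?thesis
    by (simp add: lieD_def sum.distrib vs.scale_sum_right[symmetric] vs.scale_right_diff_distrib)
qed

lemma lieD_add: "form i p \<omega> \<Longrightarrow> form i q \<omega>' \<Longrightarrow>
    lieD L V x (\<lambda>xs. \<omega> xs + \<omega>' xs) xs = lieD L V x \<omega> xs + lieD L V x \<omega>' xs"
  and lieD_diff: "form i p \<omega> \<Longrightarrow> form i q \<omega>' \<Longrightarrow>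
    lieD L V x (\<lambda>xs. \<omega> xs - \<omega>' xs) xs = lieD L V x \<omega> xs - lieD L V x \<omega>' xs"
  and lieD_scale: "form i p \<omega> \<Longrightarrow>
    lieD L V x (\<lambda>xs. vsc V c (\<omega> xs)) xs = vsc V c (lieD L V x \<omega> xs)"
  using lieD_lin[of i p \<omega> q \<omega>' x 1 1 xs] lieD_lin[of i p \<omega> q \<omega>' x 1 "-1" xs]
    lieD_lin[of i p \<omega> p \<omega> x c 0 xs] by simp_all

lemma lieD_zero [simp]: "lieD L V x (\<lambda>_. 0) = (\<lambda>_. 0)"
  by (simp add: lieD_def fun_eq_iff)

lemma form_ctr_0: "form i (Suc p) \<omega> \<Longrightarrow> \<omega> (0 # zs) = 0"
  using form_ctr_scale[of L "carr V i" p \<omega> 0 0] by (simp add: fun_eq_iff)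

lemma form_ctr_diff: "form i (Suc p) \<omega> \<Longrightarrow> \<omega> ((x - y) # zs) = \<omega> (x # zs) - \<omega> (y # zs)"
  using ctr_add[of L "vsc V" "carr V i" p \<omega> "x - y" y] by (simp add: fun_eq_iff)

lemma form_lieD:
  assumes "form i p \<omega>"
  shows "form i p (lieD L V x \<omega>)"
  using assms
proof (induction p arbitrary: \<omega>)
  case 0
  then have "\<omega> xs = 0" if "xs \<noteq> []" for xs using that by (simp add: alt_form_0_iff)
  then show ?case using 0 by (auto simp: alt_form_0_iff lieD_def act_mem)
next
  case (Suc p)
  show ?case
  proof (rule alt_form_SucI)
    show "form i p (ctr y (lieD L V x \<omega>))" for y
      unfolding ctr_lieD by (intro form_minus Suc.IH alt_form_ctr[OF Suc.prems])
    show "lieD L V x \<omega> [] = 0"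
      using alt_form_zero[OF Suc.prems] by (simp add: lieD_def)
    show "lieD L V x \<omega> ((y + z) # zs) = lieD L V x \<omega> (y # zs) + lieD L V x \<omega> (z # zs)" for y z zs
      unfolding lieD_Cons ctr_add[OF Suc.prems] lbr_simps
      using lieD_add[OF alt_form_ctr[OF Suc.prems] alt_form_ctr[OF Suc.prems], of x y z zs]
        ctr_add[OF Suc.prems, of "lbr L x y" "lbr L x z"] by (simp add: fun_eq_iff)
    show "lieD L V x \<omega> (lsc L c y # zs) = vsc V c (lieD L V x \<omega> (y # zs))" for c y zs
      unfolding lieD_Cons form_ctr_scale[OF Suc.prems] lbr_simps
      using lieD_scale[OF alt_form_ctr[OF Suc.prems], of x c y zs]
        form_ctr_scale[OF Suc.prems, of c "lbr L x y"]
      by (simp add: fun_eq_iff vs.scale_right_diff_distrib)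
    \<comment> \<open>What survives has [x, y], y and y, [x, y] in the first two slots, and these
      two values cancel by antisymmetry.\<close>
    show "lieD L V x \<omega> (y # y # zs) = 0" for y zs
      unfolding lieD_Cons alt_form_ctr_ctr_same[OF Suc.prems]
      using alt_form_swap[OF Suc.prems, of y "lbr L x y" zs] by simp
  qed
qed

lemma lieD_add_left:
  assumes "form i p \<omega>"
  shows "lieD L V (x + y) \<omega> xs = lieD L V x \<omega> xs + lieD L V y \<omega> xs"
proof -
  have "\<omega> (xs[j := lbr L (x + y) (xs ! j)]) =
      \<omega> (xs[j := lbr L x (xs ! j)]) + \<omega> (xs[j := lbr L y (xs ! j)])" if "j < length xs" for j
    using that alt_form_add[OF assms] alt_form_zero[OF assms]
    by (cases "length xs = p") (simp_all add: lbr_simps)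
  then show ?thesis
    using act_add_left[OF form_val[OF assms]] by (simp add: lieD_def sum.distrib)
qed

lemma lieD_scale_left:
  assumes "form i p \<omega>"
  shows "lieD L V (lsc L c x) \<omega> xs = vsc V c (lieD L V x \<omega> xs)"
proof -
  have "\<omega> (xs[j := lbr L (lsc L c x) (xs ! j)]) = vsc V c (\<omega> (xs[j := lbr L x (xs ! j)]))"
    if "j < length xs" for j
  proof (cases "length xs = p")
    case True
    then show ?thesis unfolding lbr_simps using that by (intro alt_form_scale[OF assms]) auto
  next
    case False
    then show ?thesis by (simp add: alt_form_zero[OF assms])
  qed
  then show ?thesis
    using act_scale_left[OF form_val[OF assms]]
    by (simp add: lieD_def vs.scale_sum_right vs.scale_right_diff_distrib)
qed

text \<open>Contract with z. The terms mixing L_x with the contraction by [y, z] and L_y with that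
  by [x, z] are together symmetric in x and y, so they drop out of the commutator; what remains is
  the Jacobi identity.\<close>

lemma lieD_lbr:
  assumes "form i p \<omega>"
  shows "lieD L V (lbr L x y) \<omega> xs = lieD L V x (lieD L V y \<omega>) xs - lieD L V y (lieD L V x \<omega>) xs"
  using assms
proof (induction p arbitrary: \<omega> xs)
  case 0
  show ?case
  proof (cases "xs = []")
    case True
    then show ?thesis using act_lbr[OF form_val[OF 0]] by (simp add: lieD_def)
  next
    case False
    then show ?thesis
      using alt_form_zero[OF form_lieD[OF 0]] alt_form_zero[OF form_lieD[OF form_lieD[OF 0]]] by simp
  qed
next
  case (Suc p)
  note c = alt_form_ctr[OF Suc.prems]
  show ?case
  proof (cases xs)
    case Nil
    then show ?thesis
      using alt_form_zero[OF form_lieD[OF Suc.prems]]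
        alt_form_zero[OF form_lieD[OF form_lieD[OF Suc.prems]]] by simp
  next
    case (Cons z zs)
    have *: "lieD L V x (lieD L V y \<omega>) (z # zs) = lieD L V x (lieD L V y (ctr z \<omega>)) zs
       - lieD L V x (ctr (lbr L y z) \<omega>) zs - lieD L V y (ctr (lbr L x z) \<omega>) zs
       + \<omega> (lbr L y (lbr L x z) # zs)" for x y
      unfolding lieD_Cons ctr_lieD lieD_diff[OF form_lieD[OF c] c] by simp
    have "lieD L V (lbr L x y) \<omega> (z # zs) =
        lieD L V (lbr L x y) (ctr z \<omega>) zs - \<omega> (lbr L (lbr L x y) z # zs)"
      by (rule lieD_Cons)
    also have "lbr L (lbr L x y) z = lbr L x (lbr L y z) - lbr L y (lbr L x z)"
      using lbr_jacobi[of x y z] by simp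
    finally show ?thesis
      unfolding Cons * Suc.IH[OF c] form_ctr_diff[OF Suc.prems] by simp
  qed
qed

lemma ce_lin:
  assumes "form i p \<omega>" "form i q \<omega>'"
  shows "ce L V m (\<lambda>xs. vsc V a (\<omega> xs) + vsc V b (\<omega>' xs)) xs =
    vsc V a (ce L V m \<omega> xs) + vsc V b (ce L V m \<omega>' xs)"
proof -
  have *: "act V x (vsc V a (\<omega> xs) + vsc V b (\<omega>' xs)) =
      vsc V a (act V x (\<omega> xs)) + vsc V b (act V x (\<omega>' xs))" for x xs
    using act_add[of _ i] act_scale[of _ i] carr_scale[of _ i]
      form_val[OF assms(1)] form_val[OF assms(2)] by simp
  show ?thesis
    by (simp add: ce_def * case_prod_beta sum.distrib vs.scale_sum_right vs.scale_right_distrib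
        mult.commute add_ac del: sum.lessThan_Suc)
qed

lemma ce_add: "form i p \<omega> \<Longrightarrow> form i q \<omega>' \<Longrightarrow>
    ce L V m (\<lambda>xs. \<omega> xs + \<omega>' xs) xs = ce L V m \<omega> xs + ce L V m \<omega>' xs"
  and ce_diff: "form i p \<omega> \<Longrightarrow> form i q \<omega>' \<Longrightarrow>
    ce L V m (\<lambda>xs. \<omega> xs - \<omega>' xs) xs = ce L V m \<omega> xs - ce L V m \<omega>' xs"
  and ce_scale: "form i p \<omega> \<Longrightarrow>
    ce L V m (\<lambda>xs. vsc V c (\<omega> xs)) xs = vsc V c (ce L V m \<omega> xs)"
  using ce_lin[of i p \<omega> q \<omega>' m 1 1 xs] ce_lin[of i p \<omega> q \<omega>' m 1 "-1" xs]
    ce_lin[of i p \<omega> p \<omega> m c 0 xs] by simp_all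

lemma ce_zero [simp]: "ce L V p (\<lambda>_. 0) = (\<lambda>_. 0)"
  by (simp add: ce_def fun_eq_iff)

lemma ce_Nil [simp]: "ce L V p \<omega> [] = 0"
  by (simp add: ce_def)

lemma ctr_ce_0:
  assumes "form i 0 \<omega>"
  shows "ctr x (ce L V 0 \<omega>) = lieD L V x \<omega>"
proof
  fix xs
  have e: "{(i, j). i < j \<and> j = (0::nat)} = {}" by auto
  show "ctr x (ce L V 0 \<omega>) xs = lieD L V x \<omega> xs"
    using alt_form_zero[OF form_lieD[OF assms]]
    by (cases "xs = []") (simp add: ce_def lieD_def e, simp add: ce_def)
qed

text \<open>Cartan's formula. In the first sum of \<open>ce\<close> the summand i = 0 gives the
  action of x, and the index shift reverses the sign of the others. In the second sum the pairs with
  i = 0 give the bracket terms of L_x; for the others the sign exponent grows by 2, but x and the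
  bracket have to be exchanged, which again yields a minus sign.\<close>

lemma ctr_ce_Suc:
  assumes "form i (Suc p) \<omega>"
  shows "ctr x (ce L V (Suc p) \<omega>) = (\<lambda>xs. lieD L V x \<omega> xs - ce L V p (ctr x \<omega>) xs)"
proof
  fix xs
  show "ctr x (ce L V (Suc p) \<omega>) xs = lieD L V x \<omega> xs - ce L V p (ctr x \<omega>) xs"
  proof (cases "length xs = Suc p")
    case False
    then show ?thesis using alt_form_zero[OF form_lieD[OF assms]] by (simp add: ce_def)
  next
    case True
    have 1: "vsc V ((- 1) ^ j) (\<omega> (y # rm j xs)) = \<omega> (xs[j := y])" if "j < Suc p" for j y
      using alt_form_move[OF vs.vector_space_axioms assms, of j xs y] that True
      by (simp flip: power_add mult_2)
    have 2: "\<omega> (y # x # zs) = - \<omega> (x # y # zs)" for y zs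
      by (rule alt_form_swap[OF assms])
    have "(\<Sum>i < Suc p + 1. vsc V ((-1) ^ i) (act V ((x # xs) ! i) (\<omega> (rm i (x # xs))))) =
        act V x (\<omega> xs) - (\<Sum>i < p + 1. vsc V ((-1) ^ i) (act V (xs ! i) (ctr x \<omega> (rm i xs))))"
      by (simp add: sum.lessThan_Suc_shift sum_negf del: sum.lessThan_Suc)
    moreover have "(\<Sum>(i, j) \<in> {(i, j). i < j \<and> j < Suc p + 1}. vsc V ((-1) ^ (i + j))
          (\<omega> (lbr L ((x # xs) ! i) ((x # xs) ! j) # rm i (rm j (x # xs))))) =
        - (\<Sum>j<length xs. \<omega> (xs[j := lbr L x (xs ! j)])) -
        (\<Sum>(i, j) \<in> {(i, j). i < j \<and> j < p + 1}. vsc V ((-1) ^ (i + j))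
          (ctr x \<omega> (lbr L (xs ! i) (xs ! j) # rm i (rm j xs))))"
      unfolding True Suc_eq_plus1[symmetric] sum_pairs_Suc[of _ "Suc p"]
      by (simp add: 1 2 sum_negf case_prod_beta del: sum.lessThan_Suc)
    ultimately show ?thesis
      using True by (simp add: ce_def lieD_def del: sum.lessThan_Suc)
  qed
qed

lemma form_ce:
  assumes "form i p \<omega>"
  shows "form i (Suc p) (ce L V p \<omega>)"
  using assms
proof (induction p arbitrary: \<omega>)
  case 0
  have c: "ce L V 0 \<omega> (x # zs) = lieD L V x \<omega> zs" for x zs
    using ctr_ce_0[OF 0] by (metis ctr_apply)
  show ?case
  proof (rule alt_form_SucI)
    show "form i 0 (ctr x (ce L V 0 \<omega>))" for x
      unfolding ctr_ce_0[OF 0] by (rule form_lieD[OF 0])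
  qed (simp_all add: c lieD_add_left[OF 0] lieD_scale_left[OF 0])
next
  case (Suc p)
  note f = Suc.prems and f' = alt_form_ctr[OF Suc.prems]
  have c: "ce L V (Suc p) \<omega> (x # zs) = lieD L V x \<omega> zs - ce L V p (ctr x \<omega>) zs" for x zs
    using ctr_ce_Suc[OF f] by (metis ctr_apply)
  show ?case
  proof (rule alt_form_SucI)
    show "form i (Suc p) (ctr x (ce L V (Suc p) \<omega>))" for x
      unfolding ctr_ce_Suc[OF f] by (rule form_minus[OF form_lieD[OF f] Suc.IH[OF f']])
    show "ce L V (Suc p) \<omega> ((x + y) # zs) = ce L V (Suc p) \<omega> (x # zs) + ce L V (Suc p) \<omega> (y # zs)"
      for x y zs
      unfolding c lieD_add_left[OF f] ctr_add[OF f] ce_add[OF f' f'] by simp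
    show "ce L V (Suc p) \<omega> (lsc L a x # zs) = vsc V a (ce L V (Suc p) \<omega> (x # zs))" for a x zs
      unfolding c lieD_scale_left[OF f] form_ctr_scale[OF f] ce_scale[OF f']
      by (simp add: vs.scale_right_diff_distrib)
    \<comment> \<open>Contracting twice with x produces L_x of the contracted form with both signs,
      a term in [x, x] = 0 and, for positive \<open>p\<close>, a term in the vanishing double
      contraction.\<close>
    show "ce L V (Suc p) \<omega> (x # x # zs) = 0" if "Suc (length zs) = Suc p" for x zs
    proof (cases p)
      case 0
      then have "ce L V p (ctr x \<omega>) (x # zs) = lieD L V x (ctr x \<omega>) zs"
        using ctr_ce_0[of i "ctr x \<omega>" x] f' by (metis ctr_apply)
      then show ?thesis
        by (simp add: c lieD_Cons lbr_simps form_ctr_0[OF f])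
    next
      case (Suc q)
      then have "ce L V p (ctr x \<omega>) (x # zs) = lieD L V x (ctr x \<omega>) zs - ce L V q (ctr x (ctr x \<omega>)) zs"
        using ctr_ce_Suc[of i q "ctr x \<omega>" x] f' by (metis ctr_apply)
      then show ?thesis
        by (simp add: c lieD_Cons lbr_simps form_ctr_0[OF f] alt_form_ctr_ctr_same[OF f])
    qed
  qed simp
qed

lemma lieD_ce:
  assumes "form i p \<omega>"
  shows "lieD L V x (ce L V p \<omega>) = ce L V p (lieD L V x \<omega>)"
  using assms
proof (induction p arbitrary: \<omega>)
  case 0
  show ?case
  proof (rule form_eqI)
    show "lieD L V x (ce L V 0 \<omega>) [] = ce L V 0 (lieD L V x \<omega>) []" by (simp add: lieD_def)
    have "ce L V 0 \<omega> (y # zs) = lieD L V y \<omega> zs" for y zs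
      using ctr_ce_0[OF 0] by (metis ctr_apply)
    then show "ctr y (lieD L V x (ce L V 0 \<omega>)) = ctr y (ce L V 0 (lieD L V x \<omega>))" for y
      unfolding ctr_lieD ctr_ce_0[OF 0] ctr_ce_0[OF form_lieD[OF 0]]
      by (simp add: lieD_lbr[OF 0])
  qed
next
  case (Suc p)
  note f = Suc.prems and f' = alt_form_ctr[OF Suc.prems]
  show ?case
  proof (rule form_eqI)
    show "lieD L V x (ce L V (Suc p) \<omega>) [] = ce L V (Suc p) (lieD L V x \<omega>) []" by (simp add: lieD_def)
    show "ctr y (lieD L V x (ce L V (Suc p) \<omega>)) = ctr y (ce L V (Suc p) (lieD L V x \<omega>))" for y
      unfolding ctr_lieD ctr_ce_Suc[OF f] ctr_ce_Suc[OF form_lieD[OF f]]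
        lieD_diff[OF form_lieD[OF f] form_ce[OF f']] Suc.IH[OF f'] ce_diff[OF form_lieD[OF f'] f']
        lieD_lbr[OF f]
      by (rule ext) simp
  qed
qed

text \<open>With i_x for the contraction, Cartan's formula gives i_x d d = L_x d - d L_x + d d i_x.
  The first two terms cancel by \<open>lieD_ce\<close>, the last vanishes by induction.\<close>

lemma ce_ce:
  assumes "form i p \<omega>"
  shows "ce L V (Suc p) (ce L V p \<omega>) = (\<lambda>_. 0)"
  using assms
proof (induction p arbitrary: \<omega>)
  case 0
  show ?case
    by (rule form_eqI)
      (simp_all add: ctr_ce_Suc[OF form_ce[OF 0]] ctr_ce_0[OF 0] lieD_ce[OF 0], simp add: ctr_def)
next
  case (Suc p)
  note f = Suc.prems and f' = alt_form_ctr[OF Suc.prems]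
  show ?case
  proof (rule form_eqI)
    show "ctr x (ce L V (Suc (Suc p)) (ce L V (Suc p) \<omega>)) = ctr x (\<lambda>_. 0)" for x
      unfolding ctr_ce_Suc[OF form_ce[OF f]] ctr_ce_Suc[OF f] lieD_ce[OF f]
        ce_diff[OF form_lieD[OF f] form_ce[OF f']] Suc.IH[OF f']
      by (simp add: ctr_def)
  qed simp
qed

end

section \<open>Linear maps applied to the values of forms\<close>

text \<open>The operations of a \<open>dgmod\<close> obey laws only on the graded pieces, so
  linearity is taken relative to a subset of the ambient type.\<close>

definition linear_on :: "('k \<Rightarrow> 'v \<Rightarrow> 'v) \<Rightarrow> ('k \<Rightarrow> 'w \<Rightarrow> 'w) \<Rightarrow> 'v::ab_group_add set
    \<Rightarrow> ('v \<Rightarrow> 'w::ab_group_add) \<Rightarrow> bool" where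
  "linear_on sv sw S \<phi> \<longleftrightarrow> (\<forall>v\<in>S. \<forall>w\<in>S. \<phi> (v + w) = \<phi> v + \<phi> w) \<and> (\<forall>c. \<forall>v\<in>S. \<phi> (sv c v) = sw c (\<phi> v))"

locale linear_on_subspace = v: vector_space sv + w: vector_space sw
  for sv :: "'k::field \<Rightarrow> 'v::ab_group_add \<Rightarrow> 'v" and sw :: "'k \<Rightarrow> 'w::ab_group_add \<Rightarrow> 'w" +
  fixes S \<phi>
  assumes sub: "v.subspace S" and lin: "linear_on sv sw S \<phi>"
begin

lemma add: "v \<in> S \<Longrightarrow> w \<in> S \<Longrightarrow> \<phi> (v + w) = \<phi> v + \<phi> w"
  and scale: "v \<in> S \<Longrightarrow> \<phi> (sv c v) = sw c (\<phi> v)"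
  using lin by (auto simp: linear_on_def)

lemma zero [simp]: "\<phi> 0 = 0"
  using scale[of 0 0] v.subspace_0[OF sub] by simp

lemma sum: "(\<And>a. a \<in> A \<Longrightarrow> f a \<in> S) \<Longrightarrow> \<phi> (sum f A) = (\<Sum>a\<in>A. \<phi> (f a))"
proof (induction A rule: infinite_finite_induct)
  case (insert a A)
  then show ?case using add[of "f a" "sum f A"] v.subspace_sum[OF sub, of A f] by simp
qed simp_all

lemma alt_form_post:
  assumes "alt_form L sv S p \<omega>" "\<And>v. v \<in> S \<Longrightarrow> \<phi> v \<in> T"
  shows "alt_form L sw T p (\<lambda>xs. \<phi> (\<omega> xs))"
proof -
  note [simp] = alt_form_mem'[OF assms(1) v.subspace_0[OF sub]]
  show ?thesis
    using assms by (simp add: alt_form_def add scale)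
qed

lemma wedge1_post:
  assumes "\<And>xs. \<omega> xs \<in> S"
  shows "\<phi> (wedge1 sv k p \<eta> \<omega> xs) = wedge1 sw k p \<eta> (\<lambda>xs. \<phi> (\<omega> xs)) xs"
  using assms by (simp add: wedge1_def Let_def sum scale v.subspace_scale[OF sub])

end

lemma (in lie_dgmod) linear_on_subspaceI:
  assumes "lie_dgmod L W" "linear_on (vsc V) (vsc W) (carr V i) \<phi>"
  shows "linear_on_subspace (vsc V) (vsc W) (carr V i) \<phi>"
proof -
  interpret w: lie_dgmod L W by fact
  show ?thesis using assms(2) carr_subspace by unfold_locales
qed

text \<open>Equivariance enters in the sum containing the action, equation \<open>1\<close>; the
  bracket sum \<open>2\<close> rests on linearity alone. Applied to the internal differential, this
  shows that it commutes with d_CE.\<close>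

lemma ce_post:
  assumes "lie_dgmod L V" "lie_dgmod L W" "linear_on (vsc V) (vsc W) (carr V i) \<phi>"
    and equiv: "\<And>x v. v \<in> carr V i \<Longrightarrow> \<phi> (act V x v) = act W x (\<phi> v)"
    and \<omega>: "alt_form L (vsc V) (carr V i) p \<omega>"
  shows "ce L W m (\<lambda>xs. \<phi> (\<omega> xs)) xs = \<phi> (ce L V m \<omega> xs)"
proof -
  interpret v: lie_dgmod L V by fact
  interpret w: lie_dgmod L W by fact
  interpret l: linear_on_subspace "vsc V" "vsc W" "carr V i" \<phi>
    by (rule v.linear_on_subspaceI; fact)
  note val = v.form_val[OF \<omega>]
  note mem = v.carr_scale v.act_mem v.carr_sum val
  have 1: "\<phi> (\<Sum>j<m + 1. vsc V ((- 1) ^ j) (act V (xs ! j) (\<omega> (rm j xs)))) =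
     (\<Sum>j<m + 1. vsc W ((- 1) ^ j) (act W (xs ! j) (\<phi> (\<omega> (rm j xs)))))"
    by (subst l.sum) (simp_all add: l.scale equiv mem del: sum.lessThan_Suc)
  have 2: "\<phi> (\<Sum>(i, j)\<in>{(i, j). i < j \<and> j < m + 1}. vsc V ((- 1) ^ (i + j))
        (\<omega> (lbr L (xs ! i) (xs ! j) # rm i (rm j xs)))) =
     (\<Sum>(i, j)\<in>{(i, j). i < j \<and> j < m + 1}. vsc W ((- 1) ^ (i + j))
        (\<phi> (\<omega> (lbr L (xs ! i) (xs ! j) # rm i (rm j xs)))))"
    by (subst l.sum) (auto simp: case_prod_beta l.scale mem)
  show ?thesis
  proof (cases "length xs = m + 1")
    case True
    have "\<phi> (ce L V m \<omega> xs) =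
       \<phi> (\<Sum>j<m + 1. vsc V ((- 1) ^ j) (act V (xs ! j) (\<omega> (rm j xs)))) +
       \<phi> (\<Sum>(i, j)\<in>{(i, j). i < j \<and> j < m + 1}. vsc V ((- 1) ^ (i + j))
        (\<omega> (lbr L (xs ! i) (xs ! j) # rm i (rm j xs))))"
      unfolding ce_def if_P[OF True]
      by (rule l.add) (auto intro!: mem simp del: sum.lessThan_Suc)
    then show ?thesis unfolding 1 2 by (simp only: ce_def if_P[OF True])
  qed (simp add: ce_def)
qed

section \<open>The total differential and its square\<close>

context lie_dgmod
begin

lemma dif_linear_on: "linear_on (vsc V) (vsc V) (carr V i) (dif V i)"
  by (simp add: linear_on_def dif_add dif_scale)

lemma form_dif: "form i p \<omega> \<Longrightarrow> form (i + 1) p (\<lambda>xs. dif V i (\<omega> xs))"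
  using linear_on_subspace.alt_form_post[OF linear_on_subspaceI[OF lie_dgmod_axioms dif_linear_on]]
    dif_mem by blast

lemma ce_dif: "form i p \<omega> \<Longrightarrow> ce L V m (\<lambda>xs. dif V i (\<omega> xs)) xs = dif V i (ce L V m \<omega> xs)"
  by (rule ce_post[OF lie_dgmod_axioms lie_dgmod_axioms dif_linear_on]) (auto simp: dif_act)

lemma OmI: "(\<And>p. form (n - int p) p (\<omega> p)) \<Longrightarrow> \<omega> \<in> Om L V n"
  and OmD: "\<omega> \<in> Om L V n \<Longrightarrow> form (n - int p) p (\<omega> p)"
  by (simp_all add: Om_def)

lemma Om_val: "\<omega> \<in> Om L V n \<Longrightarrow> \<omega> p xs \<in> carr V (n - int p)"
  by (rule form_val[OF OmD])

lemma dtot_0: "\<omega> \<in> Om L V n \<Longrightarrow> dtot L V n \<omega> 0 = (\<lambda>xs. dif V n (\<omega> 0 xs))"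
  by (rule ext) (use alt_form_zero[OF OmD, of \<omega> n _ 0] in \<open>simp add: dtot_def\<close>)

lemma dtot_Suc: "\<omega> \<in> Om L V n \<Longrightarrow> dtot L V n \<omega> (Suc p) =
    (\<lambda>xs. ce L V p (\<omega> p) xs + vsc V ((-1) ^ Suc p) (dif V (n - int (Suc p)) (\<omega> (Suc p) xs)))"
  by (rule ext) (use alt_form_zero[OF OmD, of \<omega> n _ "Suc p"] in \<open>simp add: dtot_def\<close>)

lemma dtot_Om:
  assumes "\<omega> \<in> Om L V n"
  shows "dtot L V n \<omega> \<in> Om L V (n + 1)"
proof (rule OmI)
  fix p
  have d: "form (n + 1 - int p) p (\<lambda>xs. dif V (n - int p) (\<omega> p xs))"
    using form_dif[OF OmD[OF assms, of p]] by (simp add: algebra_simps)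
  show "form (n + 1 - int p) p (dtot L V n \<omega> p)"
  proof (cases p)
    case 0
    then show ?thesis using d by (simp add: dtot_0[OF assms])
  next
    case (Suc q)
    have "form (n + 1 - int (Suc q)) (Suc q) (ce L V q (\<omega> q))"
      using form_ce[OF OmD[OF assms, of q]] by simp
    from form_plus[OF this form_smult[OF d[unfolded Suc]]] show ?thesis
      unfolding Suc dtot_Suc[OF assms] .
  qed
qed

text \<open>The squares of d_CE and of the internal differential vanish separately. The mixed terms
  cancel: the two commute by equivariance, while the sign (-1)^p of the internal part changes with
  the form degree.\<close>

lemma dtot_dtot:
  assumes "\<omega> \<in> Om L V n"
  shows "dtot L V (n + 1) (dtot L V n \<omega>) = (\<lambda>p xs. 0)"
proof (rule ext, rule ext)
  fix p xs
  note D = dtot_Om[OF assms]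
  have dd: "dif V (n + 1 - int p) (dif V (n - int p) (\<omega> p xs)) = 0" for p xs
    using dif_dif[OF Om_val[OF assms, of p xs]] by (simp add: algebra_simps)
  show "dtot L V (n + 1) (dtot L V n \<omega>) p xs = 0"
  proof (cases p)
    case 0
    then show ?thesis using dd[of 0] by (simp add: dtot_0[OF D] dtot_0[OF assms])
  next
    case (Suc q)
    have cev: "ce L V q (\<omega> q) xs \<in> carr V (n - int q)" for xs
      using form_val[OF form_ce[OF OmD[OF assms]]] .
    have difv: "dif V (n - int p) (\<omega> p xs) \<in> carr V (n + 1 - int p)" for p xs
      using dif_mem[OF Om_val[OF assms, of p xs]] by (simp add: algebra_simps)
    have "dif V (n - int q) (dtot L V n \<omega> (Suc q) xs) = dif V (n - int q) (ce L V q (\<omega> q) xs)"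
      unfolding dtot_Suc[OF assms]
      using dif_add[OF cev carr_scale[of _ "n - int q"]] dif_scale[of _ "n - int q"]
        difv[of "Suc q" xs] dd[of "Suc q" xs] by (simp del: power_Suc)
    moreover have "ce L V q (dtot L V n \<omega> q) xs = vsc V ((-1) ^ q) (dif V (n - int q) (ce L V q (\<omega> q) xs))"
    proof (cases q)
      case 0
      then show ?thesis
        using ce_dif[OF OmD[OF assms, of 0], of 0 xs] by (simp add: dtot_0[OF assms])
    next
      case (Suc r)
      have f: "form (n + 1 - int q) q (\<lambda>xs. dif V (n - int q) (\<omega> q xs))"
        using form_dif[OF OmD[OF assms, of q]] by (simp add: algebra_simps)
      have g: "form (n + 1 - int q) q (ce L V r (\<omega> r))"
        using form_ce[OF OmD[OF assms, of r]] by (simp add: Suc)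
      have "ce L V q (dtot L V n \<omega> q) xs = ce L V q (ce L V r (\<omega> r)) xs +
          vsc V ((-1) ^ q) (ce L V q (\<lambda>xs. dif V (n - int q) (\<omega> q xs)) xs)"
        using ce_add[OF g form_smult[OF f], of q "(-1) ^ q" xs] ce_scale[OF f, of q "(-1) ^ q" xs]
        by (simp add: dtot_Suc[OF assms] Suc)
      then show ?thesis
        using ce_ce[OF OmD[OF assms, of r]] ce_dif[OF OmD[OF assms, of q], of q xs]
        by (simp add: Suc)
    qed
    ultimately show ?thesis
      unfolding Suc dtot_Suc[OF D] by simp
  qed
qed

end

subsection \<open>Contraction of wedge products\<close>

text \<open>The antisymmetrisation without normalisation; \<open>wedge1\<close> is this divided by
  k! p!. The scalar action is a parameter so that \<open>alternate_Cons\<close> can absorb the sign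
  (-1)^j into it.\<close>

definition alternate :: "('k::field \<Rightarrow> 'v \<Rightarrow> 'v) \<Rightarrow> nat \<Rightarrow> ('g list \<Rightarrow> 'v::ab_group_add) \<Rightarrow> 'g list \<Rightarrow> 'v" where
  "alternate sv n M xs =
     (\<Sum>\<sigma> | \<sigma> permutes {0..<n}. sv (of_int (sign \<sigma>)) (M (map (\<lambda>i. xs ! \<sigma> i) [0..<n])))"

text \<open>Expansion along the position \<open>j\<close> to which a permutation moves the first argument.\<close>

lemma alternate_Cons:
  fixes sv :: "'k::field \<Rightarrow> 'v \<Rightarrow> 'v::ab_group_add"
  assumes len: "length zs = n"
  shows "alternate sv (Suc n) M (x # zs) =
    (\<Sum>j<Suc n. alternate (\<lambda>c. sv ((-1) ^ j * c)) n (\<lambda>ws. M (take j ws @ x # drop j ws)) zs)"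
proof -
  let ?P = "\<lambda>j. {\<sigma>. \<sigma> permutes {0..<Suc n} \<and> \<sigma> j = 0}"
  let ?f = "\<lambda>\<sigma>. sv (of_int (sign \<sigma>)) (M (map (\<lambda>i. (x # zs) ! \<sigma> i) [0..<Suc n]))"
  have "alternate sv (Suc n) M (x # zs) = sum ?f (\<Union>j\<in>{0..<Suc n}. ?P j)"
    unfolding alternate_def by (rule sum.cong[OF permutation_split_ran]) auto
  also have "\<dots> = (\<Sum>j\<in>{0..<Suc n}. sum ?f (?P j))"
  proof (rule sum.UNION_disjoint)
    show "\<forall>i\<in>{0..<Suc n}. \<forall>j\<in>{0..<Suc n}. i \<noteq> j \<longrightarrow> ?P i \<inter> ?P j = {}"
      by (intro ballI impI permutation_disjoint_dom) auto
  qed (auto intro: finite_subset[OF _ finite_permutations[of "{0..<Suc n}"]])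
  also have "\<dots> = (\<Sum>j<Suc n. alternate (\<lambda>c. sv ((-1) ^ j * c)) n (\<lambda>ws. M (take j ws @ x # drop j ws)) zs)"
  proof (rule sum.cong)
    fix j assume "j \<in> {..<Suc n}"
    then have j: "j < Suc n" by simp
    have "sum ?f (?P j) = (\<Sum>q | q permutes {0..<n}. ?f (permutation_insert j 0 q))"
      unfolding permutation_fix[OF j, of 0, simplified]
      by (subst sum.reindex[OF permutation_insert_inj_on[OF j]]) auto
    also have "\<dots> = alternate (\<lambda>c. sv ((-1) ^ j * c)) n (\<lambda>ws. M (take j ws @ x # drop j ws)) zs"
      unfolding alternate_def
    proof (rule sum.cong[OF refl])
      fix q assume "q \<in> {q. q permutes {0..<n}}"
      then have q: "q permutes {0..<n}" by simp
      let ?ws = "map (\<lambda>i. zs ! q i) [0..<n]"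
      \<comment> \<open>\<open>permutation_insert j 0 q\<close> sends j to 0 and arranges the rest
        as \<open>q\<close> does, so its list is that of \<open>q\<close> with x inserted at
        position j, and its sign is (-1)^j times that of \<open>q\<close>.\<close>
      have "map (\<lambda>i. (x # zs) ! permutation_insert j 0 q i) [0..<Suc n] = take j ?ws @ x # drop j ?ws"
      proof (rule nth_equalityI)
        show "length (map (\<lambda>i. (x # zs) ! permutation_insert j 0 q i) [0..<Suc n]) =
            length (take j ?ws @ x # drop j ?ws)" using j by simp
        fix i assume "i < length (map (\<lambda>i. (x # zs) ! permutation_insert j 0 q i) [0..<Suc n])"
        then have i: "i < Suc n" by simp
        then have "map (\<lambda>i. (x # zs) ! permutation_insert j 0 q i) [0..<Suc n] ! i =
            (x # zs) ! permutation_insert j 0 q i"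
          by (simp del: upt_Suc)
        also have "\<dots> = (take j ?ws @ x # drop j ?ws) ! i"
          using i j by (auto simp: permutation_insert_expand nth_append nth_Cons' min_def)
        finally show "map (\<lambda>i. (x # zs) ! permutation_insert j 0 q i) [0..<Suc n] ! i =
            (take j ?ws @ x # drop j ?ws) ! i" .
      qed
      moreover have "of_int (sign (permutation_insert j 0 q)) = (-1) ^ j * (of_int (sign q) :: 'k)"
        using signof_permutation_insert[OF q j, of 0] by simp
      ultimately show "?f (permutation_insert j 0 q) =
          sv ((-1) ^ j * of_int (sign q)) (M (take j ?ws @ x # drop j ?ws))"
        by simp
    qed
    finally show "sum ?f (?P j) = alternate (\<lambda>c. sv ((-1) ^ j * c)) n (\<lambda>ws. M (take j ws @ x # drop j ws)) zs" .
  qed auto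
  finally show ?thesis .
qed


lemma alt_form_insert:
  assumes "vector_space sv" "alt_form L sv S p \<omega>" "j \<le> length us"
  shows "\<omega> (take j us @ x # drop j us) = sv ((-1) ^ j) (\<omega> (x # us))"
proof -
  interpret vector_space sv by fact
  let ?ys = "take j us @ x # drop j us"
  have "rm j ?ys = us" "?ys[j := x] = ?ys" "j < length ?ys"
    using assms(3) by (simp_all add: rm_def list_update_append min_def)
  then have "\<omega> (x # us) = sv ((-1) ^ j) (\<omega> ?ys)"
    using alt_form_move[OF assms(1,2), of j ?ys x] by simp
  then show ?thesis by (simp flip: power_add mult_2)
qed

lemma wedge1_alternate:
  fixes sv :: "'k::field \<Rightarrow> 'v::ab_group_add \<Rightarrow> 'v"
  assumes "vector_space sv" "length xs = k + p"
  shows "wedge1 sv k p \<eta> \<omega> xs = sv (1 / of_nat (fact k * fact p))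
    (alternate sv (k + p) (\<lambda>ys. sv (\<eta> (take k ys)) (\<omega> (drop k ys))) xs)"
proof -
  interpret vector_space sv by fact
  show ?thesis
    using assms(2) by (simp add: wedge1_def alternate_def Let_def scale_sum_right)
qed

text \<open>The expansion places x at each of the k + p positions: k of them are arguments of eta
  and p of omega, and within each group the terms are equal. The factors k and p turn 1 / (k! p!)
  into the normalisations of the two smaller products.\<close>

lemma ctr_wedge1:
  fixes sv :: "'k::field_char_0 \<Rightarrow> 'v::ab_group_add \<Rightarrow> 'v"
  assumes sv: "vector_space sv" and \<eta>: "sform L k \<eta>" and \<omega>: "alt_form L sv S p \<omega>"
  shows "ctr x (wedge1 sv k p \<eta> \<omega>) = (\<lambda>zs.
    (if k = 0 then 0 else wedge1 sv (k - 1) p (ctr x \<eta>) \<omega> zs) +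
    (if p = 0 then 0 else sv ((-1) ^ k) (wedge1 sv k (p - 1) \<eta> (ctr x \<omega>) zs)))"
proof
  interpret vector_space sv by fact
  have mult: "vector_space ((*) :: 'k \<Rightarrow> 'k \<Rightarrow> 'k)" by unfold_locales (auto simp: algebra_simps)
  fix zs
  let ?R = "(if k = 0 then 0 else wedge1 sv (k - 1) p (ctr x \<eta>) \<omega> zs) +
    (if p = 0 then 0 else sv ((-1) ^ k) (wedge1 sv k (p - 1) \<eta> (ctr x \<omega>) zs))"
  show "ctr x (wedge1 sv k p \<eta> \<omega>) zs = ?R"
  proof (cases "Suc (length zs) = k + p")
    case False
    then show ?thesis by (auto simp: wedge1_def)
  next
    case True
    define n where "n = length zs"
    have kp: "k + p = Suc n" using True n_def by simp
    let ?M = "\<lambda>ys. sv (\<eta> (take k ys)) (\<omega> (drop k ys))"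
    let ?T = "\<lambda>j. alternate (\<lambda>c. sv ((-1) ^ j * c)) n (\<lambda>ws. ?M (take j ws @ x # drop j ws)) zs"
    let ?A = "alternate sv n (\<lambda>ws. sv (\<eta> (x # take (k - 1) ws)) (\<omega> (drop (k - 1) ws))) zs"
    let ?B = "alternate sv n (\<lambda>ws. sv (\<eta> (take k ws)) (\<omega> (x # drop k ws))) zs"
    have one: "(-1) ^ j * (-1) ^ j = (1::'k)" for j by (simp flip: power_add mult_2)
    have sq: "(-1) ^ j * a * ((-1) ^ j * b) = a * b" for j and a b :: 'k
    proof -
      have "(-1) ^ j * a * ((-1) ^ j * b) = ((-1) ^ j * (-1) ^ j) * (a * b)" by (simp only: mult_ac)
      then show ?thesis by (simp only: one mult_1_left)
    qed
    have sq': "c * (-1) ^ j * a * (b * (-1) ^ j) = c * (a * b)" for j and a b c :: 'k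
    proof -
      have "c * (-1) ^ j * a * (b * (-1) ^ j) = ((-1) ^ j * (-1) ^ j) * (c * (a * b))" by (simp only: mult_ac)
      then show ?thesis by (simp only: one mult_1_left)
    qed
    \<comment> \<open>The sign of placing x at position j is undone by moving x to the front of the
      arguments of eta.\<close>
    have A: "?T j = ?A" if "j < k" for j
      unfolding alternate_def
    proof (rule sum.cong[OF refl])
      fix \<sigma>
      let ?ws = "map (\<lambda>i. zs ! \<sigma> i) [0..<n]"
      have j: "j \<le> length (take (k - 1) ?ws)" using that kp by simp
      have "take k (take j ?ws @ x # drop j ?ws) =
          take j (take (k - 1) ?ws) @ x # drop j (take (k - 1) ?ws)"
        using that kp by (cases "k - j") (auto simp: min_def take_Cons' drop_take)
      moreover have "drop k (take j ?ws @ x # drop j ?ws) = drop (k - 1) ?ws"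
        using that kp by (cases "k - j") (auto simp: min_def drop_Cons')
      ultimately show "sv ((-1) ^ j * of_int (sign \<sigma>)) (?M (take j ?ws @ x # drop j ?ws)) =
          sv (of_int (sign \<sigma>)) (sv (\<eta> (x # take (k - 1) ?ws)) (\<omega> (drop (k - 1) ?ws)))"
        using alt_form_insert[OF mult \<eta>[unfolded sform_def] j, of x]
        by (simp only: scale_scale sq)
    qed
    \<comment> \<open>Moving x to the front of the arguments of omega undoes only l of the k + l
      signs, so (-1)^k survives.\<close>
    have B: "?T (k + l) = sv ((-1) ^ k) ?B" if "l < p" for l
      unfolding alternate_def scale_sum_right
    proof (rule sum.cong[OF refl])
      fix \<sigma>
      let ?ws = "map (\<lambda>i. zs ! \<sigma> i) [0..<n]"
      have l: "l \<le> length (drop k ?ws)" using that kp by simp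
      have "take k (take (k + l) ?ws @ x # drop (k + l) ?ws) = take k ?ws"
        using that kp by (simp add: min_def)
      moreover have "drop k (take (k + l) ?ws @ x # drop (k + l) ?ws) =
          take l (drop k ?ws) @ x # drop l (drop k ?ws)"
        using that kp by (simp add: min_def drop_take add.commute)
      ultimately show "sv ((-1) ^ (k + l) * of_int (sign \<sigma>)) (?M (take (k + l) ?ws @ x # drop (k + l) ?ws)) =
          sv ((-1) ^ k) (sv (of_int (sign \<sigma>)) (sv (\<eta> (take k ?ws)) (\<omega> (x # drop k ?ws))))"
        using alt_form_insert[OF sv \<omega> l, of x]
        by (simp only: scale_scale power_add sq')
    qed
    have "(\<Sum>j<Suc n. ?T j) = (\<Sum>j<k. ?T j) + (\<Sum>l<p. ?T (k + l))"
      unfolding kp[symmetric] by (induction p) (simp_all add: add.assoc)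
    also have "\<dots> = sv (of_nat k) ?A + sv (of_nat p * (-1) ^ k) ?B"
    proof -
      have "(\<Sum>j<m. w) = sv (of_nat m) w" for m :: nat and w
        by (induction m) (simp_all add: scale_left_distrib add.commute)
      then show ?thesis using A B by (simp del: sum_constant)
    qed
    finally have "ctr x (wedge1 sv k p \<eta> \<omega>) zs =
        sv (1 / of_nat (fact k * fact p)) (sv (of_nat k) ?A + sv (of_nat p * (-1) ^ k) ?B)"
      using alternate_Cons[of zs n sv ?M x] wedge1_alternate[OF sv, of "x # zs" k p \<eta> \<omega>] kp
      by (simp add: n_def)
    also have "\<dots> = ?R"
    proof -
      have fct: "of_nat (Suc m) / of_nat (fact (Suc m) * c) = (1 :: 'k) / of_nat (fact m * c)" for m c :: nat
        by (simp add: fact_Suc mult.assoc del: of_nat_Suc mult_Suc)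
      have eA: "sv (of_nat k / of_nat (fact k * fact p)) ?A =
          (if k = 0 then 0 else wedge1 sv (k - 1) p (ctr x \<eta>) \<omega> zs)"
      proof (cases k)
        case (Suc k')
        then show ?thesis
          unfolding Suc fct using wedge1_alternate[OF sv, of zs k' p "ctr x \<eta>" \<omega>] kp Suc
          by (simp add: n_def)
      qed simp
      have eB: "sv (of_nat p / of_nat (fact k * fact p)) ?B =
          (if p = 0 then 0 else wedge1 sv k (p - 1) \<eta> (ctr x \<omega>) zs)"
      proof (cases p)
        case (Suc p')
        then show ?thesis
          unfolding Suc mult.commute[of "fact k"] fct
          using wedge1_alternate[OF sv, of zs k p' \<eta> "ctr x \<omega>"] kp Suc
          by (simp add: n_def mult.commute)
      qed simp
      have e: "sv (1 / d) (sv (of_nat k) a + sv (of_nat p * (-1) ^ k) b) =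
          sv (of_nat k / d) a + sv ((-1) ^ k) (sv (of_nat p / d) b)" for a b d
        by (simp add: scale_right_distrib mult.commute)
      show ?thesis unfolding e eA eB by simp
    qed
    finally show ?thesis .
  qed
qed

lemma vector_space_mult: "vector_space ((*) :: 'k::field \<Rightarrow> 'k \<Rightarrow> 'k)"
  by unfold_locales (auto simp: algebra_simps)

lemma sform_ctr: "sform L (Suc k) \<eta> \<Longrightarrow> sform L k (ctr x \<eta>)"
  unfolding sform_def by (rule alt_form_ctr)

lemma (in vector_space) wedge1_add_left:
  "wedge1 scale k p (\<lambda>xs. \<eta> xs + \<eta>' xs) \<omega> xs = wedge1 scale k p \<eta> \<omega> xs + wedge1 scale k p \<eta>' \<omega> xs"
  by (simp add: wedge1_def Let_def distrib_left add_divide_distrib scale_left_distrib sum.distrib)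

lemma (in vector_space) wedge1_scale_left:
  "wedge1 scale k p (\<lambda>xs. c * \<eta> xs) \<omega> xs = scale c (wedge1 scale k p \<eta> \<omega> xs)"
  by (simp add: wedge1_def Let_def scale_sum_right mult.left_commute)

lemma (in vector_space) wedge1_lin_right:
  "wedge1 scale k p \<eta> (\<lambda>xs. scale a (\<omega> xs) + scale b (\<omega>' xs)) xs =
     scale a (wedge1 scale k p \<eta> \<omega> xs) + scale b (wedge1 scale k p \<eta> \<omega>' xs)"
  by (simp add: wedge1_def Let_def scale_right_distrib sum.distrib scale_sum_right mult.commute)

lemma (in vector_space) wedge1_add_right:
  "wedge1 scale k p \<eta> (\<lambda>xs. \<omega> xs + \<omega>' xs) xs = wedge1 scale k p \<eta> \<omega> xs + wedge1 scale k p \<eta> \<omega>' xs"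
  using wedge1_lin_right[of k p \<eta> 1 \<omega> 1 \<omega>' xs] by simp

lemma (in vector_space) wedge1_diff_right:
  "wedge1 scale k p \<eta> (\<lambda>xs. \<omega> xs - \<omega>' xs) xs = wedge1 scale k p \<eta> \<omega> xs - wedge1 scale k p \<eta> \<omega>' xs"
  using wedge1_lin_right[of k p \<eta> 1 \<omega> "-1" \<omega>' xs] by simp

lemma (in vector_space) wedge1_scale_right:
  "wedge1 scale k p \<eta> (\<lambda>xs. scale c (\<omega> xs)) xs = scale c (wedge1 scale k p \<eta> \<omega> xs)"
  using wedge1_lin_right[of k p \<eta> c \<omega> 0 \<omega> xs] by simp

lemma (in vector_space) wedge1_zero_left [simp]: "wedge1 scale k p (\<lambda>_. 0) \<omega> xs = 0"
  by (simp add: wedge1_def Let_def)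

lemma (in vector_space) wedge1_zero_right [simp]: "wedge1 scale k p \<eta> (\<lambda>_. 0) xs = 0"
  by (simp add: wedge1_def Let_def)

text \<open>Induction on the total degree through \<open>ctr_wedge1\<close> and
  \<open>alt_form_SucI\<close>, which keeps permutations out of the argument.\<close>

lemma alt_form_wedge1:
  fixes sv :: "'k::field_char_0 \<Rightarrow> 'v::ab_group_add \<Rightarrow> 'v"
  assumes sv: "vector_space sv" "module.subspace sv S" and "sform L k \<eta>" "alt_form L sv S p \<omega>"
  shows "alt_form L sv S (k + p) (wedge1 sv k p \<eta> \<omega>)"
  using assms(3,4)
proof (induction "k + p" arbitrary: k p \<eta> \<omega>)
  interpret vector_space sv by fact
  case 0
  then have "\<omega> [] \<in> S" by (simp add: alt_form_0_iff)
  then show ?case using 0 subspace_scale[OF sv(2)] by (auto simp: alt_form_0_iff wedge1_def)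
next
  interpret vector_space sv by fact
  case (Suc n)
  note \<eta> = Suc.prems(1) and \<omega> = Suc.prems(2)
  let ?A = "\<lambda>x zs. if k = 0 then 0 else wedge1 sv (k - 1) p (ctr x \<eta>) \<omega> zs"
  let ?B = "\<lambda>x zs. if p = 0 then 0 else sv ((-1) ^ k) (wedge1 sv k (p - 1) \<eta> (ctr x \<omega>) zs)"
  have c: "ctr x (wedge1 sv k p \<eta> \<omega>) = (\<lambda>zs. ?A x zs + ?B x zs)" for x
    by (rule ctr_wedge1[OF sv(1) \<eta> \<omega>])
  have c': "wedge1 sv k p \<eta> \<omega> (x # zs) = ?A x zs + ?B x zs" for x zs
    using c[of x] by (metis (no_types, lifting) ctr_apply)
  have "alt_form L sv S (Suc n) (wedge1 sv k p \<eta> \<omega>)"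
  proof (rule alt_form_SucI)
    fix x
    have "alt_form L sv S n (?A x)"
    proof (cases k)
      case (Suc k')
      then have "alt_form L sv S (k' + p) (wedge1 sv k' p (ctr x \<eta>) \<omega>)"
        using Suc.hyps \<eta> \<omega> sform_ctr by (intro Suc.hyps(1)) auto
      moreover have "k' + p = n" using Suc.hyps(2) Suc by simp
      ultimately show ?thesis using Suc by simp
    qed (use alt_form_zero_form[OF sv] in simp)
    moreover have "alt_form L sv S n (?B x)"
    proof (cases p)
      case (Suc p')
      then have "alt_form L sv S (k + p') (wedge1 sv k p' \<eta> (ctr x \<omega>))"
        using Suc.hyps \<eta> \<omega> alt_form_ctr by (intro Suc.hyps(1)) auto
      moreover have "k + p' = n" using Suc.hyps(2) Suc by simp
      ultimately show ?thesis using Suc alt_form_smult[OF sv] by simp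
    qed (use alt_form_zero_form[OF sv] in simp)
    ultimately show "alt_form L sv S n (ctr x (wedge1 sv k p \<eta> \<omega>))"
      unfolding c by (rule alt_form_plus[OF sv])
  next
    show "wedge1 sv k p \<eta> \<omega> [] = 0" using Suc.hyps(2) by (auto simp: wedge1_def)
  next
    fix x y zs
    show "wedge1 sv k p \<eta> \<omega> ((x + y) # zs) = wedge1 sv k p \<eta> \<omega> (x # zs) + wedge1 sv k p \<eta> \<omega> (y # zs)"
    proof -
      have "?A (x + y) zs = ?A x zs + ?A y zs"
        using ctr_add[of L "(*)" UNIV "k - 1" \<eta> x y] \<eta>[unfolded sform_def]
        by (cases k) (simp_all add: wedge1_add_left del: ctr_apply)
      moreover have "?B (x + y) zs = ?B x zs + ?B y zs"
        using ctr_add[of L sv S "p - 1" \<omega> x y] \<omega>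
        by (cases p) (simp_all add: wedge1_add_right scale_right_distrib del: ctr_apply)
      ultimately show ?thesis unfolding c' by (simp only: add_ac)
    qed
  next
    fix a x zs
    show "wedge1 sv k p \<eta> \<omega> (lsc L a x # zs) = sv a (wedge1 sv k p \<eta> \<omega> (x # zs))"
    proof -
      have "?A (lsc L a x) zs = sv a (?A x zs)"
        using ctr_scale[OF vector_space_mult, of L UNIV "k - 1" \<eta> a x] \<eta>[unfolded sform_def]
        by (cases k) (simp_all add: wedge1_scale_left del: ctr_apply)
      moreover have "?B (lsc L a x) zs = sv a (?B x zs)"
        using ctr_scale[OF sv(1), of L S "p - 1" \<omega> a x] \<omega>
        by (cases p) (simp_all add: wedge1_scale_right mult.commute del: ctr_apply)
      ultimately show ?thesis unfolding c' by (simp only: scale_right_distrib)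
    qed
  next
    fix x zs
    note \<eta>xx = alt_form_ctr_ctr_same[OF \<eta>[unfolded sform_def], of x]
    note \<omega>xx = alt_form_ctr_ctr_same[OF \<omega>, of x]
    \<comment> \<open>After contracting twice with x only the products with both factors contracted
      survive. The two orders carry (-1)^(k - 1) and (-1)^k and cancel.\<close>
    have A: "?A x (x # zs) = (if k = 0 \<or> p = 0 then 0 else
        sv ((-1) ^ (k - 1)) (wedge1 sv (k - 1) (p - 1) (ctr x \<eta>) (ctr x \<omega>) zs))"
    proof (cases k)
      case (Suc k')
      have "wedge1 sv k' p (ctr x \<eta>) \<omega> (x # zs) = ctr x (wedge1 sv k' p (ctr x \<eta>) \<omega>) zs" by simp
      also have "\<dots> = (if p = 0 then 0 else sv ((-1) ^ k') (wedge1 sv k' (p - 1) (ctr x \<eta>) (ctr x \<omega>) zs))"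
        using ctr_wedge1[OF sv(1) sform_ctr[OF \<eta>[unfolded Suc]] \<omega>, of x x] by (simp add: \<eta>xx)
      finally show ?thesis using Suc by simp
    qed simp
    have B: "?B x (x # zs) = (if k = 0 \<or> p = 0 then 0 else
        sv ((-1) ^ k) (wedge1 sv (k - 1) (p - 1) (ctr x \<eta>) (ctr x \<omega>) zs))"
    proof (cases p)
      case (Suc p')
      have "wedge1 sv k p' \<eta> (ctr x \<omega>) (x # zs) = ctr x (wedge1 sv k p' \<eta> (ctr x \<omega>)) zs" by simp
      also have "\<dots> = (if k = 0 then 0 else wedge1 sv (k - 1) p' (ctr x \<eta>) (ctr x \<omega>) zs)"
        using ctr_wedge1[OF sv(1) \<eta> alt_form_ctr[OF \<omega>[unfolded Suc]], of x x] by (simp add: \<omega>xx)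
      finally show ?thesis using Suc by simp
    qed simp
    show "wedge1 sv k p \<eta> \<omega> (x # x # zs) = 0"
      unfolding c' A B by (cases k) simp_all
  qed
  then show ?case using Suc.hyps(2) by simp
qed

text \<open>The commutator of the Chevalley--Eilenberg differential with a linear map \<open>s\<close>
  that need not be equivariant; unlike the differential it commutes with wedge products.\<close>

definition ce_comm :: "('k::field, 'g::ab_group_add) lie \<Rightarrow> ('k, 'g, 'v::ab_group_add) dgmod
    \<Rightarrow> ('v \<Rightarrow> 'v) \<Rightarrow> nat \<Rightarrow> ('g list \<Rightarrow> 'v) \<Rightarrow> 'g list \<Rightarrow> 'v" where
  "ce_comm L V s p \<omega> xs = ce L V p (\<lambda>xs. s (\<omega> xs)) xs - s (ce L V p \<omega> xs)"

section \<open>Wedge products and the commutator of d_CE with a linear map\<close>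

locale lie_dgmod_char0 = lie_dgmod L V
  for L :: "('k::field_char_0, 'g::ab_group_add) lie" and V :: "('k, 'g, 'v::ab_group_add) dgmod"
begin

lemma form_wedge1: "sform L k \<eta> \<Longrightarrow> form i p \<omega> \<Longrightarrow> form i (k + p) (wedge1 (vsc V) k p \<eta> \<omega>)"
  by (rule alt_form_wedge1[OF vs.vector_space_axioms carr_subspace])

lemmas form_ctr_wedge1 = ctr_wedge1[OF vs.vector_space_axioms]

lemma wedge_Om:
  assumes "sform L k \<eta>" "\<omega> \<in> Om L V n"
  shows "wedge V k \<eta> \<omega> \<in> Om L V (n + int k)"
proof (rule OmI)
  fix p
  show "form (n + int k - int p) p (wedge V k \<eta> \<omega> p)"
  proof (cases "k \<le> p")
    case True
    have "form (n - int (p - k)) (k + (p - k)) (wedge1 (vsc V) k (p - k) \<eta> (\<omega> (p - k)))"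
      by (rule form_wedge1[OF assms(1) OmD[OF assms(2)]])
    then show ?thesis using True by (simp add: wedge_def of_nat_diff algebra_simps)
  qed (use form_zero_form in \<open>simp add: wedge_def\<close>)
qed

end

text \<open>\<open>s\<close> is linear on the whole ambient type and respects the grading on the
  piece of degree \<open>i\<close>. Global linearity lets it pass through sums without membership
  conditions.\<close>

locale homotopy_map = lie_dgmod_char0 +
  fixes s i
  assumes s_add: "\<And>v w. s (v + w) = s v + s w" and s_scale: "\<And>c v. s (vsc V c v) = vsc V c (s v)"
    and s_mem: "\<And>v. v \<in> carr V i \<Longrightarrow> s v \<in> carr V (i - 1)"
begin

lemma s_linear_on: "linear_on (vsc V) (vsc V) A s"
  by (simp add: linear_on_def s_add s_scale)

sublocale s: linear_on_subspace "vsc V" "vsc V" "carr V i" s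
  by (rule linear_on_subspaceI[OF lie_dgmod_axioms s_linear_on])

lemma s_diff: "s (v - w) = s v - s w"
  by (metis add_diff_cancel_right' diff_add_cancel s_add)

lemma form_s: "form i p \<omega> \<Longrightarrow> form (i - 1) p (\<lambda>xs. s (\<omega> xs))"
  by (rule s.alt_form_post[OF _ s_mem])

lemma form_ce_comm:
  assumes "form i p \<omega>"
  shows "form (i - 1) (Suc p) (ce_comm L V s p \<omega>)"
  unfolding ce_comm_def[abs_def]
  by (intro form_minus form_ce form_s assms)

text \<open>The bracket terms of L_x commute with a linear map of the values, so the commutator of
  L_x with \<open>s\<close> is the pointwise application of one linear map. Such maps commute with
  wedge products, which makes \<open>ce_comm_wedge1\<close> work.\<close>

lemma lieD_s: "lieD L V x (\<lambda>xs. s (\<omega> xs)) xs - s (lieD L V x \<omega> xs) = act V x (s (\<omega> xs)) - s (act V x (\<omega> xs))"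
proof -
  have "s (\<Sum>j<n. f j) = (\<Sum>j<n. s (f j))" for n :: nat and f
    by (induction n) (simp_all add: s_add)
  then show ?thesis by (simp add: lieD_def s_diff)
qed

lemma ctr_ce_comm_0:
  assumes "form i 0 \<omega>"
  shows "ctr x (ce_comm L V s 0 \<omega>) = (\<lambda>xs. act V x (s (\<omega> xs)) - s (act V x (\<omega> xs)))"
  using ctr_ce_0[OF assms] ctr_ce_0[OF form_s[OF assms]] lieD_s[of x \<omega>]
  by (simp add: fun_eq_iff ce_comm_def)

lemma ctr_ce_comm_Suc:
  assumes "form i (Suc p) \<omega>"
  shows "ctr x (ce_comm L V s (Suc p) \<omega>) =
    (\<lambda>xs. (act V x (s (\<omega> xs)) - s (act V x (\<omega> xs))) - ce_comm L V s p (ctr x \<omega>) xs)"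
  using ctr_ce_Suc[OF assms, of x] ctr_ce_Suc[OF form_s[OF assms], of x] lieD_s[of x \<omega>]
  by (simp add: fun_eq_iff ce_comm_def s_diff ctr_def)

lemma ce_comm_lin:
  assumes "form i p \<omega>" "form i q \<omega>'"
  shows "ce_comm L V s m (\<lambda>xs. vsc V a (\<omega> xs) + vsc V b (\<omega>' xs)) xs =
    vsc V a (ce_comm L V s m \<omega> xs) + vsc V b (ce_comm L V s m \<omega>' xs)"
  using ce_lin[OF assms, of m a b xs] ce_lin[OF form_s[OF assms(1)] form_s[OF assms(2)], of m a b xs]
  by (simp add: ce_comm_def s_add s_scale vs.scale_right_diff_distrib)

lemma ce_comm_zero [simp]: "ce_comm L V s p (\<lambda>_. 0) xs = 0"
  by (simp add: ce_comm_def)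

lemma ctr_ce_comm:
  assumes "form i p \<omega>"
  shows "ctr x (ce_comm L V s p \<omega>) = (\<lambda>xs. (act V x (s (\<omega> xs)) - s (act V x (\<omega> xs))) -
    (if p = 0 then 0 else ce_comm L V s (p - 1) (ctr x \<omega>) xs))"
  using assms by (cases p) (simp_all add: ctr_ce_comm_0 ctr_ce_comm_Suc)

text \<open>Contraction with x leaves a pointwise linear map, covered by \<open>wedge1_post\<close>,
  and the same claim for the products in which eta or omega is contracted, whose total degree is
  smaller.\<close>

lemma ce_comm_wedge1:
  assumes "sform L k \<eta>" "form i p \<omega>"
  shows "ce_comm L V s (k + p) (wedge1 (vsc V) k p \<eta> \<omega>) =
    (\<lambda>xs. vsc V ((-1) ^ k) (wedge1 (vsc V) k (Suc p) \<eta> (ce_comm L V s p \<omega>) xs))"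
  using assms
proof (induction "k + p" arbitrary: k p \<eta> \<omega> rule: less_induct)
  case less
  note \<eta> = less.prems(1) and \<omega> = less.prems(2)
  note w = form_wedge1[OF \<eta> \<omega>]
  let ?w = "wedge1 (vsc V)"
  show ?case
  proof (rule form_eqI)
    show "ce_comm L V s (k + p) (?w k p \<eta> \<omega>) [] = vsc V ((-1) ^ k) (?w k (Suc p) \<eta> (ce_comm L V s p \<omega>) [])"
      by (simp add: ce_comm_def wedge1_def)
  next
    fix x
    let ?a = "\<lambda>v. act V x (s v) - s (act V x v)"
    have a: "linear_on_subspace (vsc V) (vsc V) (carr V i) ?a"
    proof (rule linear_on_subspaceI[OF lie_dgmod_axioms])
      show "linear_on (vsc V) (vsc V) (carr V i) ?a"
        using act_add[OF s_mem s_mem] act_scale[OF s_mem]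
        by (simp add: linear_on_def s_add s_scale act_add[of _ i] act_scale[of _ i] vs.scale_right_diff_distrib)
    qed
    have aw: "?a (?w k p \<eta> \<omega> xs) = ?w k p \<eta> (\<lambda>xs. ?a (\<omega> xs)) xs" for xs
      by (rule linear_on_subspace.wedge1_post[OF a form_val[OF \<omega>]])
    let ?C = "ce_comm L V s p \<omega>"
    define A where "A = (\<lambda>zs. if k = 0 then 0 else ?w (k - 1) p (ctr x \<eta>) \<omega> zs)"
    define B where "B = (\<lambda>zs. if p = 0 then 0 else ?w k (p - 1) \<eta> (ctr x \<omega>) zs)"
    have cw: "ctr x (?w k p \<eta> \<omega>) = (\<lambda>zs. A zs + vsc V ((-1) ^ k) (B zs))"
      unfolding form_ctr_wedge1[OF \<eta> \<omega>] by (auto simp: A_def B_def)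
    have fA: "form i (k + p - 1) A"
      using form_wedge1[OF sform_ctr \<omega>, of "k - 1" \<eta> x] \<eta> form_zero_form
      by (cases k) (simp_all add: A_def)
    have fB: "form i (k + p - 1) B"
      using form_wedge1[OF \<eta> alt_form_ctr, of i "p - 1" \<omega> x] \<omega> form_zero_form
      by (cases p) (simp_all add: B_def)
    \<comment> \<open>The induction hypothesis for a form of degree k - 1 supplies (-1)^(k - 1),
      whence the minus sign.\<close>
    have cA: "ce_comm L V s (k + p - 1) A zs =
        (if k = 0 then 0 else - vsc V ((-1) ^ k) (?w (k - 1) (Suc p) (ctr x \<eta>) ?C zs))" for zs
    proof (cases k)
      case (Suc k')
      then have "ce_comm L V s (k' + p) (?w k' p (ctr x \<eta>) \<omega>) =
         (\<lambda>xs. vsc V ((-1) ^ k') (?w k' (Suc p) (ctr x \<eta>) ?C xs))"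
        using \<eta> \<omega> by (intro less.hyps sform_ctr) auto
      then show ?thesis using Suc by (simp add: A_def)
    qed (simp add: A_def)
    have cB: "ce_comm L V s (k + p - 1) B zs =
        (if p = 0 then 0 else vsc V ((-1) ^ k) (?w k p \<eta> (ce_comm L V s (p - 1) (ctr x \<omega>)) zs))" for zs
    proof (cases p)
      case (Suc p')
      then have "ce_comm L V s (k + p') (?w k p' \<eta> (ctr x \<omega>)) =
         (\<lambda>xs. vsc V ((-1) ^ k) (?w k (Suc p') \<eta> (ce_comm L V s p' (ctr x \<omega>)) xs))"
        using \<eta> \<omega> by (intro less.hyps alt_form_ctr) auto
      then show ?thesis using Suc by (simp add: B_def)
    qed (simp add: B_def)
    have one: "vsc V ((-1) ^ k) (vsc V ((-1) ^ k) v) = v" for v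
      by (simp flip: power_add mult_2)
    have wC: "ctr x (?w k (Suc p) \<eta> ?C) = (\<lambda>zs. (if k = 0 then 0 else ?w (k - 1) (Suc p) (ctr x \<eta>) ?C zs) +
        vsc V ((-1) ^ k) (?w k p \<eta> (ctr x ?C) zs))"
      unfolding form_ctr_wedge1[OF \<eta> form_ce_comm[OF \<omega>]] by simp
    have wC': "?w k p \<eta> (ctr x ?C) zs = ?w k p \<eta> (\<lambda>xs. ?a (\<omega> xs)) zs -
        (if p = 0 then 0 else ?w k p \<eta> (ce_comm L V s (p - 1) (ctr x \<omega>)) zs)" for zs
      unfolding ctr_ce_comm[OF \<omega>] vs.wedge1_diff_right by simp
    show "ctr x (ce_comm L V s (k + p) (?w k p \<eta> \<omega>)) =
        ctr x (\<lambda>xs. vsc V ((-1) ^ k) (?w k (Suc p) \<eta> ?C xs))"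
    proof
      fix zs
      have "ctr x (ce_comm L V s (k + p) (?w k p \<eta> \<omega>)) zs = ?w k p \<eta> (\<lambda>xs. ?a (\<omega> xs)) zs -
          (if k + p = 0 then 0 else ce_comm L V s (k + p - 1) (\<lambda>zs. A zs + vsc V ((-1) ^ k) (B zs)) zs)"
        unfolding ctr_ce_comm[OF w] aw cw ..
      also have "(if k + p = 0 then 0 else ce_comm L V s (k + p - 1) (\<lambda>zs. A zs + vsc V ((-1) ^ k) (B zs)) zs) =
         ce_comm L V s (k + p - 1) A zs + vsc V ((-1) ^ k) (ce_comm L V s (k + p - 1) B zs)"
        using ce_comm_lin[OF fA fB, of "k + p - 1" 1 "(-1) ^ k" zs] by (auto simp: A_def B_def)
      also have "?w k p \<eta> (\<lambda>xs. ?a (\<omega> xs)) zs - \<dots> = vsc V ((-1) ^ k) (ctr x (?w k (Suc p) \<eta> ?C) zs)"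
        unfolding wC wC' cA cB vs.scale_right_distrib one by simp
      finally show "ctr x (ce_comm L V s (k + p) (?w k p \<eta> \<omega>)) zs =
        ctr x (\<lambda>xs. vsc V ((-1) ^ k) (?w k (Suc p) \<eta> ?C xs)) zs" by simp
    qed
  qed
qed

end

subsection \<open>Maps linear over the scalar forms, and their homotopies\<close>

text \<open>\<open>e\<close> is the degree and \<open>c\<close> the sign acquired in passing a
  1-form: \<open>c = 1\<close> for weak morphisms and \<open>c = -1\<close> for homotopies, so that
  both are treated at once.\<close>

definition om_linear :: "('k::field, 'g::ab_group_add) lie \<Rightarrow> ('k, 'g, 'v::ab_group_add) dgmod
    \<Rightarrow> ('k, 'g, 'w::ab_group_add) dgmod \<Rightarrow> int \<Rightarrow> 'k
    \<Rightarrow> (int \<Rightarrow> (nat \<Rightarrow> 'g list \<Rightarrow> 'v) \<Rightarrow> (nat \<Rightarrow> 'g list \<Rightarrow> 'w)) \<Rightarrow> bool" where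
  "om_linear L V W e c F \<longleftrightarrow>
     (\<forall>n \<omega>. \<omega> \<in> Om L V n \<longrightarrow> F n \<omega> \<in> Om L W (n + e)) \<and>
     (\<forall>n \<omega> \<omega>'. \<omega> \<in> Om L V n \<longrightarrow> \<omega>' \<in> Om L V n \<longrightarrow>
        F n (\<lambda>p xs. \<omega> p xs + \<omega>' p xs) = (\<lambda>p xs. F n \<omega> p xs + F n \<omega>' p xs)) \<and>
     (\<forall>n a \<omega>. \<omega> \<in> Om L V n \<longrightarrow>
        F n (\<lambda>p xs. vsc V a (\<omega> p xs)) = (\<lambda>p xs. vsc W a (F n \<omega> p xs))) \<and>
     (\<forall>k \<eta> n \<omega>. sform L k \<eta> \<longrightarrow> \<omega> \<in> Om L V n \<longrightarrow>
        F (n + int k) (wedge V k \<eta> \<omega>) = (\<lambda>p xs. vsc W (c ^ k) (wedge W k \<eta> (F n \<omega>) p xs)))"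

lemma om_linearI:
  assumes "\<And>n \<omega>. \<omega> \<in> Om L V n \<Longrightarrow> F n \<omega> \<in> Om L W (n + e)"
    and "\<And>n \<omega> \<omega>' p xs. \<omega> \<in> Om L V n \<Longrightarrow> \<omega>' \<in> Om L V n \<Longrightarrow>
        F n (\<lambda>p xs. \<omega> p xs + \<omega>' p xs) p xs = F n \<omega> p xs + F n \<omega>' p xs"
    and "\<And>n a \<omega> p xs. \<omega> \<in> Om L V n \<Longrightarrow> F n (\<lambda>p xs. vsc V a (\<omega> p xs)) p xs = vsc W a (F n \<omega> p xs)"
    and "\<And>k \<eta> n \<omega> p xs. sform L k \<eta> \<Longrightarrow> \<omega> \<in> Om L V n \<Longrightarrow>
        F (n + int k) (wedge V k \<eta> \<omega>) p xs = vsc W (c ^ k) (wedge W k \<eta> (F n \<omega>) p xs)"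
  shows "om_linear L V W e c F"
  unfolding om_linear_def using assms by (auto simp: fun_eq_iff)

lemma om_linear_mem: "om_linear L V W e c F \<Longrightarrow> \<omega> \<in> Om L V n \<Longrightarrow> F n \<omega> \<in> Om L W (n + e)"
  and om_linear_add: "om_linear L V W e c F \<Longrightarrow> \<omega> \<in> Om L V n \<Longrightarrow> \<omega>' \<in> Om L V n \<Longrightarrow>
        F n (\<lambda>p xs. \<omega> p xs + \<omega>' p xs) = (\<lambda>p xs. F n \<omega> p xs + F n \<omega>' p xs)"
  and om_linear_scale: "om_linear L V W e c F \<Longrightarrow> \<omega> \<in> Om L V n \<Longrightarrow>
        F n (\<lambda>p xs. vsc V a (\<omega> p xs)) = (\<lambda>p xs. vsc W a (F n \<omega> p xs))"
  and om_linear_wedge: "om_linear L V W e c F \<Longrightarrow> sform L k \<eta> \<Longrightarrow> \<omega> \<in> Om L V n \<Longrightarrow>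
        F (n + int k) (wedge V k \<eta> \<omega>) = (\<lambda>p xs. vsc W (c ^ k) (wedge W k \<eta> (F n \<omega>) p xs))"
  by (simp_all add: om_linear_def)

lemma homotopic_iff: "homotopic L V W F F' \<longleftrightarrow> (\<exists>h. om_linear L V W (-1) (-1) h \<and>
    (\<forall>n \<omega>. \<omega> \<in> Om L V n \<longrightarrow> (\<lambda>p xs. F' n \<omega> p xs - F n \<omega> p xs) =
        (\<lambda>p xs. dtot L W (n - 1) (h n \<omega>) p xs + h (n + 1) (dtot L V n \<omega>) p xs)))"
  unfolding homotopic_def om_linear_def by (simp add: conj_assoc)

context lie_dgmod
begin

lemma weak_mor_iff: "weak_mor L U V F \<longleftrightarrow> om_linear L U V 0 1 F \<and>
    (\<forall>n \<omega>. \<omega> \<in> Om L U n \<longrightarrow> F (n + 1) (dtot L U n \<omega>) = dtot L V n (F n \<omega>))"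
  unfolding weak_mor_def om_linear_def by (simp add: conj_assoc)

lemma wedge_lin: "wedge V k \<eta> (\<lambda>p xs. vsc V a (\<omega> p xs) + vsc V b (\<omega>' p xs)) p xs =
    vsc V a (wedge V k \<eta> \<omega> p xs) + vsc V b (wedge V k \<eta> \<omega>' p xs)"
  by (simp add: wedge_def vs.wedge1_lin_right)

lemma Om_lin: "\<omega> \<in> Om L V n \<Longrightarrow> \<omega>' \<in> Om L V n \<Longrightarrow>
    (\<lambda>p xs. vsc V a (\<omega> p xs) + vsc V b (\<omega>' p xs)) \<in> Om L V n"
  by (simp add: Om_def alt_form_lin[OF vs.vector_space_axioms carr_subspace])

lemma Om_scale: "\<omega> \<in> Om L V n \<Longrightarrow> (\<lambda>p xs. vsc V a (\<omega> p xs)) \<in> Om L V n"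
  by (simp add: Om_def form_smult)

lemma Om_add: "\<omega> \<in> Om L V n \<Longrightarrow> \<omega>' \<in> Om L V n \<Longrightarrow> (\<lambda>p xs. \<omega> p xs + \<omega>' p xs) \<in> Om L V n"
  by (simp add: Om_def form_plus)

lemma Om_zero: "(\<lambda>p xs. 0) \<in> Om L V n"
  by (simp add: Om_def form_zero_form)

lemma dtot_lin:
  assumes "\<omega> \<in> Om L V n" "\<omega>' \<in> Om L V n"
  shows "dtot L V n (\<lambda>p xs. vsc V a (\<omega> p xs) + vsc V b (\<omega>' p xs)) p xs =
    vsc V a (dtot L V n \<omega> p xs) + vsc V b (dtot L V n \<omega>' p xs)"
proof -
  have d: "dif V (n - int p) (vsc V a (\<omega> p xs) + vsc V b (\<omega>' p xs)) =
     vsc V a (dif V (n - int p) (\<omega> p xs)) + vsc V b (dif V (n - int p) (\<omega>' p xs))" for p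
    using dif_add[OF carr_scale carr_scale] dif_scale Om_val[OF assms(1)] Om_val[OF assms(2)] by simp
  show ?thesis
  proof (cases p)
    case 0
    then show ?thesis using d[of 0]
      by (simp add: dtot_0[OF assms(1)] dtot_0[OF assms(2)] dtot_0[OF Om_lin[OF assms]])
  next
    case (Suc q)
    then show ?thesis using d[of "Suc q"] ce_lin[OF OmD[OF assms(1), of q] OmD[OF assms(2), of q], of q a b xs]
      by (simp add: dtot_Suc[OF assms(1)] dtot_Suc[OF assms(2)] dtot_Suc[OF Om_lin[OF assms]]
          vs.scale_right_distrib mult.commute del: power_Suc)
  qed
qed

lemma dtot_add: "\<omega> \<in> Om L V n \<Longrightarrow> \<omega>' \<in> Om L V n \<Longrightarrow>
   dtot L V n (\<lambda>p xs. \<omega> p xs + \<omega>' p xs) = (\<lambda>p xs. dtot L V n \<omega> p xs + dtot L V n \<omega>' p xs)"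
  using dtot_lin[of \<omega> n \<omega>' 1 1] by (simp add: fun_eq_iff)

lemma dtot_diff: "\<omega> \<in> Om L V n \<Longrightarrow> \<omega>' \<in> Om L V n \<Longrightarrow>
   dtot L V n (\<lambda>p xs. \<omega> p xs - \<omega>' p xs) = (\<lambda>p xs. dtot L V n \<omega> p xs - dtot L V n \<omega>' p xs)"
  using dtot_lin[of \<omega> n \<omega>' 1 "-1"] by (simp add: fun_eq_iff)

lemma dtot_uminus: "\<omega> \<in> Om L V n \<Longrightarrow> dtot L V n (\<lambda>p xs. - \<omega> p xs) = (\<lambda>p xs. - dtot L V n \<omega> p xs)"
  using dtot_lin[of \<omega> n \<omega> "-1" 0] by (simp add: fun_eq_iff)

lemma om_linear_lin:
  assumes F: "om_linear L U V e c F" and G: "om_linear L U V e c G"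
  shows "om_linear L U V e c (\<lambda>n \<omega> p xs. vsc V a (F n \<omega> p xs) + vsc V b (G n \<omega> p xs))"
proof (rule om_linearI)
  show "(\<lambda>p xs. vsc V a (F n \<omega> p xs) + vsc V b (G n \<omega> p xs)) \<in> Om L V (n + e)"
    if "\<omega> \<in> Om L U n" for n \<omega>
    by (intro Om_lin om_linear_mem[OF F that] om_linear_mem[OF G that])
qed (simp_all add: om_linear_add[OF F] om_linear_add[OF G] om_linear_scale[OF F] om_linear_scale[OF G]
    om_linear_wedge[OF F] om_linear_wedge[OF G] vs.scale_right_distrib wedge_lin mult.commute add_ac)

lemma om_linear_plus:
  assumes F: "om_linear L U V e c F" and G: "om_linear L U V e c G"
  shows "om_linear L U V e c (\<lambda>n \<omega> p xs. F n \<omega> p xs + G n \<omega> p xs)"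
  using om_linear_lin[OF assms, of 1 1] by simp

lemma om_linear_minus:
  assumes F: "om_linear L U V e c F" and G: "om_linear L U V e c G"
  shows "om_linear L U V e c (\<lambda>n \<omega> p xs. F n \<omega> p xs - G n \<omega> p xs)"
  using om_linear_lin[OF assms, of 1 "-1"] by simp

lemma om_linear_uminus:
  assumes F: "om_linear L U V e c F"
  shows "om_linear L U V e c (\<lambda>n \<omega> p xs. - F n \<omega> p xs)"
  using om_linear_lin[OF assms assms, of "-1" 0] by simp

end

lemma om_linear_zero:
  assumes "lie_dgmod L V" "lie_dgmod L W" "om_linear L V W e c F"
  shows "F n (\<lambda>p xs. 0) = (\<lambda>p xs. 0)"
proof -
  interpret v: lie_dgmod L V by fact
  interpret w: lie_dgmod L W by fact
  show ?thesis using om_linear_scale[OF assms(3) v.Om_zero, of n 0] by simp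
qed

lemma om_linear_neg:
  assumes "lie_dgmod L V" "lie_dgmod L W" "om_linear L V W e c F" "\<omega> \<in> Om L V n"
  shows "F n (\<lambda>p xs. - \<omega> p xs) = (\<lambda>p xs. - F n \<omega> p xs)"
proof -
  interpret v: lie_dgmod L V by fact
  interpret w: lie_dgmod L W by fact
  show ?thesis using om_linear_scale[OF assms(3,4), of "-1"] by simp
qed

lemma om_linear_diff:
  assumes "lie_dgmod L V" "lie_dgmod L W" "om_linear L V W e c F" "\<omega> \<in> Om L V n" "\<omega>' \<in> Om L V n"
  shows "F n (\<lambda>p xs. \<omega> p xs - \<omega>' p xs) = (\<lambda>p xs. F n \<omega> p xs - F n \<omega>' p xs)"
proof -
  interpret v: lie_dgmod L V by fact
  have "(\<lambda>p xs. - \<omega>' p xs) \<in> Om L V n" using v.Om_scale[OF assms(5), of "-1"] by simp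
  from om_linear_add[OF assms(3,4) this] om_linear_neg[OF assms(1,2,3,5)] show ?thesis
    by simp
qed

lemma om_linear_sum:
  assumes "lie_dgmod L V" "lie_dgmod L W" "om_linear L V W e c F" "\<And>b. b \<in> B \<Longrightarrow> \<omega> b \<in> Om L V n"
    and "finite B"
  shows "(\<lambda>p xs. \<Sum>b\<in>B. \<omega> b p xs) \<in> Om L V n \<and>
    F n (\<lambda>p xs. \<Sum>b\<in>B. \<omega> b p xs) = (\<lambda>p xs. \<Sum>b\<in>B. F n (\<omega> b) p xs)"
proof -
  interpret v: lie_dgmod L V by fact
  from assms(5,4) show ?thesis
  proof (induction B rule: finite_induct)
    case empty
    then show ?case using v.Om_zero om_linear_zero[OF assms(1-3)] by simp
  next
    case (insert b B)
    then show ?case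
      using v.Om_add[of "\<omega> b" n "\<lambda>p xs. \<Sum>b\<in>B. \<omega> b p xs"]
        om_linear_add[OF assms(3), of "\<omega> b" n "\<lambda>p xs. \<Sum>b\<in>B. \<omega> b p xs"] by simp
  qed
qed

lemma om_linear_comp:
  assumes W: "lie_dgmod_char0 L W" and U: "lie_dgmod_char0 L U"
    and F: "om_linear L V W e c F" and G: "om_linear L W U e' c' G"
  shows "om_linear L V U (e + e') (c * c') (\<lambda>n \<omega>. G (n + e) (F n \<omega>))"
proof (rule om_linearI)
  interpret w: lie_dgmod_char0 L W by fact
  interpret u: lie_dgmod_char0 L U by fact
  note Fm = om_linear_mem[OF F]
  show "G (n + e) (F n \<omega>) \<in> Om L U (n + (e + e'))" if "\<omega> \<in> Om L V n" for n \<omega>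
    using om_linear_mem[OF G Fm[OF that]] by (simp add: add.assoc)
  show "G (n + e) (F n (\<lambda>p xs. \<omega> p xs + \<omega>' p xs)) p xs = G (n + e) (F n \<omega>) p xs + G (n + e) (F n \<omega>') p xs"
    if "\<omega> \<in> Om L V n" "\<omega>' \<in> Om L V n" for n \<omega> \<omega>' p xs
    using om_linear_add[OF F that] om_linear_add[OF G Fm[OF that(1)] Fm[OF that(2)]] by simp
  show "G (n + e) (F n (\<lambda>p xs. vsc V a (\<omega> p xs))) p xs = vsc U a (G (n + e) (F n \<omega>) p xs)"
    if "\<omega> \<in> Om L V n" for n a \<omega> p xs
    using om_linear_scale[OF F that] om_linear_scale[OF G Fm[OF that]] by simp
  show "G (n + int k + e) (F (n + int k) (wedge V k \<eta> \<omega>)) p xs =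
      vsc U ((c * c') ^ k) (wedge U k \<eta> (G (n + e) (F n \<omega>)) p xs)"
    if "sform L k \<eta>" "\<omega> \<in> Om L V n" for k \<eta> n \<omega> p xs
  proof -
    have e: "n + int k + e = n + e + int k" by simp
    show ?thesis
      unfolding e om_linear_wedge[OF F that] om_linear_scale[OF G w.wedge_Om[OF that(1) Fm[OF that(2)]]]
        om_linear_wedge[OF G that(1) Fm[OF that(2)]]
      by (simp add: power_mult_distrib)
  qed
qed

section \<open>Symmetry, transitivity and composition of homotopies\<close>

text \<open>Weak morphisms are constrained only on \<open>Om\<close>, so equality of maps is
  replaced by agreement there.\<close>

lemma homotopic_cong:
  assumes "homotopic L V W F F'" "\<And>n \<omega>. \<omega> \<in> Om L V n \<Longrightarrow> F n \<omega> = G n \<omega>"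
    "\<And>n \<omega>. \<omega> \<in> Om L V n \<Longrightarrow> F' n \<omega> = G' n \<omega>"
  shows "homotopic L V W G G'"
  using assms unfolding homotopic_iff by auto

lemma homotopic_sym:
  assumes "lie_dgmod L V" "lie_dgmod L W" "homotopic L V W F F'"
  shows "homotopic L V W F' F"
proof -
  interpret w: lie_dgmod L W by fact
  from assms(3) obtain h where h: "om_linear L V W (-1) (-1) h"
    and eq: "\<And>n \<omega>. \<omega> \<in> Om L V n \<Longrightarrow> (\<lambda>p xs. F' n \<omega> p xs - F n \<omega> p xs) =
        (\<lambda>p xs. dtot L W (n - 1) (h n \<omega>) p xs + h (n + 1) (dtot L V n \<omega>) p xs)"
    by (auto simp: homotopic_iff)
  show ?thesis
    unfolding homotopic_iff
  proof (intro exI conjI allI impI)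
    show "om_linear L V W (-1) (-1) (\<lambda>n \<omega> p xs. - h n \<omega> p xs)" by (rule w.om_linear_uminus[OF h])
    fix n \<omega> assume \<omega>: "\<omega> \<in> Om L V n"
    show "(\<lambda>p xs. F n \<omega> p xs - F' n \<omega> p xs) =
      (\<lambda>p xs. dtot L W (n - 1) (\<lambda>p xs. - h n \<omega> p xs) p xs + - h (n + 1) (dtot L V n \<omega>) p xs)"
    proof (intro ext)
      fix p xs
      have "F' n \<omega> p xs - F n \<omega> p xs = dtot L W (n - 1) (h n \<omega>) p xs + h (n + 1) (dtot L V n \<omega>) p xs"
        using eq[OF \<omega>] by meson
      then show "F n \<omega> p xs - F' n \<omega> p xs =
          dtot L W (n - 1) (\<lambda>p xs. - h n \<omega> p xs) p xs + - h (n + 1) (dtot L V n \<omega>) p xs"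
        using w.dtot_uminus[of "h n \<omega>" "n - 1"] om_linear_mem[OF h \<omega>] by (simp add: algebra_simps)
    qed
  qed
qed

lemma homotopic_trans:
  assumes "lie_dgmod L V" "lie_dgmod L W" "homotopic L V W F F'" "homotopic L V W F' F''"
  shows "homotopic L V W F F''"
proof -
  interpret w: lie_dgmod L W by fact
  from assms(3) obtain h where h: "om_linear L V W (-1) (-1) h"
    and eq: "\<And>n \<omega>. \<omega> \<in> Om L V n \<Longrightarrow> (\<lambda>p xs. F' n \<omega> p xs - F n \<omega> p xs) =
        (\<lambda>p xs. dtot L W (n - 1) (h n \<omega>) p xs + h (n + 1) (dtot L V n \<omega>) p xs)"
    by (auto simp: homotopic_iff)
  from assms(4) obtain h' where h': "om_linear L V W (-1) (-1) h'"
    and eq': "\<And>n \<omega>. \<omega> \<in> Om L V n \<Longrightarrow> (\<lambda>p xs. F'' n \<omega> p xs - F' n \<omega> p xs) =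
        (\<lambda>p xs. dtot L W (n - 1) (h' n \<omega>) p xs + h' (n + 1) (dtot L V n \<omega>) p xs)"
    by (auto simp: homotopic_iff)
  show ?thesis
    unfolding homotopic_iff
  proof (intro exI conjI allI impI)
    show "om_linear L V W (-1) (-1) (\<lambda>n \<omega> p xs. h n \<omega> p xs + h' n \<omega> p xs)"
      by (rule w.om_linear_plus[OF h h'])
    fix n \<omega> assume \<omega>: "\<omega> \<in> Om L V n"
    show "(\<lambda>p xs. F'' n \<omega> p xs - F n \<omega> p xs) =
      (\<lambda>p xs. dtot L W (n - 1) (\<lambda>p xs. h n \<omega> p xs + h' n \<omega> p xs) p xs +
        (h (n + 1) (dtot L V n \<omega>) p xs + h' (n + 1) (dtot L V n \<omega>) p xs))"
    proof (intro ext)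
      fix p xs
      have "F' n \<omega> p xs - F n \<omega> p xs = dtot L W (n - 1) (h n \<omega>) p xs + h (n + 1) (dtot L V n \<omega>) p xs"
        using eq[OF \<omega>] by meson
      moreover have "F'' n \<omega> p xs - F' n \<omega> p xs =
          dtot L W (n - 1) (h' n \<omega>) p xs + h' (n + 1) (dtot L V n \<omega>) p xs"
        using eq'[OF \<omega>] by meson
      ultimately show "F'' n \<omega> p xs - F n \<omega> p xs =
          dtot L W (n - 1) (\<lambda>p xs. h n \<omega> p xs + h' n \<omega> p xs) p xs +
          (h (n + 1) (dtot L V n \<omega>) p xs + h' (n + 1) (dtot L V n \<omega>) p xs)"
        using w.dtot_add[of "h n \<omega>" "n - 1" "h' n \<omega>"] om_linear_mem[OF h \<omega>] om_linear_mem[OF h' \<omega>]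
        by (simp add: algebra_simps)
    qed
  qed
qed

text \<open>\<open>G\<close> after a homotopy is a homotopy, because \<open>G\<close> is additive
  and commutes with the total differentials. With the identity for \<open>F\<close> and the
  retraction for \<open>F'\<close> this compares \<open>G\<close> with its composite with the
  retraction.\<close>

lemma homotopic_comp_left:
  assumes V: "lie_dgmod_char0 L V" and W: "lie_dgmod_char0 L W" and U: "lie_dgmod_char0 L U"
    and G: "weak_mor L W U G" and F: "weak_mor L V W F" and F': "weak_mor L V W F'"
    and "homotopic L V W F F'"
  shows "homotopic L V U (comp_wm G F) (comp_wm G F')"
proof -
  interpret v: lie_dgmod_char0 L V by fact
  interpret w: lie_dgmod_char0 L W by fact
  interpret u: lie_dgmod_char0 L U by fact
  from assms(7) obtain h where h: "om_linear L V W (-1) (-1) h"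
    and eq: "\<And>n \<omega>. \<omega> \<in> Om L V n \<Longrightarrow> (\<lambda>p xs. F' n \<omega> p xs - F n \<omega> p xs) =
        (\<lambda>p xs. dtot L W (n - 1) (h n \<omega>) p xs + h (n + 1) (dtot L V n \<omega>) p xs)"
    by (auto simp: homotopic_iff)
  have G': "om_linear L W U 0 1 G"
    and Gd: "\<And>n \<omega>. \<omega> \<in> Om L W n \<Longrightarrow> G (n + 1) (dtot L W n \<omega>) = dtot L U n (G n \<omega>)"
    using G by (auto simp: u.weak_mor_iff)
  have Fm: "F n \<omega> \<in> Om L W n" "F' n \<omega> \<in> Om L W n" if "\<omega> \<in> Om L V n" for n \<omega>
    using that F F' by (auto simp: weak_mor_def)
  show ?thesis
    unfolding homotopic_iff
  proof (intro exI conjI allI impI)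
    show "om_linear L V U (-1) (-1) (\<lambda>n \<omega>. G (n + -1) (h n \<omega>))"
      using om_linear_comp[OF W U h G'] by simp
    fix n \<omega> assume \<omega>: "\<omega> \<in> Om L V n"
    have hm: "h n \<omega> \<in> Om L W (n - 1)" using om_linear_mem[OF h \<omega>] by simp
    have hm': "h (n + 1) (dtot L V n \<omega>) \<in> Om L W n"
      using om_linear_mem[OF h v.dtot_Om[OF \<omega>]] by simp
    have dm: "dtot L W (n - 1) (h n \<omega>) \<in> Om L W n" using w.dtot_Om[OF hm] by simp
    have "(\<lambda>p xs. comp_wm G F' n \<omega> p xs - comp_wm G F n \<omega> p xs) =
        G n (\<lambda>p xs. F' n \<omega> p xs - F n \<omega> p xs)"
      using om_linear_diff[OF w.lie_dgmod_axioms u.lie_dgmod_axioms G' Fm(2)[OF \<omega>] Fm(1)[OF \<omega>]]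
      by (simp add: comp_wm_def)
    also have "\<dots> = (\<lambda>p xs. G n (dtot L W (n - 1) (h n \<omega>)) p xs + G n (h (n + 1) (dtot L V n \<omega>)) p xs)"
      unfolding eq[OF \<omega>] by (rule om_linear_add[OF G' dm hm'])
    also have "G n (dtot L W (n - 1) (h n \<omega>)) = dtot L U (n - 1) (G (n - 1) (h n \<omega>))"
      using Gd[OF hm] by simp
    finally show "(\<lambda>p xs. comp_wm G F' n \<omega> p xs - comp_wm G F n \<omega> p xs) =
       (\<lambda>p xs. dtot L U (n - 1) (G (n + -1) (h n \<omega>)) p xs + G (n + 1 + -1) (h (n + 1) (dtot L V n \<omega>)) p xs)"
      by simp
  qed
qed

lemma weak_mor_comp:
  assumes W: "lie_dgmod_char0 L W" and U: "lie_dgmod_char0 L U"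
    and G: "weak_mor L W U G" and F: "weak_mor L V W F"
  shows "weak_mor L V U (comp_wm G F)"
proof -
  interpret w: lie_dgmod_char0 L W by fact
  interpret u: lie_dgmod_char0 L U by fact
  have "om_linear L V U 0 1 (comp_wm G F)"
    using om_linear_comp[OF W U, of V 0 1 F 0 1 G] F G
    by (simp add: comp_wm_def w.weak_mor_iff u.weak_mor_iff)
  moreover have "F n \<omega> \<in> Om L W n" if "\<omega> \<in> Om L V n" for n \<omega>
    using that F by (auto simp: weak_mor_def)
  ultimately show ?thesis
    using F G by (simp add: comp_wm_def w.weak_mor_iff u.weak_mor_iff)
qed

text \<open>The factor c^p is the sign of a map of values passing a p-form; on a product with a
  k-form it splits as c^k c^(p - k). Strict morphisms, the projection onto the kernel and the
  homotopy \<open>h\<close> all have this shape.\<close>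

lemma om_linear_post:
  assumes V: "lie_dgmod_char0 L V" and W: "lie_dgmod_char0 L W"
    and lin: "\<And>i. linear_on (vsc V) (vsc W) (carr V i) (\<phi> i)"
    and mem: "\<And>i v. v \<in> carr V i \<Longrightarrow> \<phi> i v \<in> carr W (i + e)"
  shows "om_linear L V W e c (\<lambda>n \<omega> p xs. vsc W (c ^ p) (\<phi> (n - int p) (\<omega> p xs)))"
proof -
  interpret v: lie_dgmod_char0 L V by fact
  interpret w: lie_dgmod_char0 L W by fact
  note l = v.linear_on_subspaceI[OF w.lie_dgmod_axioms lin]
  show ?thesis
  proof (rule om_linearI)
    fix n \<omega> assume \<omega>: "\<omega> \<in> Om L V n"
    note val = v.Om_val[OF \<omega>]
    show "(\<lambda>p xs. vsc W (c ^ p) (\<phi> (n - int p) (\<omega> p xs))) \<in> Om L W (n + e)"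
    proof (rule w.OmI)
      fix p
      have "w.form (n - int p + e) p (\<lambda>xs. \<phi> (n - int p) (\<omega> p xs))"
        by (rule linear_on_subspace.alt_form_post[OF l v.OmD[OF \<omega>] mem])
      then show "w.form (n + e - int p) p (\<lambda>xs. vsc W (c ^ p) (\<phi> (n - int p) (\<omega> p xs)))"
        using w.form_smult[of L "n - int p + e" p] by (simp add: algebra_simps)
    qed
    show "vsc W (c ^ p) (\<phi> (n - int p) (vsc V a (\<omega> p xs))) = vsc W a (vsc W (c ^ p) (\<phi> (n - int p) (\<omega> p xs)))"
      for a p xs
      using linear_on_subspace.scale[OF l val] by (simp add: mult.commute)
    show "vsc W (c ^ p) (\<phi> (n - int p) (\<omega> p xs + \<omega>' p xs)) =
        vsc W (c ^ p) (\<phi> (n - int p) (\<omega> p xs)) + vsc W (c ^ p) (\<phi> (n - int p) (\<omega>' p xs))"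
      if "\<omega>' \<in> Om L V n" for \<omega>' p xs
      using linear_on_subspace.add[OF l val v.Om_val[OF that]] by (simp add: w.vs.scale_right_distrib)
    show "vsc W (c ^ p) (\<phi> (n + int k - int p) (wedge V k \<eta> \<omega> p xs)) =
      vsc W (c ^ k) (wedge W k \<eta> (\<lambda>p xs. vsc W (c ^ p) (\<phi> (n - int p) (\<omega> p xs))) p xs)"
      if "sform L k \<eta>" for k \<eta> p xs
    proof (cases "k \<le> p")
      case False
      then show ?thesis using linear_on_subspace.zero[OF l] by (simp add: wedge_def)
    next
      case True
      have e: "n + int k - int p = n - int (p - k)" using True by simp
      have "\<phi> (n - int (p - k)) (wedge1 (vsc V) k (p - k) \<eta> (\<omega> (p - k)) xs) =
          wedge1 (vsc W) k (p - k) \<eta> (\<lambda>xs. \<phi> (n - int (p - k)) (\<omega> (p - k) xs)) xs"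
        by (rule linear_on_subspace.wedge1_post[OF l]) (rule val)
      then show ?thesis
        unfolding wedge_def if_P[OF True] e w.vs.wedge1_scale_right
        using True by (simp flip: power_add)
    qed
  qed
qed

section \<open>Generation of forms by elements of form degree zero\<close>

lemma wedge1_scalar:
  fixes sv :: "'k::field_char_0 \<Rightarrow> 'v::ab_group_add \<Rightarrow> 'v"
  assumes sv: "vector_space sv" and \<zeta>: "sform L 0 \<zeta>" and \<omega>: "alt_form L sv S p \<omega>"
  shows "wedge1 sv 0 p \<zeta> \<omega> = (\<lambda>xs. sv (\<zeta> []) (\<omega> xs))"
  using \<omega>
proof (induction p arbitrary: \<omega>)
  interpret vector_space sv by fact
  case 0
  moreover have "{\<sigma>::nat \<Rightarrow> nat. \<forall>x. \<sigma> x = x} = {id}" by auto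
  ultimately show ?case by (auto simp: fun_eq_iff wedge1_def alt_form_0_iff)
next
  interpret vector_space sv by fact
  case (Suc p)
  show ?case
  proof (rule form_eqI)
    show "wedge1 sv 0 (Suc p) \<zeta> \<omega> [] = sv (\<zeta> []) (\<omega> [])"
      using alt_form_zero[OF Suc.prems, of "[]"] by (simp add: wedge1_def)
    show "ctr x (wedge1 sv 0 (Suc p) \<zeta> \<omega>) = ctr x (\<lambda>xs. sv (\<zeta> []) (\<omega> xs))" for x
      unfolding ctr_wedge1[OF sv \<zeta> Suc.prems] using Suc.IH[OF alt_form_ctr[OF Suc.prems]]
      by (simp add: ctr_def)
  qed
qed

text \<open>A basis is extracted from the finite spanning set so that the coordinates become linear
  functionals.\<close>

lemma finite_dim_coordinates:
  fixes L :: "('k::field, 'g::ab_group_add) lie"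
  assumes "lie_algebra L" "finite_dim L"
  obtains B cf where "finite B" "\<And>b x y. cf b (x + y) = cf b x + cf b y"
    "\<And>b c x. cf b (lsc L c x) = c * cf b x" "\<And>x. (\<Sum>b\<in>B. lsc L (cf b x) b) = x"
proof -
  interpret vector_space "lsc L" using assms(1) by (simp add: lie_algebra_def)
  obtain A where A: "finite A" "span A = UNIV" using assms(2) by (auto simp: finite_dim_def)
  obtain B where B: "B \<subseteq> A" "independent B" "A \<subseteq> span B"
    using maximal_independent_subset[of A] by blast
  have sB: "x \<in> span B" for x using span_minimal[OF B(3) subspace_span] A(2) by auto
  have fB: "finite B" using A B finite_subset by blast
  show ?thesis
  proof (rule that[OF fB])
    show "representation B (x + y) b = representation B x b + representation B y b" for b x y
      using representation_add[OF B(2) sB sB] by simp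
    show "representation B (lsc L c x) b = c * representation B x b" for b c x
      using representation_scale[OF B(2) sB] by simp
    show "(\<Sum>b\<in>B. lsc L (representation B x b) b) = x" for x
      by (rule sum_representation_eq[OF B(2) sB fB subset_refl])
  qed
qed

definition coform :: "('g \<Rightarrow> 'k::zero) \<Rightarrow> 'g list \<Rightarrow> 'k" where
  "coform f xs = (if length xs = 1 then f (xs ! 0) else 0)"

lemma sform_coform:
  assumes "\<And>x y. f (x + y) = f x + f y" "\<And>c x. f (lsc L c x) = c * f x"
  shows "sform L 1 (coform f)"
  using assms by (auto simp: sform_def alt_form_def coform_def)

text \<open>An Euler identity. Contract with x: the part in which the dual vector meets x sums to
  the contraction of t by the expansion of x. The other part is the same sum for the contracted
  form, the sign of the derivation rule cancelling that of exchanging two contractions. Each degree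
  adds one copy of t.\<close>

lemma (in lie_dgmod_char0) sum_wedge_ctr:
  assumes "finite B" "\<And>b x y. cf b (x + y) = cf b x + cf b y"
    "\<And>b c x. cf b (lsc L c x) = c * cf b x" "\<And>x. (\<Sum>b\<in>B. lsc L (cf b x) b) = x"
    and "form i (Suc q) t"
  shows "(\<Sum>b\<in>B. wedge1 (vsc V) 1 q (coform (cf b)) (ctr b t) xs) = vsc V (of_nat (Suc q)) (t xs)"
proof -
  \<comment> \<open>Base case and induction step at once, hence the guard
    \<open>q \<noteq> 0\<close> on the induction hypothesis.\<close>
  have step: "(\<Sum>b\<in>B. wedge1 (vsc V) 1 q (coform (cf b)) (ctr b t) xs) = vsc V (of_nat (Suc q)) (t xs)"
    if IH: "\<And>t xs. q \<noteq> 0 \<Longrightarrow> form i q t \<Longrightarrow>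
        (\<Sum>b\<in>B. wedge1 (vsc V) 1 (q - 1) (coform (cf b)) (ctr b t) xs) = vsc V (of_nat q) (t xs)"
      and t: "form i (Suc q) t" for q t xs
  proof -
    note cof = sform_coform[of "cf b" L for b, OF assms(2,3)]
    have "(\<Sum>b\<in>B. wedge1 (vsc V) 1 q (coform (cf b)) (ctr b t) (x # zs)) = vsc V (of_nat (Suc q)) (t (x # zs))" for x zs
    proof -
      interpret l: linear_on_subspace "lsc L" "vsc V" UNIV "\<lambda>y. t (y # zs)"
        using ctr_add[OF t] form_ctr_scale[OF t] gs.subspace_UNIV
        by unfold_locales (auto simp: linear_on_def fun_eq_iff)
      have "wedge1 (vsc V) 1 q (coform (cf b)) (ctr b t) (x # zs) = vsc V (cf b x) (t (b # zs)) +
         (if q = 0 then 0 else wedge1 (vsc V) 1 (q - 1) (coform (cf b)) (ctr b (ctr x t)) zs)" for b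
      proof -
        have "wedge1 (vsc V) 1 q (coform (cf b)) (ctr b t) (x # zs) = ctr x (wedge1 (vsc V) 1 q (coform (cf b)) (ctr b t)) zs"
          by simp
        also have "\<dots> = wedge1 (vsc V) 0 q (ctr x (coform (cf b))) (ctr b t) zs -
            (if q = 0 then 0 else wedge1 (vsc V) 1 (q - 1) (coform (cf b)) (ctr x (ctr b t)) zs)"
          unfolding form_ctr_wedge1[OF cof alt_form_ctr[OF t]] by simp
        also have "wedge1 (vsc V) 0 q (ctr x (coform (cf b))) (ctr b t) zs = vsc V (cf b x) (t (b # zs))"
          using wedge1_scalar[OF vs.vector_space_axioms _ alt_form_ctr[OF t], of "ctr x (coform (cf b))" b]
            sform_ctr[of L 0] cof[of b] by (simp add: coform_def)
        also have "ctr x (ctr b t) = (\<lambda>ys. - ctr b (ctr x t) ys)"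
          by (rule ext) (simp only: ctr_apply, rule alt_form_swap[OF t])
        also have "wedge1 (vsc V) 1 (q - 1) (coform (cf b)) (\<lambda>ys. - ctr b (ctr x t) ys) zs =
            - wedge1 (vsc V) 1 (q - 1) (coform (cf b)) (ctr b (ctr x t)) zs"
          using vs.wedge1_scale_right[of 1 "q - 1" "coform (cf b)" "-1" "ctr b (ctr x t)" zs]
          by (simp del: ctr_apply)
        finally show ?thesis by (simp split: if_splits del: ctr_apply)
      qed
      then have "(\<Sum>b\<in>B. wedge1 (vsc V) 1 q (coform (cf b)) (ctr b t) (x # zs)) =
         (\<Sum>b\<in>B. vsc V (cf b x) (t (b # zs))) +
         (\<Sum>b\<in>B. if q = 0 then 0 else wedge1 (vsc V) 1 (q - 1) (coform (cf b)) (ctr b (ctr x t)) zs)"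
        by (simp only: sum.distrib)
      also have "(\<Sum>b\<in>B. vsc V (cf b x) (t (b # zs))) = t (x # zs)"
        using l.sum[of B "\<lambda>b. lsc L (cf b x) b"] l.scale assms(4)[of x] by simp
      also have "(\<Sum>b\<in>B. if q = 0 then 0 else wedge1 (vsc V) 1 (q - 1) (coform (cf b)) (ctr b (ctr x t)) zs) =
         vsc V (of_nat q) (t (x # zs))"
        using IH[OF _ alt_form_ctr[OF t, of x], of zs] by (cases "q = 0") simp_all
      finally show ?thesis by (simp add: vs.scale_left_distrib del: ctr_apply)
    qed
    moreover have "(\<Sum>b\<in>B. wedge1 (vsc V) 1 q (coform (cf b)) (ctr b t) []) = vsc V (of_nat (Suc q)) (t [])"
      using alt_form_zero[OF t, of "[]"] by (simp add: wedge1_def)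
    ultimately show ?thesis
      by (cases xs) auto
  qed
  from assms(5) show ?thesis
  proof (induction q arbitrary: t xs)
    case 0
    then show ?case by (intro step) auto
  next
    case (Suc q)
    then show ?case by (intro step) (simp_all del: ctr_apply of_nat_Suc)
  qed
qed

definition single :: "nat \<Rightarrow> ('g list \<Rightarrow> 'v::zero) \<Rightarrow> nat \<Rightarrow> 'g list \<Rightarrow> 'v" where
  "single q t p = (if p = q then t else (\<lambda>_. 0))"

lemma single_0_eq_emb: "alt_form L sv S 0 t \<Longrightarrow> single 0 t = emb (t [])"
  by (auto simp: single_def emb_def fun_eq_iff alt_form_0_iff)

text \<open>This is where finite dimension enters: \<open>\<Omega>(V)\<close> is generated by \<open>V\<close> as a module over
  the scalar forms, because \<open>p \<cdot> t = \<Sum>\<^sub>b b\<^sup>* \<and> \<iota>\<^sub>b t\<close> for every \<open>p\<close>-form \<open>t\<close>.\<close>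

lemma om_linear_eqI:
  fixes L :: "('k::field_char_0, 'g::ab_group_add) lie"
  assumes M: "lie_dgmod_char0 L M" and U: "lie_dgmod_char0 L U" and fin: "finite_dim L"
    and conc: "\<And>i. i \<noteq> 0 \<Longrightarrow> carr M i = {0}"
    and F: "om_linear L M U e c F" and G: "om_linear L M U e c G"
    and eq: "\<And>v. v \<in> carr M 0 \<Longrightarrow> F 0 (emb v) = G 0 (emb v)"
    and \<omega>: "\<omega> \<in> Om L M n"
  shows "F n \<omega> = G n \<omega>"
proof -
  interpret m: lie_dgmod_char0 L M by fact
  interpret u: lie_dgmod_char0 L U by fact
  obtain B cf where B: "finite B" "\<And>b x y. cf b (x + y) = cf b x + cf b y"
    "\<And>b c x. cf b (lsc L c x) = c * cf b x" "\<And>x. (\<Sum>b\<in>B. lsc L (cf b x) b) = x"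
    using finite_dim_coordinates[OF m.lie fin] by blast
  note cof = sform_coform[of "cf b" L for b, OF B(2,3)]
  have single_Om: "single q t \<in> Om L M (int q)" if "m.form 0 q t" for q t
    using that m.form_zero_form by (auto simp: Om_def single_def)
  have single_eq: "F (int q) (single q t) = G (int q) (single q t)" if "m.form 0 q t" for q t
    using that
  proof (induction q arbitrary: t)
    case 0
    then show ?case using single_0_eq_emb[OF 0] eq[OF m.form_val[OF 0]] by simp
  next
    case (Suc q)
    \<comment> \<open>The division cancels the factor \<open>Suc q\<close> of
      \<open>sum_wedge_ctr\<close>, so the sum of the wedge products is exactly
      \<open>t\<close>.\<close>
    define t' where "t' = (\<lambda>xs. vsc M (1 / of_nat (Suc q)) (t xs))"
    have t': "m.form 0 (Suc q) t'" unfolding t'_def by (rule m.form_smult[OF Suc.prems])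
    let ?\<omega> = "\<lambda>b. wedge M 1 (coform (cf b)) (single q (ctr b t'))"
    have "single (Suc q) t = (\<lambda>p xs. \<Sum>b\<in>B. ?\<omega> b p xs)"
    proof (intro ext)
      fix p xs
      show "single (Suc q) t p xs = (\<Sum>b\<in>B. ?\<omega> b p xs)"
      proof (cases "p = Suc q")
        case True
        have "(\<Sum>b\<in>B. ?\<omega> b p xs) = vsc M (of_nat (Suc q)) (t' xs)"
          using m.sum_wedge_ctr[OF B t', of xs] True by (simp add: wedge_def single_def)
        also have "\<dots> = t xs" by (simp add: t'_def del: of_nat_Suc)
        finally show ?thesis using True by (simp add: single_def)
      next
        case False
        then have "?\<omega> b p xs = 0" for b by (cases p) (auto simp: wedge_def single_def)
        then show ?thesis using False by (simp add: single_def)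
      qed
    qed
    moreover have \<omega>': "?\<omega> b \<in> Om L M (int (Suc q))" for b
      using m.wedge_Om[OF cof single_Om[OF alt_form_ctr[OF t', of b]], of b] by (simp add: add.commute)
    have "F (int (Suc q)) (?\<omega> b) = G (int (Suc q)) (?\<omega> b)" for b
      using om_linear_wedge[OF F cof single_Om[OF alt_form_ctr[OF t', of b]], of b]
        om_linear_wedge[OF G cof single_Om[OF alt_form_ctr[OF t', of b]], of b]
        Suc.IH[OF alt_form_ctr[OF t', of b]] by (simp add: add.commute del: ctr_apply)
    then show ?case
      using om_linear_sum[OF m.lie_dgmod_axioms u.lie_dgmod_axioms F \<omega>' B(1)]
        om_linear_sum[OF m.lie_dgmod_axioms u.lie_dgmod_axioms G \<omega>' B(1)] calculation by simp
  qed
  show ?thesis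
  proof (cases "n \<ge> 0")
    case True
    then obtain q where q: "n = int q" by (metis nonneg_int_cases)
    \<comment> \<open>The module sits in degree 0, so an element of total degree n has its only
      component in form degree n.\<close>
    have "\<omega> p xs = 0" if "p \<noteq> q" for p xs
      using m.Om_val[OF \<omega>, of p xs] conc[of "n - int p"] that q by simp
    then have "\<omega> = single q (\<omega> q)" by (auto simp: single_def fun_eq_iff)
    then show ?thesis using single_eq[of q "\<omega> q"] m.OmD[OF \<omega>, of q] q by simp
  next
    case False
    have "\<omega> p xs = 0" for p xs
      using m.Om_val[OF \<omega>, of p xs] conc[of "n - int p"] False by simp
    then have "\<omega> = (\<lambda>p xs. 0)" by (simp add: fun_eq_iff)
    then show ?thesis
      using om_linear_zero[OF m.lie_dgmod_axioms u.lie_dgmod_axioms F]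
        om_linear_zero[OF m.lie_dgmod_axioms u.lie_dgmod_axioms G] by simp
  qed
qed

section \<open>A linear contraction of the resolution\<close>

text \<open>Turns the differential, linear only on the graded pieces, into a linear map of the whole
  ambient type, so that a linear right inverse on its image can be chosen.\<close>

lemma linear_on_extend:
  assumes "linear_on_subspace sv sw S f"
  obtains g where "Vector_Spaces.linear sv sw g" "\<And>v. v \<in> S \<Longrightarrow> g v = f v"
proof -
  interpret linear_on_subspace sv sw S f by fact
  interpret vp: vector_space_pair sv sw by unfold_locales
  obtain B where B: "B \<subseteq> S" "v.independent B" "S \<subseteq> v.span B"
    using v.maximal_independent_subset[of S] by blast
  let ?g = "vp.construct B f"
  interpret g: Vector_Spaces.linear sv sw ?g by (rule vp.linear_construct[OF B(2)])
  have "v.span B \<subseteq> {v \<in> S. ?g v = f v}"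
  proof (rule v.span_minimal)
    show "B \<subseteq> {v \<in> S. ?g v = f v}" using B vp.construct_basis[OF B(2)] by auto
    show "v.subspace {v \<in> S. ?g v = f v}"
      unfolding v.subspace_def
      using v.subspace_0[OF sub] v.subspace_add[OF sub] v.subspace_scale[OF sub]
      by (auto simp: g.add g.scale add scale)
  qed
  then show ?thesis using that[of ?g] B(3) g.linear_axioms by blast
qed

text \<open>Let r be linear right inverses of the differentials on their images. Then v - r d v is a
  cycle, and \<open>s\<close> applies r to it. In positive degree this cycle is a boundary, so d s v
  = v - r d v; a boundary d v is its own cycle part, so s d v = r d v, and the sum is v. In degree 0
  the cycle v - r d v is the component in the kernel.\<close>

lemma (in lie_dgmod) contraction_exists:
  assumes "nonneg V" "acyclic_pos V"
  obtains s where "\<And>i v w. s i (v + w) = s i v + s i w" "\<And>i c v. s i (vsc V c v) = vsc V c (s i v)"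
    "\<And>i v. v \<in> carr V i \<Longrightarrow> s i v \<in> carr V (i - 1)"
    "\<And>i v. i \<noteq> 0 \<Longrightarrow> v \<in> carr V i \<Longrightarrow> dif V (i - 1) (s i v) + s (i + 1) (dif V i v) = v"
    "\<And>v. v \<in> carr V 0 \<Longrightarrow> v - s 1 (dif V 0 v) \<in> ker0 V"
proof -
  interpret vp: vector_space_pair "vsc V" "vsc V" by unfold_locales
  have "\<exists>g. Vector_Spaces.linear (vsc V) (vsc V) g \<and> (\<forall>v\<in>carr V i. g v = dif V i v)" for i
    using linear_on_extend[OF linear_on_subspaceI[OF lie_dgmod_axioms dif_linear_on]] by metis
  then obtain d where d: "\<And>i. Vector_Spaces.linear (vsc V) (vsc V) (d i)"
    and dd: "\<And>i v. v \<in> carr V i \<Longrightarrow> d i v = dif V i v" by metis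
  have "\<exists>r. range r \<subseteq> carr V (i - 1) \<and> Vector_Spaces.linear (vsc V) (vsc V) r \<and>
      (\<forall>v\<in>d (i - 1) ` carr V (i - 1). d (i - 1) (r v) = v)" for i
    by (rule vp.linear_exists_right_inverse_on[OF d carr_subspace])
  then obtain r where rr: "\<And>i v. r i v \<in> carr V (i - 1)"
    and r: "\<And>i. Vector_Spaces.linear (vsc V) (vsc V) (r i)"
    and rinv: "\<And>i u. u \<in> carr V (i - 1) \<Longrightarrow> d (i - 1) (r i (d (i - 1) u)) = d (i - 1) u"
    by (metis image_eqI range_subsetD)
  have rinv': "dif V i (r (i + 1) (dif V i u)) = dif V i u" if "u \<in> carr V i" for i u
    using rinv[of u "i + 1"] rr[of "i + 1" "dif V i u"] that by (simp add: dd)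
  note radd = vp.linear_add[OF r] and rscale = vp.linear_scale[OF r]
    and rdiff = vp.linear_diff[OF r]
  note dadd = vp.linear_add[OF d] and dscale = vp.linear_scale[OF d]
  have r0: "r i 0 = 0" for i using rscale[of i 0 0] by simp
  let ?q = "\<lambda>i v. v - r (i + 1) (d i v)"
  let ?s = "\<lambda>i v. r i (?q i v)"
  have qm: "?q i v \<in> carr V i" if "v \<in> carr V i" for i v
    using carr_diff[OF that] rr[of "i + 1"] by simp
  have qz: "dif V i (?q i v) = 0" if "v \<in> carr V i" for i v
  proof -
    have "dif V i (?q i v) = d i v - d i (r (i + 1) (d i v))"
      using dd[OF qm[OF that]] vp.linear_diff[OF d] by simp
    then show ?thesis using rinv'[OF that] dd that rr[of "i + 1"] by simp
  qed
  have sd: "?s (i + 1) (dif V i v) = r (i + 1) (dif V i v)" if "v \<in> carr V i" for i v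
    using dif_dif[OF that] dd[OF dif_mem[OF that]] r0 by simp
  show ?thesis
  proof (rule that[of ?s])
    show "?s i (v + w) = ?s i v + ?s i w" for i v w
      by (simp add: radd rdiff dadd)
    show "?s i (vsc V c v) = vsc V c (?s i v)" for i c v
      by (simp add: rscale rdiff dscale vs.scale_right_diff_distrib)
    show "?s i v \<in> carr V (i - 1)" for i v by (rule rr)
    show "dif V (i - 1) (?s i v) + ?s (i + 1) (dif V i v) = v" if i0: "i \<noteq> 0" and v: "v \<in> carr V i" for i v
    proof (cases "i > 0")
      case True
      then obtain u where u: "u \<in> carr V (i - 1)" "dif V (i - 1) u = ?q i v"
        using assms(2) qm[OF v] qz[OF v] unfolding acyclic_pos_def
        by (metis zle_iff_zadd int_one_le_iff_zero_less)
      have "dif V (i - 1) (?s i v) = ?q i v"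
        using rinv'[OF u(1)] u(2) by simp
      then show ?thesis unfolding sd[OF v] using dd[OF v] by simp
    next
      case False
      then have "v = 0" using i0 v assms(1) by (auto simp: nonneg_def)
      moreover have "d i 0 = 0" using dd[of 0 i] by simp
      moreover have "d (i + 1) 0 = 0" using dd[of 0 "i + 1"] by simp
      ultimately show ?thesis by (simp add: r0)
    qed
    show "v - ?s 1 (dif V 0 v) \<in> ker0 V" if "v \<in> carr V 0" for v
      using sd[OF that] qm[OF that] qz[OF that] dd[OF that] by (simp add: ker0_def)
  qed
qed

section \<open>Strict morphisms and elements of total degree zero\<close>

text \<open>Strict morphisms give weak ones without components of positive form degree: equivariance
  handles d_CE, and the internal differentials carry the same sign (-1)^p on both sides.\<close>

lemma weak_mor_post:
  assumes V: "lie_dgmod_char0 L V" and W: "lie_dgmod_char0 L W"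
    and lin: "\<And>i. linear_on (vsc V) (vsc W) (carr V i) (\<phi> i)"
    and mem: "\<And>i v. v \<in> carr V i \<Longrightarrow> \<phi> i v \<in> carr W i"
    and equiv: "\<And>i x v. v \<in> carr V i \<Longrightarrow> \<phi> i (act V x v) = act W x (\<phi> i v)"
    and dif: "\<And>i v. v \<in> carr V i \<Longrightarrow> \<phi> (i + 1) (dif V i v) = dif W i (\<phi> i v)"
  shows "weak_mor L V W (\<lambda>n \<omega> p xs. \<phi> (n - int p) (\<omega> p xs))"
proof -
  interpret v: lie_dgmod_char0 L V by fact
  interpret w: lie_dgmod_char0 L W by fact
  let ?F = "\<lambda>n \<omega> p xs. \<phi> (n - int p) (\<omega> p xs)"
  note l = v.linear_on_subspaceI[OF w.lie_dgmod_axioms lin]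
  have F: "om_linear L V W 0 1 ?F"
    using om_linear_post[OF V W lin, of 0 1] mem by simp
  have "?F (n + 1) (dtot L V n \<omega>) p xs = dtot L W n (?F n \<omega>) p xs" if \<omega>: "\<omega> \<in> Om L V n" for n \<omega> p xs
  proof -
    have F\<omega>: "?F n \<omega> \<in> Om L W n" using om_linear_mem[OF F \<omega>] by simp
    show ?thesis
    proof (cases p)
      case 0
      then show ?thesis
        using dif[OF v.Om_val[OF \<omega>, of 0 xs]] by (simp add: v.dtot_0[OF \<omega>] w.dtot_0[OF F\<omega>])
    next
      case (Suc q)
      have e: "n + 1 - int (Suc q) = n - int q" by simp
      have d: "dif V (n - int (Suc q)) (\<omega> (Suc q) xs) \<in> carr V (n - int q)"
        using v.dif_mem[OF v.Om_val[OF \<omega>, of "Suc q" xs]] by simp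
      have "\<phi> (n - int q) (ce L V q (\<omega> q) xs + vsc V ((-1) ^ Suc q) (dif V (n - int (Suc q)) (\<omega> (Suc q) xs))) =
        \<phi> (n - int q) (ce L V q (\<omega> q) xs) +
        vsc W ((-1) ^ Suc q) (\<phi> (n - int q) (dif V (n - int (Suc q)) (\<omega> (Suc q) xs)))"
        using linear_on_subspace.add[OF l v.form_val[OF v.form_ce[OF v.OmD[OF \<omega>]]] v.carr_scale[OF d]]
          linear_on_subspace.scale[OF l d] by (simp del: power_Suc)
      also have "\<phi> (n - int q) (ce L V q (\<omega> q) xs) = ce L W q (\<lambda>xs. \<phi> (n - int q) (\<omega> q xs)) xs"
        using ce_post[OF v.lie_dgmod_axioms w.lie_dgmod_axioms lin equiv v.OmD[OF \<omega>, of q], of q xs] by simp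
      also have "\<phi> (n - int q) (dif V (n - int (Suc q)) (\<omega> (Suc q) xs)) =
          dif W (n - int (Suc q)) (\<phi> (n - int (Suc q)) (\<omega> (Suc q) xs))"
        using dif[OF v.Om_val[OF \<omega>, of "Suc q" xs]] by simp
      finally show ?thesis
        unfolding Suc v.dtot_Suc[OF \<omega>] w.dtot_Suc[OF F\<omega>] e .
    qed
  qed
  then show ?thesis using F by (simp add: w.weak_mor_iff fun_eq_iff)
qed

lemma weak_mor_id:
  assumes V: "lie_dgmod_char0 L V"
  shows "weak_mor L V V (\<lambda>n \<omega>. \<omega>)"
  using weak_mor_post[OF V V, of "\<lambda>i v. v"] by (simp add: linear_on_def)

lemma (in lie_dgmod) emb_Om:
  assumes "v \<in> carr V 0"
  shows "emb v \<in> Om L V 0"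
proof (rule OmI)
  fix p
  show "form (0 - int p) p (emb v p)"
  proof (cases p)
    case 0
    then show ?thesis using assms by (simp add: alt_form_0_iff emb_def)
  next
    case (Suc q)
    then have e: "emb v p = (\<lambda>_. 0)" by (simp add: emb_def fun_eq_iff)
    show ?thesis unfolding e by (rule form_zero_form)
  qed
qed

text \<open>The component of form degree p has values in degree -p, where the module is zero for p >
  0. Hence a weak morphism into a non-negative module sends \<open>emb v\<close>, for v of degree 0,
  to its \<open>f00\<close> component and nothing else.\<close>

lemma (in lie_dgmod) Om_0_eq_emb:
  assumes "nonneg V" "\<omega> \<in> Om L V 0"
  shows "\<omega> = emb (\<omega> 0 [])"
proof (intro ext)
  fix p xs
  show "\<omega> p xs = emb (\<omega> 0 []) p xs"
  proof (cases "p = 0")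
    case True
    then show ?thesis using alt_form_zero[OF OmD[OF assms(2), of 0], of xs] by (auto simp: emb_def)
  next
    case False
    then show ?thesis
      using Om_val[OF assms(2), of p xs] assms(1) by (simp add: nonneg_def emb_def)
  qed
qed

subsection \<open>The retraction onto the kernel\<close>

text \<open>\<open>P\<close> is q - R, where q projects values onto the kernel and R raises the form
  degree by one. Its component p sees only the components p and p - 1 of the argument; the third and
  fourth conclusions say what q leaves when component p - 1 vanishes, which is the input for
  iterating \<open>P\<close>.\<close>

lemma (in lie_dgmod_char0) perturbed_projection_exists:
  assumes nn: "nonneg V" and "acyclic_pos V"
  obtains P where "weak_mor L V V P" "homotopic L V V (\<lambda>n \<omega>. \<omega>) P"
    "\<And>n \<omega> p xs. \<omega> \<in> Om L V n \<Longrightarrow> int p \<noteq> n \<Longrightarrow> p = 0 \<or> \<omega> (p - 1) = (\<lambda>_. 0) \<Longrightarrow> P n \<omega> p xs = 0"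
    "\<And>n \<omega> p xs. \<omega> \<in> Om L V n \<Longrightarrow> int p = n \<Longrightarrow> p = 0 \<or> \<omega> (p - 1) = (\<lambda>_. 0) \<Longrightarrow> P n \<omega> p xs \<in> ker0 V"
    "\<And>v. v \<in> ker0 V \<Longrightarrow> P 0 (emb v) = emb v"
proof -
  obtain s where s: "\<And>i v w. s i (v + w) = s i v + s i w" "\<And>i c v. s i (vsc V c v) = vsc V c (s i v)"
    "\<And>i v. v \<in> carr V i \<Longrightarrow> s i v \<in> carr V (i - 1)"
    and contr: "\<And>i v. i \<noteq> 0 \<Longrightarrow> v \<in> carr V i \<Longrightarrow> dif V (i - 1) (s i v) + s (i + 1) (dif V i v) = v"
    and contr0: "\<And>v. v \<in> carr V 0 \<Longrightarrow> v - s 1 (dif V 0 v) \<in> ker0 V"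
    using contraction_exists[OF assms] by blast
  have hm: "homotopy_map L V (s i) i" for i
    using s by unfold_locales auto
  have s0: "s i 0 = 0" for i using s(2)[of i 0 0] by simp
  define q where "q i v = (if i = 0 then v - s 1 (dif V 0 v) else 0)" for i :: int and v
  have E: "dif V (i - 1) (s i v) + s (i + 1) (dif V i v) = v - q i v" if "v \<in> carr V i" for i v
  proof (cases "i = 0")
    case True
    have "s 0 v = 0" using s(3)[of v 0] that True nn by (auto simp: nonneg_def)
    then show ?thesis using True by (simp add: q_def)
  qed (use contr that in \<open>simp add: q_def\<close>)
  have q_mem: "q i v \<in> carr V i" if "v \<in> carr V i" for i v
    using contr0 that by (auto simp: q_def ker0_def)
  have q_lin: "linear_on (vsc V) (vsc V) (carr V i) (q i)" for i
    by (auto simp: linear_on_def q_def s dif_add dif_scale vs.scale_right_diff_distrib)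
  \<comment> \<open>The factor (-1)^p is the Koszul sign of a map of degree -1 passing a
    p-form.\<close>
  define h where "h n \<omega> p xs = vsc V ((-1) ^ p) (s (n - int p) (\<omega> p xs))" for n \<omega> p and xs :: "'g list"
  have h: "om_linear L V V (-1) (-1) h"
    unfolding h_def[abs_def]
    using om_linear_post[OF lie_dgmod_char0_axioms lie_dgmod_char0_axioms, of s "-1" "-1"] s
    by (simp add: linear_on_def)
  have hOm: "h n \<omega> \<in> Om L V (n - 1)" if "\<omega> \<in> Om L V n" for n \<omega>
    using om_linear_mem[OF h that] by simp
  \<comment> \<open>\<open>R\<close> is what D h + h D adds to 1 - q: the commutator of d_CE with
    \<open>s\<close>, with the sign of \<open>h\<close> in form degree p - 1.\<close>
  define R where "R n \<omega> p xs = (if p = 0 then 0 else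
      vsc V ((-1) ^ (p - 1)) (ce_comm L V (s (n - int (p - 1))) (p - 1) (\<omega> (p - 1)) xs))"
    for n :: int and \<omega> p and xs :: "'g list"
  define P where "P n \<omega> p xs = q (n - int p) (\<omega> p xs) - R n \<omega> p xs" for n \<omega> p and xs :: "'g list"
  have R: "om_linear L V V 0 1 R"
  proof (rule om_linearI)
    fix n \<omega> assume \<omega>: "\<omega> \<in> Om L V n"
    show "R n \<omega> \<in> Om L V (n + 0)"
    proof (rule OmI)
      fix p show "form (n + 0 - int p) p (R n \<omega> p)"
      proof (cases p)
        case 0
        then have "R n \<omega> p = (\<lambda>_. 0)" by (simp add: R_def fun_eq_iff)
        from form_zero_form show ?thesis unfolding \<open>R n \<omega> p = (\<lambda>_. 0)\<close> .
      next
        case (Suc r)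
        have "form (n - int r - 1) (Suc r) (ce_comm L V (s (n - int r)) r (\<omega> r))"
          by (rule homotopy_map.form_ce_comm[OF hm OmD[OF \<omega>]])
        from form_smult[OF this, of "(-1) ^ r"] show ?thesis
          by (simp add: Suc R_def[abs_def] algebra_simps)
      qed
    qed
    show "R n (\<lambda>p xs. vsc V a (\<omega> p xs)) p xs = vsc V a (R n \<omega> p xs)" for a p xs
      using homotopy_map.ce_comm_lin[OF hm OmD[OF \<omega>, of "p - 1"] OmD[OF \<omega>, of "p - 1"], of "p - 1" a 0 xs]
      by (cases p) (simp_all add: R_def mult.commute)
    show "R n (\<lambda>p xs. \<omega> p xs + \<omega>' p xs) p xs = R n \<omega> p xs + R n \<omega>' p xs"
      if "\<omega>' \<in> Om L V n" for \<omega>' p xs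
      using homotopy_map.ce_comm_lin[OF hm OmD[OF \<omega>, of "p - 1"] OmD[OF that, of "p - 1"], of "p - 1" 1 1 xs]
      by (cases p) (simp_all add: R_def vs.scale_right_distrib)
    show "R (n + int k) (wedge V k \<eta> \<omega>) p xs = vsc V (1 ^ k) (wedge V k \<eta> (R n \<omega>) p xs)"
      if \<eta>: "sform L k \<eta>" for k \<eta> p xs
    proof (cases "Suc k \<le> p")
      case False
      have R0: "R n \<omega> 0 = (\<lambda>_. 0)" by (simp add: R_def fun_eq_iff)
      have "wedge V k \<eta> (R n \<omega>) p xs = 0"
        using False R0 by (auto simp: wedge_def not_less_eq_eq le_Suc_eq)
      moreover have "R (n + int k) (wedge V k \<eta> \<omega>) p xs = 0"
      proof (cases p)
        case (Suc r)
        then have "wedge V k \<eta> \<omega> r = (\<lambda>_. 0)" using False by (simp add: wedge_def)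
        then show ?thesis using Suc homotopy_map.ce_comm_zero[OF hm] by (simp add: R_def)
      qed (simp add: R_def)
      ultimately show ?thesis by simp
    next
      case True
      then obtain r where r: "p = Suc (k + r)" by (metis add_Suc le_Suc_ex)
      have e: "n + int k - int (k + r) = n - int r" by simp
      have "R (n + int k) (wedge V k \<eta> \<omega>) p xs = vsc V ((-1) ^ (k + r))
          (ce_comm L V (s (n - int r)) (k + r) (wedge1 (vsc V) k r \<eta> (\<omega> r)) xs)"
        unfolding R_def r by (simp add: e wedge_def)
      \<comment> \<open>The sign (-1)^k of the commutator combines with (-1)^(k + r) to (-1)^r, so
        \<open>R\<close> is linear over the forms without a sign.\<close>
      also have "\<dots> = vsc V ((-1) ^ r) (wedge1 (vsc V) k (Suc r) \<eta> (ce_comm L V (s (n - int r)) r (\<omega> r)) xs)"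
        unfolding homotopy_map.ce_comm_wedge1[OF hm \<eta> OmD[OF \<omega>]]
        by (simp add: power_add mult.left_commute flip: power_mult_distrib)
      also have "\<dots> = wedge1 (vsc V) k (Suc r) \<eta> (R n \<omega> (Suc r)) xs"
        by (simp add: R_def[abs_def] vs.wedge1_scale_right)
      also have "\<dots> = vsc V (1 ^ k) (wedge V k \<eta> (R n \<omega>) p xs)"
        by (simp add: wedge_def r Suc_diff_le)
      finally show ?thesis .
    qed
  qed
  have q: "om_linear L V V 0 1 (\<lambda>n \<omega> p xs. q (n - int p) (\<omega> p xs))"
    using om_linear_post[OF lie_dgmod_char0_axioms lie_dgmod_char0_axioms q_lin, of 0 1] q_mem by simp
  have P: "om_linear L V V 0 1 P"
    unfolding P_def[abs_def] by (rule om_linear_minus[OF q R])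
  have POm: "P n \<omega> \<in> Om L V n" if "\<omega> \<in> Om L V n" for n \<omega>
    using om_linear_mem[OF P that] by simp
  \<comment> \<open>The formula q - R gave linearity over the forms; here \<open>P\<close> is
    identified with 1 - (D h + h D), from which commutation with D follows by D D = 0.\<close>
  have key: "\<omega> p xs - P n \<omega> p xs = dtot L V (n - 1) (h n \<omega>) p xs + h (n + 1) (dtot L V n \<omega>) p xs"
    if \<omega>: "\<omega> \<in> Om L V n" for n \<omega> p xs
  proof (cases p)
    case 0
    then show ?thesis
      using E[OF Om_val[OF \<omega>, of 0 xs]]
      by (simp add: dtot_0[OF hOm[OF \<omega>]] dtot_0[OF \<omega>] P_def R_def h_def)
  next
    case (Suc r)
    let ?v = "\<omega> p xs" and ?s = "s (n - int r)"
    have sq: "vsc V ((-1) ^ p) (vsc V ((-1) ^ p) v) = v" for v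
      by (simp flip: power_add mult_2)
    have sv: "s (n - int p) ?v \<in> carr V (n - int p - 1)" by (rule s(3)[OF Om_val[OF \<omega>]])
    have e: "n - 1 - int p = n - int p - 1" "n + 1 - int p = n - int r" "n - int p + 1 = n - int r"
      using Suc by simp_all
    have "dtot L V (n - 1) (h n \<omega>) p xs = ce L V r (h n \<omega> r) xs + vsc V ((-1) ^ p) (dif V (n - 1 - int p) (h n \<omega> p xs))"
      unfolding Suc dtot_Suc[OF hOm[OF \<omega>]] ..
    also have "ce L V r (h n \<omega> r) xs = vsc V ((-1) ^ r) (ce L V r (\<lambda>xs. ?s (\<omega> r xs)) xs)"
      unfolding h_def[abs_def] by (rule ce_scale[OF homotopy_map.form_s[OF hm OmD[OF \<omega>]]])
    also have "vsc V ((-1) ^ p) (dif V (n - 1 - int p) (h n \<omega> p xs)) = dif V (n - int p - 1) (s (n - int p) ?v)"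
      unfolding h_def e dif_scale[OF sv] by (rule sq)
    finally have 1: "dtot L V (n - 1) (h n \<omega>) p xs =
        vsc V ((-1) ^ r) (ce L V r (\<lambda>xs. ?s (\<omega> r xs)) xs) + dif V (n - int p - 1) (s (n - int p) ?v)" .
    have "h (n + 1) (dtot L V n \<omega>) p xs =
        vsc V ((-1) ^ p) (?s (ce L V r (\<omega> r) xs + vsc V ((-1) ^ p) (dif V (n - int p) ?v)))"
      unfolding h_def e unfolding Suc dtot_Suc[OF \<omega>] ..
    also have "\<dots> = - vsc V ((-1) ^ r) (?s (ce L V r (\<omega> r) xs)) + ?s (dif V (n - int p) ?v)"
      unfolding s vs.scale_right_distrib sq by (simp add: Suc)
    finally have 2: "h (n + 1) (dtot L V n \<omega>) p xs =
        - vsc V ((-1) ^ r) (?s (ce L V r (\<omega> r) xs)) + ?s (dif V (n - int p) ?v)" .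
    have 3: "dif V (n - int p - 1) (s (n - int p) ?v) + ?s (dif V (n - int p) ?v) = ?v - q (n - int p) ?v"
      using E[OF Om_val[OF \<omega>, of p xs]] unfolding e .
    have 4: "R n \<omega> p xs = vsc V ((-1) ^ r) (ce L V r (\<lambda>xs. ?s (\<omega> r xs)) xs) - vsc V ((-1) ^ r) (?s (ce L V r (\<omega> r) xs))"
      by (simp add: R_def Suc ce_comm_def vs.scale_right_diff_distrib)
    have "\<omega> p xs - P n \<omega> p xs = (?v - q (n - int p) ?v) + R n \<omega> p xs" by (simp add: P_def)
    also have "\<dots> = dtot L V (n - 1) (h n \<omega>) p xs + h (n + 1) (dtot L V n \<omega>) p xs"
      unfolding 1 2 4 3[symmetric] by (simp add: algebra_simps)
    finally show ?thesis .
  qed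
  have Peq: "P n \<omega> = (\<lambda>p xs. \<omega> p xs - (dtot L V (n - 1) (h n \<omega>) p xs + h (n + 1) (dtot L V n \<omega>) p xs))"
    if "\<omega> \<in> Om L V n" for n \<omega>
    using key[OF that] by (simp add: fun_eq_iff algebra_simps)
  show ?thesis
  proof (rule that[of P])
    show "weak_mor L V V P"
      unfolding weak_mor_iff
    proof (intro conjI P allI impI)
      fix n \<omega> assume \<omega>: "\<omega> \<in> Om L V n"
      have D: "dtot L V n \<omega> \<in> Om L V (n + 1)" by (rule dtot_Om[OF \<omega>])
      have hD: "h (n + 1) (dtot L V n \<omega>) \<in> Om L V n" using hOm[OF D] by simp
      have Dh: "dtot L V (n - 1) (h n \<omega>) \<in> Om L V n" using dtot_Om[OF hOm[OF \<omega>]] by simp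
      have "P (n + 1) (dtot L V n \<omega>) = (\<lambda>p xs. dtot L V n \<omega> p xs - dtot L V n (h (n + 1) (dtot L V n \<omega>)) p xs)"
        unfolding Peq[OF D] dtot_dtot[OF \<omega>] om_linear_zero[OF lie_dgmod_axioms lie_dgmod_axioms h] by simp
      also have "\<dots> = dtot L V n (P n \<omega>)"
        unfolding Peq[OF \<omega>] dtot_diff[OF \<omega> Om_add[OF Dh hD]] dtot_add[OF Dh hD]
        using dtot_dtot[OF hOm[OF \<omega>]] by simp
      finally show "P (n + 1) (dtot L V n \<omega>) = dtot L V n (P n \<omega>)" .
    qed
    have "homotopic L V V P (\<lambda>n \<omega>. \<omega>)"
      unfolding homotopic_iff using h key by (intro exI[of _ h]) (auto simp: fun_eq_iff)
    then show "homotopic L V V (\<lambda>n \<omega>. \<omega>) P"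
      by (rule homotopic_sym[OF lie_dgmod_axioms lie_dgmod_axioms])
    have R0: "R n \<omega> p xs = 0" if "p = 0 \<or> \<omega> (p - 1) = (\<lambda>_. 0)" for n \<omega> p xs
      using that homotopy_map.ce_comm_zero[OF hm] by (auto simp: R_def)
    show "P n \<omega> p xs = 0" if "\<omega> \<in> Om L V n" "int p \<noteq> n" "p = 0 \<or> \<omega> (p - 1) = (\<lambda>_. 0)" for n \<omega> p xs
      using R0[where p = p and \<omega> = \<omega>, OF that(3)] that(2) by (simp add: P_def q_def)
    show "P n \<omega> p xs \<in> ker0 V" if "\<omega> \<in> Om L V n" "int p = n" "p = 0 \<or> \<omega> (p - 1) = (\<lambda>_. 0)" for n \<omega> p xs
      using R0[where p = p and \<omega> = \<omega>, OF that(3)] that(2) contr0[of "\<omega> p xs"] Om_val[OF that(1), of p xs] by (simp add: P_def q_def)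
    show "P 0 (emb v) = emb v" if v: "v \<in> ker0 V" for v
    proof -
      have "P 0 (emb v) = emb (P 0 (emb v) 0 [])"
        using v by (intro Om_0_eq_emb[OF nn] POm emb_Om) (simp add: ker0_def)
      also have "P 0 (emb v) 0 [] = v"
        using v by (simp add: P_def R_def q_def emb_def ker0_def s0)
      finally show ?thesis .
    qed
  qed
qed

section \<open>The kernel as a module in degree zero, and the iterated retraction\<close>

text \<open>Kept on the same ambient type with the same action, so that the forms with values in the
  kernel are a subset of \<open>Om L V n\<close> and the inclusion is the identity.\<close>

definition ker_mod :: "('k, 'g, 'v::ab_group_add) dgmod \<Rightarrow> ('k, 'g, 'v) dgmod" where
  "ker_mod V = V\<lparr>carr := (\<lambda>i. if i = 0 then ker0 V else {0}), dif := (\<lambda>i v. 0)\<rparr>"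

lemma ker_mod_simps [simp]: "vsc (ker_mod V) = vsc V" "act (ker_mod V) = act V"
  "carr (ker_mod V) i = (if i = 0 then ker0 V else {0})" "dif (ker_mod V) i v = 0"
  by (simp_all add: ker_mod_def)

lemma wedge_ker_mod [simp]: "wedge (ker_mod V) = wedge V"
  by (simp add: wedge_def fun_eq_iff)

lemma ce_ker_mod [simp]: "ce L (ker_mod V) = ce L V"
  by (simp add: ce_def fun_eq_iff)

lemma alt_form_subset:
  assumes "alt_form L sv S p \<omega>" "\<And>xs. \<omega> xs \<in> T"
  shows "alt_form L sv T p \<omega>"
  using assms by (simp add: alt_form_def)

context lie_dgmod
begin

lemma ker0_subspace: "vs.subspace (ker0 V)"
  using carr_add[of _ 0] carr_scale[of _ 0]
  by (auto simp: vs.subspace_def ker0_def dif_add dif_scale)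

lemma ker0_act: "v \<in> ker0 V \<Longrightarrow> act V x v \<in> ker0 V"
  using dif_act[of v 0 x] by (simp add: ker0_def act_mem)

lemma ker0_carr: "v \<in> ker0 V \<Longrightarrow> v \<in> carr V 0"
  by (simp add: ker0_def)

lemma ker_mod_dgmod: "lie_dgmod L (ker_mod V)"
proof
  show "lie_algebra L" by (rule lie)
  have "vs.subspace {0}" by (rule vs.subspace_single_0)
  moreover have "\<exists>N::int. \<forall>i. N < \<bar>i\<bar> \<longrightarrow> i \<noteq> 0" by (rule exI[of _ 0]) simp
  ultimately show "dg_module L (ker_mod V)"
    unfolding dg_module_def ker_mod_simps
    using vs.vector_space_axioms ker0_subspace ker0_act
      act_add_left[OF ker0_carr] act_scale_left[OF ker0_carr] act_add[OF ker0_carr ker0_carr]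
      act_scale[OF ker0_carr] act_lbr[OF ker0_carr] act_add_left[OF carr_0] act_lbr[OF carr_0]
      vs.subspace_0[OF ker0_subspace]
    by (intro conjI allI impI) (auto split: if_splits)
qed

lemma Om_ker_mod_iff:
  "\<omega> \<in> Om L (ker_mod V) n \<longleftrightarrow> \<omega> \<in> Om L V n \<and> (\<forall>p xs. \<omega> p xs \<in> (if int p = n then ker0 V else {0}))"
proof -
  interpret k: lie_dgmod L "ker_mod V" by (rule ker_mod_dgmod)
  show ?thesis
  proof (intro iffI conjI allI)
    assume \<omega>: "\<omega> \<in> Om L (ker_mod V) n"
    show *: "\<omega> p xs \<in> (if int p = n then ker0 V else {0})" for p xs
      using k.Om_val[OF \<omega>, of p xs] by (auto split: if_splits)
    show "\<omega> \<in> Om L V n"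
    proof (rule OmI)
      fix p
      have "alt_form L (vsc V) (carr (ker_mod V) (n - int p)) p (\<omega> p)" using k.OmD[OF \<omega>, of p] by simp
      then show "form (n - int p) p (\<omega> p)"
      proof (rule alt_form_subset)
        show "\<omega> p xs \<in> carr V (n - int p)" for xs
          using *[of p xs] by (auto split: if_splits simp: ker0_carr)
      qed
    qed
  next
    assume *: "\<omega> \<in> Om L V n \<and> (\<forall>p xs. \<omega> p xs \<in> (if int p = n then ker0 V else {0}))"
    show "\<omega> \<in> Om L (ker_mod V) n"
    proof (rule k.OmI)
      fix p
      have "alt_form L (vsc V) (carr (ker_mod V) (n - int p)) p (\<omega> p)"
        by (rule alt_form_subset[OF OmD[of \<omega> n p]]) (use * in \<open>auto split: if_splits\<close>)
      then show "k.form (n - int p) p (\<omega> p)" by simp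
    qed
  qed
qed

lemma dtot_ker_mod:
  assumes "\<omega> \<in> Om L (ker_mod V) n"
  shows "dtot L (ker_mod V) n \<omega> = dtot L V n \<omega>"
proof -
  have "dif V (n - int p) (\<omega> p xs) = 0" for p xs
  proof -
    have "\<omega> p xs \<in> (if int p = n then ker0 V else {0})" using assms unfolding Om_ker_mod_iff by blast
    then show ?thesis by (auto simp: ker0_def split: if_splits)
  qed
  then show ?thesis by (simp add: dtot_def fun_eq_iff)
qed

end

lemma weak_mor_incl_ker:
  assumes V: "lie_dgmod_char0 L V"
  shows "weak_mor L (ker_mod V) V (\<lambda>n \<omega>. \<omega>)"
proof -
  interpret v: lie_dgmod_char0 L V by fact
  interpret k: lie_dgmod L "ker_mod V" by (rule v.ker_mod_dgmod)
  have K: "lie_dgmod_char0 L (ker_mod V)" by unfold_locales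
  have "weak_mor L (ker_mod V) V (\<lambda>n \<omega> p xs. (\<lambda>i v. v) (n - int p) (\<omega> p xs))"
    by (rule weak_mor_post[OF K V]) (auto simp: linear_on_def ker0_def split: if_splits)
  then show ?thesis by simp
qed

text \<open>Each application of \<open>P\<close> clears one more form degree from below. In total
  degree n nonzero components have form degree between n - N and n, since the values live in degrees
  0 to N, so finitely many steps leave form degree n with values in the kernel.\<close>

lemma (in lie_dgmod_char0) retraction_exists:
  assumes "nonneg V" "acyclic_pos V"
  obtains Q where "weak_mor L V V Q" "weak_mor L V (ker_mod V) Q" "homotopic L V V (\<lambda>n \<omega>. \<omega>) Q"
    "\<And>v. v \<in> ker0 V \<Longrightarrow> Q 0 (emb v) = emb v"
proof -
  obtain P where P: "weak_mor L V V P" "homotopic L V V (\<lambda>n \<omega>. \<omega>) P"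
    and P0: "\<And>n \<omega> p xs. \<omega> \<in> Om L V n \<Longrightarrow> int p \<noteq> n \<Longrightarrow> p = 0 \<or> \<omega> (p - 1) = (\<lambda>_. 0) \<Longrightarrow> P n \<omega> p xs = 0"
    and Pk: "\<And>n \<omega> p xs. \<omega> \<in> Om L V n \<Longrightarrow> int p = n \<Longrightarrow> p = 0 \<or> \<omega> (p - 1) = (\<lambda>_. 0) \<Longrightarrow> P n \<omega> p xs \<in> ker0 V"
    and Pe: "\<And>v. v \<in> ker0 V \<Longrightarrow> P 0 (emb v) = emb v"
    by (rule perturbed_projection_exists[OF assms]) (rule that)
  note ax = lie_dgmod_char0_axioms
  have POm: "P n \<omega> \<in> Om L V n" if "\<omega> \<in> Om L V n" for n \<omega>
    using that P(1) by (simp add: weak_mor_def)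
  define I where "I j n = (P n ^^ j)" for j n
  have I_Suc: "I (Suc j) = comp_wm P (I j)" for j
    by (simp add: I_def comp_wm_def fun_eq_iff)
  have I_1: "I (Suc 0) = P" by (simp add: I_def fun_eq_iff)
  have IOm: "I j n \<omega> \<in> Om L V n" if "\<omega> \<in> Om L V n" for j n \<omega>
    using that POm by (induction j) (simp_all add: I_def)
  have Iw: "weak_mor L V V (I (Suc j))" for j
  proof (induction j)
    case (Suc j)
    then show ?case unfolding I_Suc[of "Suc j"] by (rule weak_mor_comp[OF ax ax P(1)])
  qed (use P I_1 in simp)
  have Ih: "homotopic L V V (\<lambda>n \<omega>. \<omega>) (I (Suc j))" for j
  proof (induction j)
    case (Suc j)
    have "homotopic L V V (comp_wm P (\<lambda>n \<omega>. \<omega>)) (comp_wm P (I (Suc j)))"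
      by (rule homotopic_comp_left[OF ax ax ax P(1) weak_mor_id[OF ax] Iw Suc.IH])
    then have "homotopic L V V P (I (Suc (Suc j)))"
      unfolding I_Suc[of "Suc j"] by (simp add: comp_wm_def)
    then show ?case by (rule homotopic_trans[OF lie_dgmod_axioms lie_dgmod_axioms P(2)])
  qed (use P I_1 in simp)
  obtain N where N: "\<And>i. \<bar>i\<bar> > N \<Longrightarrow> carr V i = {0}" using dgm by (auto simp: dg_module_def)
  \<comment> \<open>For \<open>j = 0\<close> the values lie in degree above N. If component p - 1 is
    already zero, the next \<open>P\<close> kills component p as well, since p differs from
    n.\<close>
  have I0: "I j n \<omega> p xs = 0" if "\<omega> \<in> Om L V n" "int p < n" "int p < n - N + int j" for j n \<omega> p xs
    using that
  proof (induction j arbitrary: p xs)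
    case 0
    then have "carr V (n - int p) = {0}" by (intro N) simp
    then show ?case using Om_val[OF 0(1), of p xs] by (simp add: I_def)
  next
    case (Suc j)
    have "p = 0 \<or> I j n \<omega> (p - 1) = (\<lambda>_. 0)"
    proof (cases p)
      case (Suc r)
      then have "I j n \<omega> r xs = 0" for xs using Suc.prems by (intro Suc.IH) auto
      then show ?thesis using Suc by (simp add: fun_eq_iff)
    qed simp
    then show ?case
      unfolding I_Suc comp_wm_def using Suc.prems by (intro P0 IOm) auto
  qed
  \<comment> \<open>\<open>nat N\<close> applications clear all form degrees below n, also for
    negative N; the extra one moves the values in form degree n into the kernel.\<close>
  define Q where "Q = I (Suc (nat N))"
  have QK: "Q n \<omega> \<in> Om L (ker_mod V) n" if \<omega>: "\<omega> \<in> Om L V n" for n \<omega>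
    unfolding Om_ker_mod_iff
  proof (intro conjI allI)
    show "Q n \<omega> \<in> Om L V n" unfolding Q_def by (rule IOm[OF \<omega>])
    fix p xs
    consider "int p = n" | "int p < n" | "int p > n" by linarith
    then show "Q n \<omega> p xs \<in> (if int p = n then ker0 V else {0})"
    proof cases
      case 1
      have "p = 0 \<or> I (nat N) n \<omega> (p - 1) = (\<lambda>_. 0)"
      proof (cases p)
        case (Suc r)
        then have "I (nat N) n \<omega> r xs = 0" for xs using 1 by (intro I0[OF \<omega>]) auto
        then show ?thesis using Suc by (simp add: fun_eq_iff)
      qed simp
      then show ?thesis
        unfolding Q_def I_Suc comp_wm_def using Pk[OF IOm[OF \<omega>] 1] 1 by simp
    next
      case 2
      then have "Q n \<omega> p xs = 0" unfolding Q_def by (intro I0[OF \<omega>]) auto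
      then show ?thesis using 2 by simp
    next
      case 3
      then have "carr V (n - int p) = {0}" using assms(1) by (simp add: nonneg_def)
      then show ?thesis using Om_val[OF IOm[OF \<omega>], of "Suc (nat N)" p xs] 3 by (simp add: Q_def)
    qed
  qed
  have Qw: "weak_mor L V V Q" unfolding Q_def by (rule Iw)
  show ?thesis
  proof (rule that[of Q])
    show "weak_mor L V V Q" by (rule Qw)
    show "weak_mor L V (ker_mod V) Q"
      using Qw QK dtot_ker_mod[OF QK] unfolding weak_mor_def by simp
    show "homotopic L V V (\<lambda>n \<omega>. \<omega>) Q" unfolding Q_def by (rule Ih)
    show "Q 0 (emb v) = emb v" if "v \<in> ker0 V" for v
    proof -
      have "I j 0 (emb v) = emb v" for j
        by (induction j) (simp_all add: I_def Pe[OF that])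
      then show ?thesis by (simp add: Q_def)
    qed
  qed
qed

section \<open>Weak morphisms out of the kernel and the lifts they induce\<close>

lemma adj_dgmod:
  fixes L :: "('k::field_char_0, 'g::ab_group_add) lie"
  assumes lie: "lie_algebra L"
  shows "lie_dgmod_char0 L (adj L)"
proof
  interpret vector_space "lsc L" using lie by (simp add: lie_algebra_def)
  note l = lie_algebra_simps[OF lie]
  have jac: "lbr L (lbr L x y) z = lbr L x (lbr L y z) - lbr L y (lbr L x z)" for x y z
    using lie_algebra_jacobi[OF lie, of x y z] by simp
  have l0: "lbr L x 0 = 0" for x using l(4)[of x 0 0] by simp
  have b: "\<exists>N::int. \<forall>i. N < \<bar>i\<bar> \<longrightarrow> i \<noteq> 0" by (rule exI[of _ 0]) simp
  show "lie_algebra L" by (rule lie)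
  show "dg_module L (adj L)"
    using vector_space_axioms subspace_UNIV subspace_single_0 l jac b
    by (auto simp: dg_module_def adj_def l0)
qed

lemma nonneg_adj: "nonneg (adj L)"
  by (simp add: nonneg_def adj_def)

text \<open>The value of \<open>F\<close> on \<open>v\<close> is closed because \<open>D v\<close> has form degree \<open>1\<close>, hence so has \<open>F (D v)\<close>.\<close>

lemma weak_mor_ker_mod:
  fixes L :: "('k::field_char_0, 'g::ab_group_add) lie"
  assumes V: "lie_dgmod_char0 L V" and W: "lie_dgmod_char0 L W" and fin: "finite_dim L"
    and nn: "nonneg W" and F: "weak_mor L (ker_mod V) W F" and v: "v \<in> ker0 V"
  shows "F 0 (emb v) = emb (f00 F v)" "f00 F v \<in> ker0 W"
proof -
  interpret v: lie_dgmod_char0 L V by fact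
  interpret w: lie_dgmod_char0 L W by fact
  interpret k: lie_dgmod L "ker_mod V" by (rule v.ker_mod_dgmod)
  have K: "lie_dgmod_char0 L (ker_mod V)" by unfold_locales
  have F': "om_linear L (ker_mod V) W 0 1 F" using F by (simp add: w.weak_mor_iff)
  have eOm: "emb u \<in> Om L (ker_mod V) 0" if "u \<in> ker0 V" for u
    using that by (intro k.emb_Om) simp
  have Fe: "F 0 (emb u) \<in> Om L W 0" if "u \<in> ker0 V" for u
    using om_linear_mem[OF F' eOm[OF that]] by simp
  have emb: "F 0 (emb u) = emb (f00 F u)" if "u \<in> ker0 V" for u
    using w.Om_0_eq_emb[OF nn Fe[OF that]] by (simp add: f00_def)
  show "F 0 (emb v) = emb (f00 F v)" by (rule emb[OF v])
  define g where "g i u = (if i = 0 then f00 F u else 0)" for i :: int and u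
  have emb_add: "emb (a + b) = (\<lambda>p xs. emb a p xs + emb b p xs)" for a b :: "'c::ab_group_add"
    by (auto simp: emb_def fun_eq_iff)
  have emb_scale: "emb (vsc V c a) = (\<lambda>p xs. vsc (ker_mod V) c (emb a p xs))" for a c
    by (auto simp: emb_def fun_eq_iff)
  have g_lin: "linear_on (vsc V) (vsc W) (ker0 V) (f00 F)"
    using om_linear_add[OF F' eOm eOm] om_linear_scale[OF F' eOm]
    by (simp add: linear_on_def f00_def emb_add emb_scale)
  have "om_linear L (ker_mod V) W 0 1 (\<lambda>n \<omega> p xs. vsc W (1 ^ p) (g (n - int p) (\<omega> p xs)))"
  proof (rule om_linear_post[OF K W])
    show "linear_on (vsc (ker_mod V)) (vsc W) (carr (ker_mod V) i) (g i)" for i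
      using g_lin by (auto simp: g_def linear_on_def)
    show "g i u \<in> carr W (i + 0)" if "u \<in> carr (ker_mod V) i" for i u
      using that w.Om_val[OF Fe, of u 0 "[]"] by (auto simp: g_def f00_def split: if_splits)
  qed
  then have g: "om_linear L (ker_mod V) W 0 1 (\<lambda>n \<omega> p xs. g (n - int p) (\<omega> p xs))" by simp
  \<comment> \<open>At this point \<open>g\<close> is known to be linear over the forms but not to
    respect the differentials; agreement with \<open>F\<close> on \<open>emb u\<close> already
    forces equality.\<close>
  have Fg: "F n \<omega> = (\<lambda>p xs. g (n - int p) (\<omega> p xs))" if "\<omega> \<in> Om L (ker_mod V) n" for n \<omega>
  proof (rule om_linear_eqI[OF K W fin _ F' g _ that])
    show "carr (ker_mod V) i = {0}" if "i \<noteq> 0" for i using that by simp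
    have f0: "f00 F 0 = 0"
      using linear_on_subspace.zero[of "vsc V" "vsc W" "ker0 V" "f00 F"] g_lin v.ker0_subspace
        v.vs.vector_space_axioms w.vs.vector_space_axioms
      by (simp add: linear_on_subspace_def linear_on_subspace_axioms_def)
    show "F 0 (emb u) = (\<lambda>p xs. g (0 - int p) (emb u p xs))" if "u \<in> carr (ker_mod V) 0" for u
      using emb[of u] that f0 by (auto simp: g_def emb_def fun_eq_iff)
  qed
  have "dif W 0 (f00 F v) = dtot L W 0 (F 0 (emb v)) 0 []"
    by (simp add: w.dtot_0[OF Fe[OF v]] f00_def)
  also have "\<dots> = F 1 (dtot L (ker_mod V) 0 (emb v)) 0 []"
    using F eOm[OF v] unfolding w.weak_mor_iff by (metis add_0)
  \<comment> \<open>In total degree 1 the component of form degree 0 has values of degree 1, where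
    \<open>g\<close> is zero by definition.\<close>
  also have "\<dots> = 0"
    using Fg[OF k.dtot_Om[OF eOm[OF v]]] by (simp add: g_def)
  finally show "f00 F v \<in> ker0 W"
    using w.Om_val[OF Fe[OF v], of 0 "[]"] by (simp add: ker0_def f00_def)
qed

theorem theorem1p22:
  fixes L :: "('k::field_char_0, 'g::ab_group_add) lie"
    and V :: "('k, 'g, 'v::ab_group_add) dgmod"
    and W :: "('k, 'g, 'w::ab_group_add) dgmod"
    and \<alpha> :: "int \<Rightarrow> (nat \<Rightarrow> 'g list \<Rightarrow> 'v) \<Rightarrow> (nat \<Rightarrow> 'g list \<Rightarrow> 'g)"
    and \<beta> :: "int \<Rightarrow> (nat \<Rightarrow> 'g list \<Rightarrow> 'w) \<Rightarrow> (nat \<Rightarrow> 'g list \<Rightarrow> 'g)"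
    and sG :: "'k \<Rightarrow> 'a::ab_group_add \<Rightarrow> 'a" and aG :: "'g \<Rightarrow> 'a \<Rightarrow> 'a" and X :: "'a \<Rightarrow> 'g"
    and sH :: "'k \<Rightarrow> 'b::ab_group_add \<Rightarrow> 'b" and aH :: "'g \<Rightarrow> 'b \<Rightarrow> 'b" and Y :: "'b \<Rightarrow> 'g"
    and \<iota> :: "'v \<Rightarrow> 'a" and \<kappa> :: "'w \<Rightarrow> 'b"
    and \<phi> :: "'a \<Rightarrow> 'b"
  assumes "lie_algebra L" and "finite_dim L"
    and "dg_LP L V \<alpha>" and "dg_LP L W \<beta>"
    and "LP_module L sG aG X" and "LP_module L sH aH Y"
    and "H0_iso L V \<alpha> sG aG X \<iota>" and "H0_iso L W \<beta> sH aH Y \<kappa>"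
    and "acyclic_pos V"
    and "LP_mor L sG aG X sH aH Y \<phi>"
  shows "\<exists>f. (weak_mor L V W f \<and> homotopic L V (adj L) \<alpha> (comp_wm \<beta> f) \<and>
              (\<forall>v \<in> ker0 V. \<kappa> (f00 f v) = \<phi> (\<iota> v))) \<and>
            (\<forall>f'. weak_mor L V W f' \<and> homotopic L V (adj L) \<alpha> (comp_wm \<beta> f') \<and>
                  (\<forall>v \<in> ker0 V. \<kappa> (f00 f' v) = \<phi> (\<iota> v)) \<longrightarrow> homotopic L V W f f')"
proof -
  note fin = assms(2)
  have V: "lie_dgmod_char0 L V" and W: "lie_dgmod_char0 L W"
    and nnV: "nonneg V" and nnW: "nonneg W"
    and \<alpha>: "weak_mor L V (adj L) \<alpha>" and \<beta>: "weak_mor L W (adj L) \<beta>"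
    using assms(1,3,4) by (auto simp: dg_LP_def lie_dgmod_char0_def lie_dgmod_def)
  interpret v: lie_dgmod_char0 L V by fact
  interpret w: lie_dgmod_char0 L W by fact
  interpret k: lie_dgmod L "ker_mod V" by (rule v.ker_mod_dgmod)
  note A = adj_dgmod[OF assms(1)]
  interpret a: lie_dgmod_char0 L "adj L" by (rule A)
  have K: "lie_dgmod_char0 L (ker_mod V)" by unfold_locales
  obtain Q where Q: "weak_mor L V V Q" "weak_mor L V (ker_mod V) Q" "homotopic L V V (\<lambda>n \<omega>. \<omega>) Q"
    and Qe: "\<And>v. v \<in> ker0 V \<Longrightarrow> Q 0 (emb v) = emb v"
    using v.retraction_exists[OF nnV assms(9)] by metis
  have QK: "Q n \<omega> \<in> Om L (ker_mod V) n" if "\<omega> \<in> Om L V n" for n \<omega>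
    using that Q(2) by (simp add: weak_mor_def)
  \<comment> \<open>Both required homotopies are instances of this one, for \<open>\<alpha>\<close>
    and for a competing lift.\<close>
  have homQ: "homotopic L V U G (comp_wm G Q)" if "lie_dgmod_char0 L U" "weak_mor L V U G"
    for U :: "('k, 'g, 'u::ab_group_add) dgmod" and G
    using homotopic_comp_left[OF V V that(1,2) weak_mor_id[OF V] Q(1,3)] by (simp add: comp_wm_def)

  have \<iota>: "\<And>v w. v \<in> ker0 V \<Longrightarrow> w \<in> ker0 V \<Longrightarrow> \<iota> (v + w) = \<iota> v + \<iota> w"
    "\<And>c v. v \<in> ker0 V \<Longrightarrow> \<iota> (vsc V c v) = sG c (\<iota> v)"
    "\<And>x v. v \<in> ker0 V \<Longrightarrow> \<iota> (act V x v) = aG x (\<iota> v)"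
    "\<And>v. v \<in> ker0 V \<Longrightarrow> X (\<iota> v) = f00 \<alpha> v"
    using assms(7) by (auto simp: H0_iso_def)
  have \<kappa>: "\<And>v w. v \<in> ker0 W \<Longrightarrow> w \<in> ker0 W \<Longrightarrow> \<kappa> (v + w) = \<kappa> v + \<kappa> w"
    "\<And>c v. v \<in> ker0 W \<Longrightarrow> \<kappa> (vsc W c v) = sH c (\<kappa> v)"
    "\<And>x v. v \<in> ker0 W \<Longrightarrow> \<kappa> (act W x v) = aH x (\<kappa> v)"
    "\<And>v. v \<in> ker0 W \<Longrightarrow> Y (\<kappa> v) = f00 \<beta> v"
    and \<kappa>b: "bij_betw \<kappa> (ker0 W) UNIV"
    using assms(8) by (auto simp: H0_iso_def)
  have \<phi>: "\<And>v w. \<phi> (v + w) = \<phi> v + \<phi> w" "\<And>c v. \<phi> (sG c v) = sH c (\<phi> v)"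
    "\<And>x v. \<phi> (aG x v) = aH x (\<phi> v)" "\<And>v. Y (\<phi> v) = X v"
    using assms(10) by (auto simp: LP_mor_def)
  have \<kappa>_inj: "x = y" if "x \<in> ker0 W" "y \<in> ker0 W" "\<kappa> x = \<kappa> y" for x y
    using \<kappa>b that by (auto simp: bij_betw_def inj_on_def)
  \<comment> \<open>Surjectivity of \<open>\<kappa>\<close> puts this into the kernel of W;
    linearity and equivariance are then tested after applying \<open>\<kappa>\<close>, which is
    injective there.\<close>
  define \<psi> where "\<psi> u = inv_into (ker0 W) \<kappa> (\<phi> (\<iota> u))" for u
  have \<psi>_mem: "\<psi> u \<in> ker0 W" and \<kappa>\<psi>: "\<kappa> (\<psi> u) = \<phi> (\<iota> u)" for u
    using \<kappa>b inv_into_into[of "\<phi> (\<iota> u)" \<kappa> "ker0 W"] f_inv_into_f[of "\<phi> (\<iota> u)" \<kappa> "ker0 W"]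
    by (auto simp: \<psi>_def bij_betw_def)
  have kadd: "x + y \<in> ker0 W" and kscale: "vsc W c x \<in> ker0 W" if "x \<in> ker0 W" "y \<in> ker0 W" for x y c
    using that w.vs.subspace_add[OF w.ker0_subspace] w.vs.subspace_scale[OF w.ker0_subspace] by auto
  have \<psi>_lin: "linear_on (vsc V) (vsc W) (ker0 V) \<psi>"
    unfolding linear_on_def
  proof (intro conjI ballI allI)
    show "\<psi> (u + u') = \<psi> u + \<psi> u'" if "u \<in> ker0 V" "u' \<in> ker0 V" for u u'
      using that \<psi>_mem kadd by (intro \<kappa>_inj) (auto simp: \<kappa>\<psi> \<kappa> \<iota> \<phi>)
    show "\<psi> (vsc V c u) = vsc W c (\<psi> u)" if "u \<in> ker0 V" for c u
      using that \<psi>_mem kscale by (intro \<kappa>_inj) (auto simp: \<kappa>\<psi> \<kappa> \<iota> \<phi>)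
  qed
  have \<psi>_act: "\<psi> (act V x u) = act W x (\<psi> u)" if "u \<in> ker0 V" for x u
    using that \<psi>_mem w.ker0_act by (intro \<kappa>_inj) (auto simp: \<kappa>\<psi> \<kappa> \<iota> \<phi>)
  \<comment> \<open>\<open>\<psi>\<close> respects the action on the kernel of V, so the source of
    this strict map is \<open>ker_mod V\<close>; only the composite with \<open>Q\<close> is a weak
    morphism on V.\<close>
  define \<Psi> where "\<Psi> n \<omega> p xs = (if n - int p = 0 then \<psi> else (\<lambda>_. 0)) (\<omega> p xs)"
    for n and \<omega> :: "nat \<Rightarrow> 'g list \<Rightarrow> 'v" and p xs
  have \<Psi>: "weak_mor L (ker_mod V) W \<Psi>"
    unfolding \<Psi>_def[abs_def]
  proof (rule weak_mor_post[OF K W, of "\<lambda>i. if i = 0 then \<psi> else (\<lambda>_. 0)"])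
    show "linear_on (vsc (ker_mod V)) (vsc W) (carr (ker_mod V) i) (if i = 0 then \<psi> else (\<lambda>_. 0))" for i
      using \<psi>_lin by (auto simp: linear_on_def)
    show "(if i = 0 then \<psi> else (\<lambda>_. 0)) u \<in> carr W i" for i :: int and u
      using \<psi>_mem w.ker0_carr by auto
    show "(if i = 0 then \<psi> else (\<lambda>_. 0)) (act (ker_mod V) x u) = act W x ((if i = 0 then \<psi> else (\<lambda>_. 0)) u)"
      if "u \<in> carr (ker_mod V) i" for i x u
      using that \<psi>_act by auto
    have "\<psi> 0 = 0"
      using \<psi>_lin v.vs.subspace_0[OF v.ker0_subspace] unfolding linear_on_def
      by (metis v.vs.scale_zero_left w.vs.scale_zero_left)
    then show "(if i + 1 = 0 then \<psi> else (\<lambda>_. 0)) (dif (ker_mod V) i u) = dif W i ((if i = 0 then \<psi> else (\<lambda>_. 0)) u)"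
      for i :: int and u
      using \<psi>_mem by (auto simp: ker0_def)
  qed
  have \<Psi>e: "f00 \<Psi> u = \<psi> u" for u
    by (simp add: f00_def \<Psi>_def emb_def)
  have conc: "carr (ker_mod V) i = {0}" if "i \<noteq> 0" for i using that by simp
  have restr: "weak_mor L (ker_mod V) U G" if "lie_dgmod_char0 L U" "weak_mor L V U G"
    for U :: "('k, 'g, 'u::ab_group_add) dgmod" and G
    using weak_mor_comp[OF V that weak_mor_incl_ker[OF V]] by (simp add: comp_wm_def)

  define f where "f = comp_wm \<Psi> Q"
  have f: "weak_mor L V W f"
    unfolding f_def by (rule weak_mor_comp[OF K W \<Psi> Q(2)])
  have "homotopic L V (adj L) \<alpha> (comp_wm \<beta> f)"
  proof (rule homotopic_cong[OF homQ[OF A \<alpha>]])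
    fix n \<omega> assume "\<omega> \<in> Om L V n"
    note \<beta>\<Psi> = weak_mor_comp[OF W A \<beta> \<Psi>] and \<alpha>K = restr[OF A \<alpha>]
    \<comment> \<open>On the image of \<open>Q\<close> the two weak morphisms are equal, not merely
      homotopic: both are determined by their values on the kernel, which agree because \<phi>
      intertwines X and Y.\<close>
    have "\<alpha> n (Q n \<omega>) = comp_wm \<beta> \<Psi> n (Q n \<omega>)"
    proof (rule om_linear_eqI[OF K A fin conc _ _ _ QK[OF \<open>\<omega> \<in> Om L V n\<close>]])
      show "om_linear L (ker_mod V) (adj L) 0 1 \<alpha>" "om_linear L (ker_mod V) (adj L) 0 1 (comp_wm \<beta> \<Psi>)"
        using \<beta>\<Psi> \<alpha>K by (simp_all add: a.weak_mor_iff)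
      fix u assume "u \<in> carr (ker_mod V) 0"
      then have u: "u \<in> ker0 V" by simp
      have "f00 (comp_wm \<beta> \<Psi>) u = \<beta> 0 (\<Psi> 0 (emb u)) 0 []" by (simp add: f00_def comp_wm_def)
      also have "\<dots> = f00 \<beta> (\<psi> u)"
        using weak_mor_ker_mod(1)[OF V W fin nnW \<Psi> u] by (simp add: f00_def[of \<beta>] \<Psi>e)
      also have "\<dots> = f00 \<alpha> u"
        using \<kappa>(4)[OF \<psi>_mem] \<iota>(4)[OF u] by (simp add: \<kappa>\<psi> \<phi>)
      finally show "\<alpha> 0 (emb u) = comp_wm \<beta> \<Psi> 0 (emb u)"
        using weak_mor_ker_mod(1)[OF V A fin nonneg_adj \<alpha>K u] weak_mor_ker_mod(1)[OF V A fin nonneg_adj \<beta>\<Psi> u]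
        by simp
    qed
    then show "comp_wm \<alpha> Q n \<omega> = comp_wm \<beta> f n \<omega>" by (simp add: f_def comp_wm_def)
  qed simp
  moreover have "\<kappa> (f00 f u) = \<phi> (\<iota> u)" if "u \<in> ker0 V" for u
    using Qe[OF that] \<Psi>e[of u] by (simp add: f_def f00_def comp_wm_def \<kappa>\<psi>)
  moreover have "homotopic L V W f f'"
    if f': "weak_mor L V W f'" and f'e: "\<forall>v \<in> ker0 V. \<kappa> (f00 f' v) = \<phi> (\<iota> v)" for f'
  proof -
    note f'K = restr[OF W f']
    have "homotopic L V W f' f"
    proof (rule homotopic_cong[OF homQ[OF W f']])
      fix n \<omega> assume "\<omega> \<in> Om L V n"
      have "f' n (Q n \<omega>) = \<Psi> n (Q n \<omega>)"
      proof (rule om_linear_eqI[OF K W fin conc _ _ _ QK[OF \<open>\<omega> \<in> Om L V n\<close>]])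
        show "om_linear L (ker_mod V) W 0 1 f'" "om_linear L (ker_mod V) W 0 1 \<Psi>"
          using f'K \<Psi> by (simp_all add: w.weak_mor_iff)
        fix u assume "u \<in> carr (ker_mod V) 0"
        then have u: "u \<in> ker0 V" by simp
        \<comment> \<open>\<open>\<kappa>\<close> is injective on the kernel of W, so it matters
          that f' sends cycles to cycles, the second part of
          \<open>weak_mor_ker_mod\<close>.\<close>
        have "f00 f' u = \<psi> u"
          using f'e u \<psi>_mem weak_mor_ker_mod(2)[OF V W fin nnW f'K u] by (intro \<kappa>_inj) (auto simp: \<kappa>\<psi>)
        then show "f' 0 (emb u) = \<Psi> 0 (emb u)"
          using weak_mor_ker_mod(1)[OF V W fin nnW f'K u] weak_mor_ker_mod(1)[OF V W fin nnW \<Psi> u]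
          by (simp add: \<Psi>e)
      qed
      then show "comp_wm f' Q n \<omega> = f n \<omega>" by (simp add: f_def comp_wm_def)
    qed simp
    then show ?thesis by (rule homotopic_sym[OF v.lie_dgmod_axioms w.lie_dgmod_axioms])
  qed
  ultimately show ?thesis using f by blast
qed

end
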